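(* Let $G$ be a finitely presented group. The word problem in $\mathfrak{X}(G)$ is soluble if and only if the word problem in $G$ is soluble.
   Context: For a group $G$, let $\overline{G}$ be a second copy of $G$ with a fixed isomorphism $g\mapsto\overline{g}$. The group $\mathfrak{X}(G)$ is the quotient of the free product $G\ast\overline{G}$ by the normal closure of $\{[g,\overline{g}] : g\in G\}$. It is known that $\mathfrak{X}(G)$ is finitely presented whenever $G$ is. *)

theory Defs
  imports "HOL-Algebra.Generated_Groups" "HOL-Library.Nat_Bijection"
begin

text \<open>
  The congruence on the free monoid of all words over the alphabet \<open>S\<close> generated by the
  pairs of words in \<open>E\<close>, and the corresponding quotient monoid.
\<close>

inductive_set word_cong :: "'s set \<Rightarrow> ('s list \<times> 's list) set \<Rightarrow> ('s list \<times> 's list) set"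
  for S :: "'s set" and E :: "('s list \<times> 's list) set" where
  base: "\<lbrakk>(l, r) \<in> E; l \<in> lists S; r \<in> lists S; u \<in> lists S; v \<in> lists S\<rbrakk>
    \<Longrightarrow> (u @ l @ v, u @ r @ v) \<in> word_cong S E"
| refl: "w \<in> lists S \<Longrightarrow> (w, w) \<in> word_cong S E"
| sym: "(u, v) \<in> word_cong S E \<Longrightarrow> (v, u) \<in> word_cong S E"
| trans: "\<lbrakk>(u, v) \<in> word_cong S E; (v, w) \<in> word_cong S E\<rbrakk> \<Longrightarrow> (u, w) \<in> word_cong S E"

definition word_quotient :: "'s set \<Rightarrow> ('s list \<times> 's list) set \<Rightarrow> 's list set monoid" where
  "word_quotient S E =
    \<lparr>carrier = lists S // word_cong S E,
     monoid.mult = (\<lambda>A B. \<Union>u\<in>A. \<Union>v\<in>B. word_cong S E `` {u @ v}),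
     one = word_cong S E `` {[]}\<rparr>"

lemma word_cong_lists: "(u, v) \<in> word_cong S E \<Longrightarrow> u \<in> lists S \<and> v \<in> lists S"
  by (induction rule: word_cong.induct) auto

lemma equiv_word_cong: "equiv (lists S) (word_cong S E)"
proof (rule equivI)
  show "word_cong S E \<subseteq> lists S \<times> lists S"
    using word_cong_lists by fastforce
  show "refl_on (lists S) (word_cong S E)"
    by (intro refl_onI word_cong.refl)
  show "sym (word_cong S E)"
    by (intro symI) (rule word_cong.sym)
  show "trans (word_cong S E)"
    by (auto intro: transI word_cong.trans)
qed

lemma word_cong_context:
  assumes "(u, v) \<in> word_cong S E" "x \<in> lists S" "y \<in> lists S"
  shows "(x @ u @ y, x @ v @ y) \<in> word_cong S E"
  using assms
proof (induction rule: word_cong.induct)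
  case (base l r u v)
  then have "((x @ u) @ l @ (v @ y), (x @ u) @ r @ (v @ y)) \<in> word_cong S E"
    by (intro word_cong.base) auto
  then show ?case by simp
next
  case (trans u v w)
  then show ?case using word_cong.trans by metis
qed (auto intro!: word_cong.refl intro: word_cong.sym simp flip: in_lists_conv_set)

lemma word_cong_append:
  assumes "(u, u') \<in> word_cong S E" "(v, v') \<in> word_cong S E"
  shows "(u @ v, u' @ v') \<in> word_cong S E"
proof -
  have "(u @ v, u' @ v) \<in> word_cong S E"
    using word_cong_context[OF assms(1), of "[]" v] word_cong_lists[OF assms(2)] by simp
  moreover have "(u' @ v, u' @ v') \<in> word_cong S E"
    using word_cong_context[OF assms(2), of u' "[]"] word_cong_lists[OF assms(1)] by simp
  ultimately show ?thesis by (rule word_cong.trans)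
qed

lemma word_quotient_mult:
  assumes "u \<in> lists S" "v \<in> lists S"
  shows "word_cong S E `` {u} \<otimes>\<^bsub>word_quotient S E\<^esub> word_cong S E `` {v}
    = word_cong S E `` {u @ v}"
proof -
  have "congruent2 (word_cong S E) (word_cong S E) (\<lambda>u v. word_cong S E `` {u @ v})"
    by (intro congruent2I' equiv_class_eq[OF equiv_word_cong] word_cong_append)
  from UN_equiv_class2[OF equiv_word_cong equiv_word_cong this assms]
  show ?thesis by (simp add: word_quotient_def)
qed

lemma group_word_quotient:
  assumes "\<And>s. s \<in> S \<Longrightarrow> \<exists>t\<in>S. ([t, s], []) \<in> word_cong S E"
  shows "group (word_quotient S E)"
proof -
  have carr: "A \<in> carrier (word_quotient S E) \<longleftrightarrow> (\<exists>u\<in>lists S. A = word_cong S E `` {u})" for A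
    by (auto simp: word_quotient_def quotient_def)
  have one: "\<one>\<^bsub>word_quotient S E\<^esub> = word_cong S E `` {[]}"
    by (simp add: word_quotient_def)
  have inverse: "\<exists>v\<in>lists S. (v @ u, []) \<in> word_cong S E" if "u \<in> lists S" for u
    using that
  proof (induction u)
    case Nil
    show ?case by (rule bexI[of _ "[]"]) (auto intro: word_cong.refl)
  next
    case (Cons s u)
    then obtain v where v: "v \<in> lists S" "(v @ u, []) \<in> word_cong S E" by auto
    from Cons obtain t where t: "t \<in> S" "([t, s], []) \<in> word_cong S E" using assms by fastforce
    have "(v @ [t, s] @ u, v @ [] @ u) \<in> word_cong S E"
      using word_cong_context[OF t(2), of v u] v Cons by auto
    then have "((v @ [t]) @ s # u, []) \<in> word_cong S E"
      using v(2) word_cong.trans by fastforce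
    with v t show ?case by (intro bexI[of _ "v @ [t]"]) auto
  qed
  show ?thesis
  proof (rule groupI)
    fix A assume "A \<in> carrier (word_quotient S E)"
    then obtain u where u: "u \<in> lists S" "A = word_cong S E `` {u}" by (auto simp: carr)
    then obtain v where v: "v \<in> lists S" "(v @ u, []) \<in> word_cong S E" using inverse by blast
    have "word_cong S E `` {v} \<otimes>\<^bsub>word_quotient S E\<^esub> A = \<one>\<^bsub>word_quotient S E\<^esub>"
      using word_quotient_mult[OF v(1) u(1)] equiv_class_eq[OF equiv_word_cong v(2)] u(2)
      by (simp add: one)
    then show "\<exists>B\<in>carrier (word_quotient S E). B \<otimes>\<^bsub>word_quotient S E\<^esub> A = \<one>\<^bsub>word_quotient S E\<^esub>"
      using v carr by blast
  next
    fix A B C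
    assume "A \<in> carrier (word_quotient S E)" "B \<in> carrier (word_quotient S E)"
      "C \<in> carrier (word_quotient S E)"
    then obtain u v w where "u \<in> lists S" "v \<in> lists S" "w \<in> lists S"
      "A = word_cong S E `` {u}" "B = word_cong S E `` {v}" "C = word_cong S E `` {w}"
      unfolding carr by metis
    moreover from this have "u @ v \<in> lists S" "v @ w \<in> lists S" by auto
    ultimately show "A \<otimes>\<^bsub>word_quotient S E\<^esub> B \<otimes>\<^bsub>word_quotient S E\<^esub> C =
        A \<otimes>\<^bsub>word_quotient S E\<^esub> (B \<otimes>\<^bsub>word_quotient S E\<^esub> C)"
      by (simp only: word_quotient_mult append_assoc)
  next
    fix A B
    assume "A \<in> carrier (word_quotient S E)" "B \<in> carrier (word_quotient S E)"
    then obtain u v where "u \<in> lists S" "v \<in> lists S"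
      "A = word_cong S E `` {u}" "B = word_cong S E `` {v}"
      unfolding carr by metis
    moreover from this have "u @ v \<in> lists S" by auto
    ultimately show "A \<otimes>\<^bsub>word_quotient S E\<^esub> B \<in> carrier (word_quotient S E)"
      unfolding carr using word_quotient_mult by metis
  next
    show "\<one>\<^bsub>word_quotient S E\<^esub> \<in> carrier (word_quotient S E)"
      unfolding carr one by (intro bexI[of _ "[]"]) auto
  next
    fix A assume "A \<in> carrier (word_quotient S E)"
    then obtain u where "u \<in> lists S" "A = word_cong S E `` {u}"
      unfolding carr by metis
    then show "\<one>\<^bsub>word_quotient S E\<^esub> \<otimes>\<^bsub>word_quotient S E\<^esub> A = A"
      using word_quotient_mult[of "[]" S u E] by (simp add: one)
  qed
qed

text \<open>The letter \<open>(x, True)\<close> stands for the generator \<open>x\<close>, and \<open>(x, False)\<close> for its inverse.\<close>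

definition free_group :: "'x set \<Rightarrow> ('x \<times> bool) list set monoid" where
  "free_group X = word_quotient (X \<times> UNIV) {([(x, b), (x, \<not> b)], []) |x b. x \<in> X}"

text \<open>
  The factors of \<open>free_product G H\<close> are tagged by \<open>Inl\<close> and \<open>Inr\<close>, hence in
  \<open>free_product G G\<close> the second factor is a disjoint copy of the first.
\<close>

definition free_product_rels ::
  "('a, 'c) monoid_scheme \<Rightarrow> ('b, 'd) monoid_scheme \<Rightarrow> (('a + 'b) list \<times> ('a + 'b) list) set" where
  "free_product_rels G H =
    {([Inl \<one>\<^bsub>G\<^esub>], []), ([Inr \<one>\<^bsub>H\<^esub>], [])}
    \<union> {([Inl a, Inl b], [Inl (a \<otimes>\<^bsub>G\<^esub> b)]) | a b. a \<in> carrier G \<and> b \<in> carrier G}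
    \<union> {([Inr a, Inr b], [Inr (a \<otimes>\<^bsub>H\<^esub> b)]) | a b. a \<in> carrier H \<and> b \<in> carrier H}"

definition free_product ::
  "('a, 'c) monoid_scheme \<Rightarrow> ('b, 'd) monoid_scheme \<Rightarrow> ('a + 'b) list set monoid" where
  "free_product G H = word_quotient (carrier G <+> carrier H) (free_product_rels G H)"

definition free_product_inl ::
  "('a, 'c) monoid_scheme \<Rightarrow> ('b, 'd) monoid_scheme \<Rightarrow> 'a \<Rightarrow> ('a + 'b) list set" where
  "free_product_inl G H g =
    word_cong (carrier G <+> carrier H) (free_product_rels G H) `` {[Inl g]}"

definition free_product_inr ::
  "('a, 'c) monoid_scheme \<Rightarrow> ('b, 'd) monoid_scheme \<Rightarrow> 'b \<Rightarrow> ('a + 'b) list set" where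
  "free_product_inr G H h =
    word_cong (carrier G <+> carrier H) (free_product_rels G H) `` {[Inr h]}"

lemma group_free_group: "group (free_group X)"
  unfolding free_group_def
proof (rule group_word_quotient)
  fix s :: "'a \<times> bool" assume "s \<in> X \<times> UNIV"
  then obtain x b where s: "s = (x, b)" "x \<in> X" by auto
  let ?E = "{([(x, b), (x, \<not> b)], []) |x b. x \<in> X}"
  have "([] @ [(x, \<not> b), (x, b)] @ [], [] @ [] @ []) \<in> word_cong (X \<times> UNIV) ?E"
    using s by (intro word_cong.base) auto
  with s show "\<exists>t\<in>X \<times> UNIV. ([t, s], []) \<in> word_cong (X \<times> UNIV) ?E"
    by (intro bexI[of _ "(x, \<not> b)"]) auto
qed

lemma group_free_product:
  assumes "group G" "group H"
  shows "group (free_product G H)"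
  unfolding free_product_def
proof (rule group_word_quotient)
  let ?S = "carrier G <+> carrier H" and ?E = "free_product_rels G H"
  interpret G: group G by fact
  interpret H: group H by fact
  fix s assume s: "s \<in> ?S"
  have rel: "(l, r) \<in> word_cong ?S ?E" if "(l, r) \<in> ?E" "l \<in> lists ?S" "r \<in> lists ?S" for l r
    using word_cong.base[OF that, of "[]" "[]"] by simp
  from s show "\<exists>t\<in>?S. ([t, s], []) \<in> word_cong ?S ?E"
  proof
    fix a assume a: "s = Inl a" "a \<in> carrier G"
    have "([Inl (inv\<^bsub>G\<^esub> a), Inl a], [Inl \<one>\<^bsub>G\<^esub>]) \<in> ?E"
      unfolding free_product_rels_def using a
      by (auto intro!: exI[of _ "inv\<^bsub>G\<^esub> a"] exI[of _ a])
    then have "([Inl (inv\<^bsub>G\<^esub> a), Inl a], []) \<in> word_cong ?S ?E"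
      using a by (intro word_cong.trans[OF rel rel]) (auto simp: free_product_rels_def)
    with a show ?thesis by (intro bexI[of _ "Inl (inv\<^bsub>G\<^esub> a)"]) auto
  next
    fix a assume a: "s = Inr a" "a \<in> carrier H"
    have "([Inr (inv\<^bsub>H\<^esub> a), Inr a], [Inr \<one>\<^bsub>H\<^esub>]) \<in> ?E"
      unfolding free_product_rels_def using a
      by (auto intro!: exI[of _ "inv\<^bsub>H\<^esub> a"] exI[of _ a])
    then have "([Inr (inv\<^bsub>H\<^esub> a), Inr a], []) \<in> word_cong ?S ?E"
      using a by (intro word_cong.trans[OF rel rel]) (auto simp: free_product_rels_def)
    with a show ?thesis by (intro bexI[of _ "Inr (inv\<^bsub>H\<^esub> a)"]) auto
  qed
qed

definition normal_closure :: "('a, 'c) monoid_scheme \<Rightarrow> 'a set \<Rightarrow> 'a set" where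
  "normal_closure G R = \<Inter>{N. N \<lhd> G \<and> R \<subseteq> N}"

lemma (in group) normal_closure_normal:
  assumes "R \<subseteq> carrier G"
  shows "normal_closure G R \<lhd> G"
proof -
  let ?N = "{N. N \<lhd> G \<and> R \<subseteq> N}"
  have "carrier G \<lhd> G"
    by (rule normal_invI) (auto simp: subgroup_self)
  then have ne: "?N \<noteq> {}" using assms by auto
  have "subgroup (\<Inter>?N) G"
    using ne by (intro subgroups_Inter) (auto simp: normal_imp_subgroup)
  moreover have "x \<otimes> h \<otimes> inv x \<in> \<Inter>?N" if "x \<in> carrier G" "h \<in> \<Inter>?N" for x h
    using that by (auto simp: normal_inv_iff)
  ultimately show ?thesis
    unfolding normal_closure_def by (rule normal_invI)
qed

definition finitely_presented :: "('a, 'c) monoid_scheme \<Rightarrow> bool" where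
  "finitely_presented G \<longleftrightarrow>
    (\<exists>(n::nat) R. finite R \<and> R \<subseteq> carrier (free_group {..<n}) \<and>
      G \<cong> free_group {..<n} Mod normal_closure (free_group {..<n}) R)"

definition commutator :: "('a, 'c) monoid_scheme \<Rightarrow> 'a \<Rightarrow> 'a \<Rightarrow> 'a" where
  "commutator G x y = x \<otimes>\<^bsub>G\<^esub> y \<otimes>\<^bsub>G\<^esub> inv\<^bsub>G\<^esub> x \<otimes>\<^bsub>G\<^esub> inv\<^bsub>G\<^esub> y"

definition \<XX> :: "('a, 'c) monoid_scheme \<Rightarrow> ('a + 'a) list set set monoid" where
  "\<XX> G = free_product G G Mod normal_closure (free_product G G)
    {commutator (free_product G G) (free_product_inl G G g) (free_product_inr G G g) | g.
      g \<in> carrier G}"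

lemma group_\<XX>:
  assumes "group G"
  shows "group (\<XX> G)"
proof -
  interpret P: group "free_product G G"
    using assms by (intro group_free_product)
  have "free_product_inl G G g \<in> carrier (free_product G G)"
    "free_product_inr G G g \<in> carrier (free_product G G)" if "g \<in> carrier G" for g
    using that
    by (auto simp: free_product_inl_def free_product_inr_def free_product_def word_quotient_def
        intro!: quotientI)
  then show ?thesis
    unfolding \<XX>_def
    by (intro normal.factorgroup_is_group P.normal_closure_normal) (auto simp: commutator_def)
qed

text \<open>
  \<open>recursive n f\<close>: the total function \<open>f\<close>, restricted to argument lists of length \<open>n\<close>, is
  recursive. All functions considered are total, so minimisation is only applied to regular
  functions. The rule \<open>ext\<close> makes the values on lists of any other length irrelevant.
\<close>

inductive recursive :: "nat \<Rightarrow> (nat list \<Rightarrow> nat) \<Rightarrow> bool" where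
  zero: "recursive n (\<lambda>xs. 0)"
| succ: "recursive 1 (\<lambda>xs. Suc (xs ! 0))"
| proj: "i < n \<Longrightarrow> recursive n (\<lambda>xs. xs ! i)"
| comp: "\<lbrakk>recursive (length gs) f; \<forall>g\<in>set gs. recursive n g\<rbrakk>
    \<Longrightarrow> recursive n (\<lambda>xs. f (map (\<lambda>g. g xs) gs))"
| prim: "\<lbrakk>recursive n f; recursive (Suc (Suc n)) h\<rbrakk>
    \<Longrightarrow> recursive (Suc n) (\<lambda>xs. rec_nat (f (tl xs)) (\<lambda>k r. h (k # r # tl xs)) (hd xs))"
| mu: "\<lbrakk>recursive (Suc n) f; \<forall>xs. length xs = n \<longrightarrow> (\<exists>k. f (k # xs) = 0)\<rbrakk>
    \<Longrightarrow> recursive n (\<lambda>xs. LEAST k. f (k # xs) = 0)"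
| ext: "\<lbrakk>recursive n f; \<forall>xs. length xs = n \<longrightarrow> g xs = f xs\<rbrakk> \<Longrightarrow> recursive n g"

definition recursive_set :: "nat set \<Rightarrow> bool" where
  "recursive_set A \<longleftrightarrow> recursive 1 (\<lambda>xs. if xs ! 0 \<in> A then 1 else 0)"

text \<open>
  Words in the generators \<open>gs\<close> and their inverses are lists of pairs: as in \<^const>\<open>free_group\<close>,
  \<open>(i, True)\<close> stands for \<open>gs ! i\<close> and \<open>(i, False)\<close> for its inverse.
\<close>

fun letter_value :: "('a, 'c) monoid_scheme \<Rightarrow> 'a list \<Rightarrow> nat \<times> bool \<Rightarrow> 'a" where
  "letter_value G gs (i, b) = (if b then gs ! i else inv\<^bsub>G\<^esub> (gs ! i))"

definition word_value :: "('a, 'c) monoid_scheme \<Rightarrow> 'a list \<Rightarrow> (nat \<times> bool) list \<Rightarrow> 'a" where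
  "word_value G gs w = foldr (\<lambda>l x. letter_value G gs l \<otimes>\<^bsub>G\<^esub> x) w \<one>\<^bsub>G\<^esub>"

definition word_problem :: "('a, 'c) monoid_scheme \<Rightarrow> 'a list \<Rightarrow> (nat \<times> bool) list set" where
  "word_problem G gs = {w \<in> lists ({..<length gs} \<times> UNIV). word_value G gs w = \<one>\<^bsub>G\<^esub>}"

definition word_code :: "(nat \<times> bool) list \<Rightarrow> nat" where
  "word_code w = list_encode (map (\<lambda>(i, b). prod_encode (i, of_bool b)) w)"

text \<open>
  Solubility of the word problem does not depend on the finite generating tuple, so it is
  required for some such tuple; a group that is not finitely generated never satisfies it.
\<close>

definition soluble_word_problem :: "('a, 'c) monoid_scheme \<Rightarrow> bool" where
  "soluble_word_problem G \<longleftrightarrow>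
    (\<exists>gs. set gs \<subseteq> carrier G \<and> generate G (set gs) = carrier G \<and>
      recursive_set (word_code ` word_problem G gs))"

end

theory Submission
  imports Defs
begin

text \<open>
  \<open>G\<close> is a retract of \<open>\<XX>(G)\<close>, so one direction only needs that solubility passes to finitely
  generated subgroups. For the other one, let \<open>W = D \<inter> L\<close> be the kernel of the map from \<open>\<XX>(G)\<close> to
  \<open>G \<times> G \<times> G\<close>, where \<open>D\<close> is the kernel of \<open>\<XX>(G) \<rightarrow> G \<times> G\<close> and \<open>L\<close> is the kernel of the map that
  identifies the two copies of \<open>G\<close>. Membership in \<open>W\<close> is decided by the word problem in \<open>G\<close>. By Sidki,
  \<open>D\<close> and \<open>L\<close> commute, so \<open>W\<close> is abelian and a module over the group ring of the finitely generated
  abelian group \<open>\<XX>(G)/DL\<close>.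

  \<open>W\<close> is a Noetherian module: pull \<open>D \<rightarrow> G\<close> back along a free presentation \<open>F \<rightarrow> G\<close>. The kernel is still
  \<open>W\<close>, the image is a subgroup of a free group, hence the extension splits and \<open>W\<close> embeds in the
  abelianization of the pullback. As \<open>G\<close> is finitely presented, that abelianization is a finitely
  generated module, hence Noetherian by the argument of Hilbert's basis theorem.

  Finally, membership in every submodule \<open>N\<close> of \<open>W\<close> is decidable, by Noetherian induction. It is
  semidecidable because \<open>\<XX>(G)\<close> is recursively presented and \<open>N\<close> is finitely generated.
  Non-membership is semidecided using the larger submodules, by distinguishing whether some ring element
  is a zero divisor on \<open>W/N\<close>, or a nonunit, or whether all of them are zero or invertible.
\<close>

section \<open>Computable functions on encoded data\<close>

text \<open>The word problem in \<open>\<XX> G\<close> is membership in the trivial normal subgroup,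
  which is the submodule of \<open>W\<close> to which the Noetherian induction is finally applied.
  The obstacle is that only a chain condition is known for \<open>W\<close>, not a finite list of
  relations. The induction therefore never computes in \<open>W\<close>: it searches for equations
  that hold in \<open>\<XX> G\<close>, and non-membership has to be certified by such positive facts
  together with the larger submodules, which are already decidable. Which of the three cases occurs
  need not be found effectively; each case only has to provide some algorithm. \<open>W\<close>
  becomes a module over a commutative ring because every commutator in \<open>\<XX> G\<close> is a
  product of an element of \<open>D\<close> and one of \<open>L\<close>, and both factors centralize
  \<open>D \<inter> L\<close>. Finite presentability of \<open>G\<close> enters through the
  relators: the kernel of the free cover has finitely many normal generators, and so has
  \<open>D\<close>, which makes the abelianized pullback finitely generated as a module.\<close>

lemma recursive_const: "recursive n (\<lambda>xs. c)"
proof (induction c)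
  case 0
  show ?case by (rule recursive.zero)
next
  case (Suc c)
  from recursive.comp[OF _ , of "[\<lambda>xs. c]" "\<lambda>xs. Suc (xs ! 0)" n] Suc recursive.succ
  show ?case by simp
qed

definition rec1 :: "(nat \<Rightarrow> nat) \<Rightarrow> bool" where
  "rec1 f \<longleftrightarrow> recursive 1 (\<lambda>xs. f (xs ! 0))"

definition rec2 :: "(nat \<Rightarrow> nat \<Rightarrow> nat) \<Rightarrow> bool" where
  "rec2 f \<longleftrightarrow> recursive 2 (\<lambda>xs. f (xs ! 0) (xs ! 1))"

lemma recursive_rec1:
  assumes "rec1 f" "recursive n F"
  shows "recursive n (\<lambda>xs. f (F xs))"
  using recursive.comp[of "[F]" "\<lambda>xs. f (xs ! 0)" n] assms by (simp add: rec1_def)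

lemma recursive_rec2:
  assumes "rec2 f" "recursive n F" "recursive n F'"
  shows "recursive n (\<lambda>xs. f (F xs) (F' xs))"
  using recursive.comp[of "[F, F']" "\<lambda>xs. f (xs ! 0) (xs ! 1)" n] assms
  by (simp add: rec2_def numeral_2_eq_2)

lemma rec1_id: "rec1 (\<lambda>x. x)"
  unfolding rec1_def by (rule recursive.proj) simp

lemma rec1_const: "rec1 (\<lambda>x. c)"
  unfolding rec1_def by (rule recursive_const)

lemma rec1_Suc: "rec1 Suc"
  unfolding rec1_def by (rule recursive.succ)

lemma rec1_comp: "rec1 f \<Longrightarrow> rec1 g \<Longrightarrow> rec1 (\<lambda>x. f (g x))"
  by (subst rec1_def) (auto intro: recursive_rec1 simp: rec1_def[of g])

lemma rec1_comp2: "rec2 f \<Longrightarrow> rec1 g \<Longrightarrow> rec1 h \<Longrightarrow> rec1 (\<lambda>x. f (g x) (h x))"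
  by (subst rec1_def) (auto intro: recursive_rec2 simp: rec1_def[of g] rec1_def[of h])

lemma rec2_comp1: "rec1 f \<Longrightarrow> rec2 g \<Longrightarrow> rec2 (\<lambda>x y. f (g x y))"
  by (subst rec2_def) (auto intro: recursive_rec1 simp: rec2_def[of g])

lemma rec2_comp2: "rec2 f \<Longrightarrow> rec2 g \<Longrightarrow> rec2 h \<Longrightarrow> rec2 (\<lambda>x y. f (g x y) (h x y))"
  by (subst rec2_def) (auto intro: recursive_rec2 simp: rec2_def[of g] rec2_def[of h])

lemma rec2_fst: "rec2 (\<lambda>x y. x)" and rec2_snd: "rec2 (\<lambda>x y. y)"
  unfolding rec2_def by (rule recursive.proj, simp)+

lemma rec2_swap: "rec2 f \<Longrightarrow> rec2 (\<lambda>x y. f y x)"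
  using rec2_comp2 rec2_fst rec2_snd by blast

lemma rec2_rec_nat:
  assumes "rec1 g" and "recursive 3 (\<lambda>xs. h (xs ! 0) (xs ! 1) (xs ! 2))"
  shows "rec2 (\<lambda>n x. rec_nat (g x) (\<lambda>k r. h k r x) n)"
proof -
  from recursive.prim[OF assms(1)[unfolded rec1_def], of "\<lambda>xs. h (xs ! 0) (xs ! 1) (xs ! 2)"] assms(2)
  have "recursive 2 (\<lambda>xs. rec_nat (g (tl xs ! 0)) (\<lambda>k r. h k r (tl xs ! 0)) (hd xs))"
    by (simp add: numeral_2_eq_2 numeral_3_eq_3)
  then show ?thesis
    unfolding rec2_def
    by (rule recursive.ext) (auto simp: nth_tl hd_conv_nth numeral_2_eq_2 length_Suc_conv)
qed

lemma recursive_proj3: "recursive 3 (\<lambda>xs. xs ! 0)" "recursive 3 (\<lambda>xs. xs ! 1)" "recursive 3 (\<lambda>xs. xs ! 2)"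
  by (rule recursive.proj, simp)+

section \<open>Arithmetic and the inverse of the Cantor pairing\<close>

lemma rec2_add: "rec2 (+)"
proof -
  have "rec2 (\<lambda>n x. rec_nat x (\<lambda>k r. Suc r) n)"
    by (rule rec2_rec_nat) (intro rec1_id recursive_rec1[OF rec1_Suc] recursive_proj3)+
  moreover have "rec_nat x (\<lambda>k r. Suc r) n = n + x" for n x :: nat
    by (induction n) auto
  ultimately show ?thesis by simp
qed

lemma rec2_mult: "rec2 (*)"
proof -
  have "rec2 (\<lambda>n x. rec_nat 0 (\<lambda>k r. r + x) n)"
    by (rule rec2_rec_nat[of "\<lambda>_. 0"]) (intro rec1_const recursive_rec2[OF rec2_add] recursive_proj3)+
  moreover have "rec_nat 0 (\<lambda>k r. r + x) n = n * x" for n x :: nat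
    by (induction n) auto
  ultimately show ?thesis by simp
qed

lemma rec1_pred: "rec1 (\<lambda>x. x - 1)"
proof -
  have "rec2 (\<lambda>n x. rec_nat 0 (\<lambda>k r. k) n)"
    by (rule rec2_rec_nat[of "\<lambda>_. 0"]) (intro rec1_const recursive_proj3)+
  moreover have "rec_nat 0 (\<lambda>k r. k) n = n - 1" for n :: nat
    by (cases n) auto
  ultimately show ?thesis using rec1_comp2[OF _ rec1_id rec1_id] by fastforce
qed

lemma rec2_diff: "rec2 (-)"
proof -
  have "rec2 (\<lambda>n x. rec_nat x (\<lambda>k r. r - 1) n)"
    by (rule rec2_rec_nat) (intro rec1_id recursive_rec1[OF rec1_pred] recursive_proj3)+
  moreover have "rec_nat x (\<lambda>k r. r - 1) n = x - n" for n x :: nat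
    by (induction n) auto
  ultimately show ?thesis using rec2_swap by simp
qed

lemma rec1_triangle: "rec1 triangle"
proof -
  have "rec2 (\<lambda>n x. rec_nat 0 (\<lambda>k r. r + Suc k) n)"
    by (rule rec2_rec_nat[of "\<lambda>_. 0"])
      (intro rec1_const recursive_rec2[OF rec2_add] recursive_rec1[OF rec1_Suc] recursive_proj3)+
  moreover have "rec_nat 0 (\<lambda>k r. r + Suc k) n = triangle n" for n :: nat
    by (induction n) auto
  ultimately have "rec2 (\<lambda>n x. triangle n)" by simp
  from rec1_comp2[OF this rec1_id rec1_id] show ?thesis .
qed

lemma rec2_prod_encode: "rec2 (\<lambda>a b. prod_encode (a, b))"
  unfolding prod_encode_def
  by simp (intro rec2_comp2[OF rec2_add] rec2_comp1[OF rec1_triangle] rec2_add rec2_fst)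

text \<open>\<open>prod_encode (a, b)\<close> is \<open>triangle (a + b) + a\<close>, so the least
  such \<open>s\<close> is the number \<open>a + b\<close> of the diagonal. From it both components
  are recovered by subtraction.\<close>

definition pair_sum :: "nat \<Rightarrow> nat" where
  "pair_sum n = (LEAST s. n < triangle (Suc s))"

lemma triangle_mono: "m \<le> n \<Longrightarrow> triangle m \<le> triangle n"
  by (induction n) (auto simp: le_Suc_eq)

lemma pair_sum_prod_encode: "pair_sum (prod_encode (a, b)) = a + b"
  unfolding pair_sum_def
proof (rule Least_equality)
  show "prod_encode (a, b) < triangle (Suc (a + b))"
    by (simp add: prod_encode_def)
  fix s assume s: "prod_encode (a, b) < triangle (Suc s)"
  show "a + b \<le> s"
  proof (rule ccontr)
    assume "\<not> a + b \<le> s"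
    then have "triangle (Suc s) \<le> triangle (a + b)" by (intro triangle_mono) simp
    with s show False by (simp add: prod_encode_def)
  qed
qed

lemma rec1_pair_sum: "rec1 pair_sum"
proof -
  \<comment> \<open>Minimisation looks for a zero, so the inequality is rewritten as a vanishing
    truncated difference; the \<open>Suc\<close> makes it strict.\<close>
  have *: "Suc n - triangle (Suc s) = 0 \<longleftrightarrow> n < triangle (Suc s)" for n s by auto
  have "recursive (Suc 1) (\<lambda>xs. Suc (xs ! 1) - triangle (Suc (xs ! 0)))"
    by (intro recursive_rec2[OF rec2_diff] recursive_rec1[OF rec1_Suc] recursive_rec1[OF rec1_triangle]
        recursive.proj) auto
  moreover have "\<exists>k. n < triangle (Suc k)" for n
    by (rule exI[of _ n]) simp
  ultimately have "recursive 1 (\<lambda>xs. LEAST k. Suc ((k # xs) ! 1) - triangle (Suc ((k # xs) ! 0)) = 0)"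
    by (intro recursive.mu) (auto simp: Suc_le_eq simp del: triangle_Suc)
  then show ?thesis
    unfolding rec1_def pair_sum_def by (simp add: Suc_le_eq del: triangle_Suc)
qed

lemma rec1_fst: "rec1 (\<lambda>n. fst (prod_decode n))"
proof -
  have "fst (prod_decode n) = n - triangle (pair_sum n)" for n
  proof -
    obtain a b where "n = prod_encode (a, b)" by (metis prod_decode_inverse surj_pair)
    then show ?thesis by (simp add: pair_sum_prod_encode) (simp add: prod_encode_def)
  qed
  moreover have "rec1 (\<lambda>n. n - triangle (pair_sum n))"
    by (intro rec1_comp2[OF rec2_diff] rec1_comp[OF rec1_triangle] rec1_pair_sum rec1_id)
  ultimately show ?thesis by simp
qed

lemma rec1_snd: "rec1 (\<lambda>n. snd (prod_decode n))"
proof -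
  have "snd (prod_decode n) = pair_sum n - fst (prod_decode n)" for n
  proof -
    obtain a b where "n = prod_encode (a, b)" by (metis prod_decode_inverse surj_pair)
    then show ?thesis by (simp add: pair_sum_prod_encode)
  qed
  moreover have "rec1 (\<lambda>n. pair_sum n - fst (prod_decode n))"
    by (intro rec1_comp2[OF rec2_diff] rec1_pair_sum rec1_fst)
  ultimately show ?thesis by simp
qed

section \<open>Recursion, search and folds with packed arguments\<close>

lemma rec1_pair: "rec1 f \<Longrightarrow> rec1 g \<Longrightarrow> rec1 (\<lambda>x. prod_encode (f x, g x))"
  by (rule rec1_comp2[OF rec2_prod_encode])

text \<open>All data of a recursion are packed into one number, in the order environment, counter,
  accumulator; \<open>computable_rec_nat\<close> relies on this order.\<close>

lemma rec1_rec_nat: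
  assumes "rec1 f" "rec1 g" "rec1 h"
  shows "rec1 (\<lambda>x. rec_nat (g x) (\<lambda>k r. h (prod_encode (x, prod_encode (k, r)))) (f x))"
proof -
  have "rec2 (\<lambda>n x. rec_nat (g x) (\<lambda>k r. h (prod_encode (x, prod_encode (k, r)))) n)"
    by (intro rec2_rec_nat assms(2) recursive_rec1[OF assms(3)]
        recursive_rec2[OF rec2_prod_encode] recursive_proj3)
  from rec1_comp2[OF this assms(1) rec1_id] show ?thesis .
qed

lemma rec1_Least:
  assumes "rec1 h" "\<And>x. \<exists>k. h (prod_encode (x, k)) = 0"
  shows "rec1 (\<lambda>x. LEAST k. h (prod_encode (x, k)) = 0)"
proof -
  have "recursive (Suc 1) (\<lambda>xs. h (prod_encode (xs ! 1, xs ! 0)))"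
    by (intro recursive_rec1[OF assms(1)] recursive_rec2[OF rec2_prod_encode] recursive.proj) auto
  from recursive.mu[OF this] assms(2) show ?thesis
    by (simp add: rec1_def)
qed

lemma rec1_if:
  assumes "rec1 c" "rec1 f" "rec1 g"
  shows "rec1 (\<lambda>x. if c x = 0 then f x else g x)"
proof -
  \<comment> \<open>Truncated subtraction makes \<open>1 - c x\<close> the indicator of
    \<open>c x = 0\<close>, and \<open>1 - (1 - c x)\<close> that of the opposite.\<close>
  have "rec1 (\<lambda>x. (1 - c x) * f x + (1 - (1 - c x)) * g x)"
    by (intro rec1_comp2[OF rec2_add] rec1_comp2[OF rec2_mult] rec1_comp2[OF rec2_diff]
        rec1_const assms)
  moreover have "(1 - c x) * f x + (1 - (1 - c x)) * g x = (if c x = 0 then f x else g x)" for x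
    by auto
  ultimately show ?thesis by simp
qed

text \<open>A list code bounds the length of the list, so iterating as often as the code says suffices.\<close>

lemma length_le_list_encode: "length xs \<le> list_encode xs"
  by (induction xs) (auto intro: order_trans[OF _ le_prod_encode_2])

lemma rec1_foldl:
  assumes "rec1 l" "rec1 i" "rec1 f"
  shows "rec1 (\<lambda>e. foldl (\<lambda>a x. f (prod_encode (e, prod_encode (a, x)))) (i e) (list_decode (l e)))"
proof -
  \<comment> \<open>The code of a nonempty list is the successor of a pair, so 1 is subtracted
    before unpairing. The state of the loop pairs the code of the unread list with the accumulator;
    once that code is 0, the state no longer changes.\<close>
  let ?tl = "\<lambda>r. snd (prod_decode (r - 1))" and ?hd = "\<lambda>r. fst (prod_decode (r - 1))"
  let ?env = "\<lambda>p. fst (prod_decode p)"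
  let ?rest = "\<lambda>p. fst (prod_decode (snd (prod_decode (snd (prod_decode p)))))"
  let ?acc = "\<lambda>p. snd (prod_decode (snd (prod_decode (snd (prod_decode p)))))"
  let ?step = "\<lambda>p. if ?rest p = 0 then snd (prod_decode (snd (prod_decode p)))
    else prod_encode (?tl (?rest p), f (prod_encode (?env p, prod_encode (?acc p, ?hd (?rest p)))))"
  let ?run = "\<lambda>e s n. rec_nat s (\<lambda>k r. ?step (prod_encode (e, prod_encode (k, r)))) n"
  note fs = rec1_comp[OF rec1_fst] rec1_comp[OF rec1_snd] rec1_comp[OF rec1_pred] rec1_id
  have step: "rec1 ?step"
    by (intro rec1_if rec1_pair rec1_comp[OF assms(3)] fs)
  \<comment> \<open>\<open>rec_nat\<close> unfolds at the last iteration, whereas the list is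
    consumed from the front. The first iteration can be split off because the step ignores the
    counter.\<close>
  have shift: "?run e s (Suc n) = ?run e (?step (prod_encode (e, prod_encode (0, s)))) n" for e s n
    by (induction n) simp_all
  have run: "snd (prod_decode (?run e (prod_encode (list_encode xs, a)) n))
      = foldl (\<lambda>a x. f (prod_encode (e, prod_encode (a, x)))) a xs" if "length xs \<le> n" for e xs a n
    using that
  proof (induction n arbitrary: xs a)
    case 0
    then show ?case by simp
  next
    case (Suc n)
    show ?case
    proof (cases xs)
      case Nil
      then show ?thesis using Suc.IH[of "[]" a] by (simp only: shift) simp
    next
      case (Cons y ys)
      then show ?thesis using Suc.prems Suc.IH[of ys "f (prod_encode (e, prod_encode (a, y)))"]
        by (simp only: shift) simp
    qed
  qed
  have "rec1 (\<lambda>e. snd (prod_decode (?run e (prod_encode (l e, i e)) (l e))))"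
    by (intro rec1_comp[OF rec1_snd] rec1_rec_nat rec1_pair assms step)
  moreover have "snd (prod_decode (?run e (prod_encode (l e, i e)) (l e)))
      = foldl (\<lambda>a x. f (prod_encode (e, prod_encode (a, x)))) (i e) (list_decode (l e))" for e
  proof -
    have "length (list_decode (l e)) \<le> l e"
      using length_le_list_encode[of "list_decode (l e)"] by simp
    from run[OF this, of "i e" e] show ?thesis by (simp only: list_decode_inverse)
  qed
  ultimately show ?thesis by (simp only:)
qed

lemma rec1_map:
  assumes "rec1 f" "rec1 l"
  shows "rec1 (\<lambda>e. list_encode (map f (list_decode (l e))))"
proof -
  have *: "foldl (\<lambda>a x. Suc (prod_encode (g x, a))) (list_encode ys) xs
      = list_encode (rev (map g xs) @ ys)" for g xs ys
  proof (induction xs arbitrary: ys)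
    case (Cons x xs)
    from Cons[of "g x # ys"] show ?case by simp
  qed simp
  let ?h = "\<lambda>g p. Suc (prod_encode (g (snd (prod_decode (snd (prod_decode p)))),
    fst (prod_decode (snd (prod_decode p)))))"
  have h: "rec1 (?h g)" if "rec1 g" for g
    by (intro rec1_comp[OF rec1_Suc] rec1_pair rec1_comp[OF that] rec1_comp[OF rec1_fst]
        rec1_comp[OF rec1_snd] rec1_id)
  have "rec1 (\<lambda>e. list_encode (rev (map g (list_decode (m e)))))" if "rec1 g" "rec1 m" for g m
    using rec1_foldl[OF that(2) rec1_const h[OF that(1)], of 0] *[of g "[]"] by simp
  \<comment> \<open>Folding with cons reverses the list, so it is done twice: the inner pass only
    reverses, the outer one applies \<open>f\<close> and restores the order.\<close>
  from this[OF assms(1) this[OF rec1_id assms(2)]] show ?thesis by (simp add: rev_map)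
qed

text \<open>
  The second axiom says that the codes form a decidable set and that \<open>dec\<close> is computable.
\<close>

class enc =
  fixes enc :: "'a \<Rightarrow> nat" and dec :: "nat \<Rightarrow> 'a"
  assumes dec_enc [simp]: "dec (enc x) = x"
    and rec1_enc_dec: "rec1 (\<lambda>n. enc (dec n))"

instantiation nat :: enc
begin
definition "enc (n :: nat) = n"
definition "dec n = (n :: nat)"
instance by standard (auto simp: enc_nat_def dec_nat_def rec1_id)
end

instantiation bool :: enc
begin
definition "enc (b :: bool) = of_bool b"
definition "dec n = (n \<noteq> 0)"
instance
proof
  show "dec (enc x) = x" for x :: bool by (simp add: enc_bool_def dec_bool_def)
  have "enc (dec n :: bool) = (if n = 0 then 0 else 1)" for n
    by (auto simp: enc_bool_def dec_bool_def)
  then show "rec1 (\<lambda>n. enc (dec n :: bool))" by (simp add: rec1_if rec1_const rec1_id)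
qed
end

instantiation prod :: (enc, enc) enc
begin
definition "enc p = prod_encode (enc (fst p), enc (snd p))"
definition "dec n = (dec (fst (prod_decode n)), dec (snd (prod_decode n)))"
instance
  by standard (auto simp: enc_prod_def dec_prod_def
    intro!: rec1_pair rec1_comp[OF rec1_enc_dec] rec1_fst rec1_snd)
end

instantiation list :: (enc) enc
begin
definition "enc xs = list_encode (map enc xs)"
definition "dec n = map dec (list_decode n)"
instance
  by standard (auto simp: enc_list_def dec_list_def comp_def rec1_map[OF rec1_enc_dec rec1_id])
end

section \<open>Computable functions between encoded types\<close>

lemma inj_enc: "enc x = enc y \<longleftrightarrow> x = y"
  by (metis dec_enc)

definition computable :: "('a::enc \<Rightarrow> 'b::enc) \<Rightarrow> bool" where
  "computable f \<longleftrightarrow> rec1 (\<lambda>n. enc (f (dec n)))"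

named_theorems computable_intros

lemma computable_comp: "computable f \<Longrightarrow> computable g \<Longrightarrow> computable (\<lambda>x. f (g x))"
  unfolding computable_def using rec1_comp[of "\<lambda>n. enc (f (dec n))" "\<lambda>n. enc (g (dec n))"] by simp

lemma computable_id [computable_intros]: "computable (\<lambda>x. x)"
  unfolding computable_def by (rule rec1_enc_dec)

lemma computable_const [computable_intros]: "computable (\<lambda>x. c)"
  unfolding computable_def by (rule rec1_const)

lemma computable_dec: "computable f \<Longrightarrow> computable (\<lambda>x. dec (f x))"
  by (rule computable_comp[of dec]) (simp_all add: computable_def dec_nat_def rec1_enc_dec)

lemma computable_Pair [computable_intros]:
  "computable f \<Longrightarrow> computable g \<Longrightarrow> computable (\<lambda>x. (f x, g x))"
  unfolding computable_def enc_prod_def by (simp add: rec1_pair)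

lemma computable_fst [computable_intros]: "computable f \<Longrightarrow> computable (\<lambda>x. fst (f x))"
  using rec1_comp[OF rec1_fst] unfolding computable_def enc_prod_def by fastforce

lemma computable_snd [computable_intros]: "computable f \<Longrightarrow> computable (\<lambda>x. snd (f x))"
  using rec1_comp[OF rec1_snd] unfolding computable_def enc_prod_def by fastforce

lemma computable_if [computable_intros]:
  assumes "computable P" "computable f" "computable g"
  shows "computable (\<lambda>x. if P x then f x else g x)"
proof -
  have "rec1 (\<lambda>n. if enc (P (dec n)) = 0 then enc (g (dec n)) else enc (f (dec n)))"
    using assms by (intro rec1_if) (auto simp: computable_def)
  moreover have "(if enc (P y) = 0 then enc (g y) else enc (f y)) = enc (if P y then f y else g y)" for y
    by (simp add: enc_bool_def)
  ultimately show ?thesis by (simp add: computable_def)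
qed

lemma computable_conj [computable_intros]:
  "computable P \<Longrightarrow> computable Q \<Longrightarrow> computable (\<lambda>x. P x \<and> Q x)"
proof -
  assume "computable P" "computable Q"
  then have "computable (\<lambda>x. if P x then Q x else False)" by (intro computable_if computable_const)
  moreover have "(if P x then Q x else False) = (P x \<and> Q x)" for x by simp
  ultimately show ?thesis by (simp only:)
qed

lemma computable_disj [computable_intros]:
  "computable P \<Longrightarrow> computable Q \<Longrightarrow> computable (\<lambda>x. P x \<or> Q x)"
proof -
  assume "computable P" "computable Q"
  then have "computable (\<lambda>x. if P x then True else Q x)" by (intro computable_if computable_const)
  moreover have "(if P x then True else Q x) = (P x \<or> Q x)" for x by simp
  ultimately show ?thesis by (simp only:)
qed

lemma computable_not [computable_intros]: "computable P \<Longrightarrow> computable (\<lambda>x. \<not> P x)"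
proof -
  assume "computable P"
  then have "computable (\<lambda>x. if P x then False else True)" by (intro computable_if computable_const)
  moreover have "(if P x then False else True) = (\<not> P x)" for x by simp
  ultimately show ?thesis by (simp only:)
qed

lemma computable_eq [computable_intros]:
  assumes "computable f" "computable g"
  shows "computable (\<lambda>x. f x = g x)"
proof -
  let ?f = "\<lambda>n. enc (f (dec n))" and ?g = "\<lambda>n. enc (g (dec n))"
  have "rec1 (\<lambda>n. if (?f n - ?g n) + (?g n - ?f n) = 0 then 1 else 0)"
    using assms by (intro rec1_if rec1_comp2[OF rec2_add] rec1_comp2[OF rec2_diff] rec1_const)
      (auto simp: computable_def)
  moreover have "(if (?f n - ?g n) + (?g n - ?f n) = 0 then 1 else 0) = enc (f (dec n) = g (dec n))" for n
    using inj_enc[of "f (dec n)" "g (dec n)"] by (simp add: enc_bool_def) arith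
  ultimately show ?thesis unfolding computable_def by (simp del: add_is_0)
qed

lemma computable_add [computable_intros]:
  "computable f \<Longrightarrow> computable g \<Longrightarrow> computable (\<lambda>x. f x + g x :: nat)"
  unfolding computable_def enc_nat_def by (rule rec1_comp2[OF rec2_add])

lemma computable_diff [computable_intros]:
  "computable f \<Longrightarrow> computable g \<Longrightarrow> computable (\<lambda>x. f x - g x :: nat)"
  unfolding computable_def enc_nat_def by (rule rec1_comp2[OF rec2_diff])

lemma computable_less [computable_intros]:
  assumes "computable f" "computable g"
  shows "computable (\<lambda>x. (f x :: nat) < g x)"
proof -
  have "computable (\<lambda>x. \<not> g x - f x = 0)"
    using assms by (intro computable_intros)
  then show ?thesis by (simp add: not_le)
qed

lemma computable_prod_decode: "computable f \<Longrightarrow> computable (\<lambda>x. prod_decode (f x))"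
  by (rule computable_comp[of prod_decode])
    (simp_all add: computable_def enc_prod_def enc_nat_def dec_nat_def rec1_id)

lemma computable_rec_nat:
  assumes "computable (\<lambda>p. h (fst p) (fst (snd p)) (snd (snd p)))" "computable g" "computable f"
  shows "computable (\<lambda>x. rec_nat (g x) (h x) (f x))"
proof -
  let ?h = "\<lambda>n. enc ((\<lambda>p. h (fst p) (fst (snd p)) (snd (snd p))) (dec n))"
  have "rec1 (\<lambda>x. rec_nat (enc (g (dec x))) (\<lambda>k r. ?h (prod_encode (x, prod_encode (k, r))))
      (enc (f (dec x))))"
    using assms unfolding computable_def by (intro rec1_rec_nat)
  moreover have "rec_nat (enc (g (dec x))) (\<lambda>k r. ?h (prod_encode (x, prod_encode (k, r)))) n
      = enc (rec_nat (g (dec x)) (h (dec x)) n)" for x n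
    by (induction n) (simp_all add: dec_prod_def dec_nat_def)
  ultimately show ?thesis by (simp add: computable_def enc_nat_def)
qed

lemma computable_foldl:
  assumes "computable (\<lambda>p. f (fst p) (fst (snd p)) (snd (snd p)))" "computable i" "computable l"
  shows "computable (\<lambda>x. foldl (f x) (i x) (l x))"
proof -
  let ?f = "\<lambda>n. enc ((\<lambda>p. f (fst p) (fst (snd p)) (snd (snd p))) (dec n))"
  have "rec1 (\<lambda>x. foldl (\<lambda>a y. ?f (prod_encode (x, prod_encode (a, y)))) (enc (i (dec x)))
      (list_decode (enc (l (dec x)))))"
    using assms unfolding computable_def by (intro rec1_foldl)
  moreover have "foldl (\<lambda>a y. ?f (prod_encode (x, prod_encode (a, y)))) (enc a) (map enc ys)
      = enc (foldl (f (dec x)) a ys)" for x a ys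
    by (induction ys arbitrary: a) (simp_all add: dec_prod_def)
  ultimately show ?thesis by (simp add: computable_def enc_list_def)
qed

lemma computable_Cons [computable_intros]:
  assumes "computable f" "computable g"
  shows "computable (\<lambda>x. f x # g x)"
  using assms unfolding computable_def enc_list_def
  by (simp add: rec1_comp[OF rec1_Suc] rec1_pair)

lemma computable_rev [computable_intros]:
  assumes "computable f"
  shows "computable (\<lambda>x. rev (f x))"
proof -
  have "computable (\<lambda>x. foldl (\<lambda>a y. y # a) [] (f x))"
    by (intro computable_foldl computable_intros assms)
  moreover have "foldl (\<lambda>a y. y # a) ys xs = rev xs @ ys" for xs ys :: "'b list"
    by (induction xs arbitrary: ys) auto
  ultimately show ?thesis by simp
qed

lemma computable_append [computable_intros]:
  assumes "computable f" "computable g"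
  shows "computable (\<lambda>x. f x @ g x)"
proof -
  have "computable (\<lambda>x. foldl (\<lambda>a y. y # a) (g x) (rev (f x)))"
    by (intro computable_foldl computable_intros assms)
  moreover have "foldl (\<lambda>a y. y # a) ys xs = rev xs @ ys" for xs ys :: "'b list"
    by (induction xs arbitrary: ys) auto
  ultimately show ?thesis by simp
qed

lemma computable_concat_map:
  assumes "computable (\<lambda>p. h (fst p) (snd p))" "computable f"
  shows "computable (\<lambda>x. concat (map (h x) (f x)))"
proof -
  have "computable (\<lambda>x. foldl (\<lambda>a y. a @ h x y) [] (f x))"
    by (intro computable_foldl computable_intros assms computable_comp[OF assms(1), of "\<lambda>p. (fst p, snd (snd p))", simplified])
  moreover have "foldl (\<lambda>a y. a @ h x y) ys xs = ys @ concat (map (h x) xs)" for x xs ys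
    by (induction xs arbitrary: ys) auto
  ultimately show ?thesis by simp
qed

lemma computable_map:
  assumes "computable (\<lambda>p. h (fst p) (snd p))" "computable f"
  shows "computable (\<lambda>x. map (h x) (f x))"
  using computable_concat_map[of "\<lambda>x y. [h x y]" f] assms
  by (simp add: computable_intros)

lemma computable_list_all:
  assumes "computable (\<lambda>p. h (fst p) (snd p))" "computable f"
  shows "computable (\<lambda>x. list_all (h x) (f x))"
proof -
  have "computable (\<lambda>x. concat (map (\<lambda>y. if h x y then [] else [True]) (f x)) = [])"
    by (intro computable_intros computable_concat_map assms)
  moreover have "concat (map (\<lambda>y. if h x y then [] else [True]) ys) = [] \<longleftrightarrow> list_all (h x) ys" for x ys
    by (induction ys) auto
  ultimately show ?thesis by simp
qed

text \<open>Finitely many values are hard-wired, regardless of how they were found. This turns a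
  mere choice of words for finitely many generators into a computable map.\<close>

lemma computable_finite_table:
  assumes "\<And>i. n \<le> i \<Longrightarrow> f i = d"
  shows "computable (f :: nat \<Rightarrow> _)"
proof -
  have table: "computable (\<lambda>i. if i < m then f i else d)" for m
  proof (induction m)
    case (Suc m)
    have "(\<lambda>i. if i < Suc m then f i else d) = (\<lambda>i. if i = m then f m else if i < m then f i else d)"
      by (auto simp: less_Suc_eq)
    with Suc show ?case by (simp add: computable_intros)
  qed (simp add: computable_const)
  have f: "(\<lambda>i. if i < n then f i else d) = f" using assms by (auto simp: fun_eq_iff)
  show ?thesis using table[of n] unfolding f .
qed

lemma computable_Least:
  fixes P :: "'a::enc \<Rightarrow> nat \<Rightarrow> bool"
  assumes "computable (\<lambda>p. P (fst p) (snd p))" "\<And>x. \<exists>k. P x k"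
  shows "computable (\<lambda>x. LEAST k. P x k)"
proof -
  let ?P = "\<lambda>n. enc ((\<lambda>p. \<not> P (fst p) (snd p)) (dec n))"
  have "rec1 (\<lambda>x. LEAST k. ?P (prod_encode (x, k)) = 0)"
    using assms computable_not[OF assms(1)]
    by (intro rec1_Least) (auto simp: computable_def dec_prod_def dec_nat_def enc_bool_def)
  then show ?thesis
    by (simp add: computable_def dec_prod_def dec_nat_def enc_bool_def enc_nat_def)
qed

subsection \<open>Semidecidable predicates\<close>

definition semidecidable :: "('a::enc \<Rightarrow> bool) \<Rightarrow> bool" where
  "semidecidable P \<longleftrightarrow> (\<exists>Q :: 'a \<times> nat \<Rightarrow> bool. computable Q \<and> (\<forall>x. P x \<longleftrightarrow> (\<exists>k::nat. Q (x, k))))"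

lemma semidecidable_computable: "computable P \<Longrightarrow> semidecidable P"
  unfolding semidecidable_def
  by (rule exI[of _ "\<lambda>p. P (fst p)"]) (simp add: computable_comp[of P fst] computable_fst computable_id)

lemma semidecidable_comp:
  assumes "semidecidable P" "computable f"
  shows "semidecidable (\<lambda>x. P (f x))"
proof -
  from assms(1) obtain Q where Q: "computable Q" "\<And>x. P x \<longleftrightarrow> (\<exists>k::nat. Q (x, k))"
    unfolding semidecidable_def by metis
  have "computable (\<lambda>p. Q (f (fst p), snd p))"
    by (intro computable_comp[OF Q(1)] computable_intros computable_comp[OF assms(2)])
  with Q(2) show ?thesis unfolding semidecidable_def by fastforce
qed

lemma semidecidable_ex:
  fixes P :: "'a::enc \<Rightarrow> 'b::enc \<Rightarrow> bool"
  assumes "semidecidable (\<lambda>p. P (fst p) (snd p))"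
  shows "semidecidable (\<lambda>x. \<exists>y. P x y)"
proof -
  from assms obtain Q where Q: "computable Q" "\<And>p. P (fst p) (snd p) \<longleftrightarrow> (\<exists>k::nat. Q (p, k))"
    unfolding semidecidable_def by metis
  \<comment> \<open>One number encodes both the element \<open>y\<close> and the stage at which
    \<open>P x y\<close> is confirmed.\<close>
  let ?Q = "\<lambda>p. Q ((fst p, dec (fst (prod_decode (snd p)))), snd (prod_decode (snd p)))"
  have "computable ?Q"
    by (intro computable_comp[OF Q(1)] computable_intros computable_dec computable_prod_decode)
  moreover have "(\<exists>y. P x y) \<longleftrightarrow> (\<exists>k. ?Q (x, k))" for x
  proof
    assume "\<exists>y. P x y"
    then obtain y k where "Q ((x, y), k)" using Q(2)[of "(x, _)"] by auto
    then show "\<exists>k. ?Q (x, k)" by (intro exI[of _ "prod_encode (enc y, k)"]) simp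
  next
    assume "\<exists>k. ?Q (x, k)"
    then show "\<exists>y. P x y" using Q(2)[of "(x, _)"] by auto
  qed
  ultimately show ?thesis unfolding semidecidable_def by blast
qed

lemma semidecidable_conj:
  assumes "semidecidable P" "semidecidable R"
  shows "semidecidable (\<lambda>x. P x \<and> R x)"
proof -
  from assms obtain Q S where
    Q: "computable Q" "\<And>x. P x \<longleftrightarrow> (\<exists>k::nat. Q (x, k))" and
    S: "computable S" "\<And>x. R x \<longleftrightarrow> (\<exists>k::nat. S (x, k))"
    unfolding semidecidable_def by metis
  have "semidecidable (\<lambda>p. Q (fst p, fst (snd p)) \<and> S (fst p, snd (snd p)))"
    by (intro semidecidable_computable computable_comp[OF Q(1)] computable_comp[OF S(1)] computable_intros)
  then have "semidecidable (\<lambda>x. \<exists>y. Q (x, fst y) \<and> S (x, snd y))"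
    by (rule semidecidable_ex)
  with Q(2) S(2) show ?thesis by simp
qed

lemma semidecidable_disj:
  assumes "semidecidable P" "semidecidable R"
  shows "semidecidable (\<lambda>x. P x \<or> R x)"
proof -
  from assms obtain Q S where
    Q: "computable Q" "\<And>x. P x \<longleftrightarrow> (\<exists>k::nat. Q (x, k))" and
    S: "computable S" "\<And>x. R x \<longleftrightarrow> (\<exists>k::nat. S (x, k))"
    unfolding semidecidable_def by metis
  have "computable (\<lambda>p. Q p \<or> S p)" using Q S by (intro computable_disj)
  with Q(2) S(2) show ?thesis
    unfolding semidecidable_def by (intro exI[of _ "\<lambda>p. Q p \<or> S p"]) blast
qed

text \<open>Post's theorem: the searches for a confirmation of \<open>P\<close> and of its negation
  run in parallel. One of them succeeds, and \<open>Q\<close> at the stage found tells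
  which.\<close>

lemma computable_by_semidecidable:
  assumes "semidecidable P" "semidecidable (\<lambda>x. \<not> P x)"
  shows "computable P"
proof -
  from assms obtain Q S where
    Q: "computable Q" "\<And>x. P x \<longleftrightarrow> (\<exists>k::nat. Q (x, k))" and
    S: "computable S" "\<And>x. \<not> P x \<longleftrightarrow> (\<exists>k::nat. S (x, k))"
    unfolding semidecidable_def by metis
  let ?k = "\<lambda>x. LEAST k. Q (x, k) \<or> S (x, k)"
  have ex: "\<exists>k. Q (x, k) \<or> S (x, k)" for x using Q(2) S(2) by blast
  have "computable (\<lambda>x. Q (x, ?k x))"
    using ex by (intro computable_comp[OF Q(1)] computable_intros computable_Least) (auto simp: Q S computable_disj)
  moreover have "Q (x, ?k x) \<longleftrightarrow> P x" for x
    using LeastI_ex[OF ex[of x]] Q(2) S(2) by blast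
  ultimately show ?thesis by simp
qed

lemma word_code_eq_enc: "word_code w = enc w"
  by (auto simp: word_code_def enc_list_def enc_prod_def enc_nat_def enc_bool_def intro!: arg_cong[of _ _ list_encode])

lemma recursive_set_word_code_iff:
  "recursive_set (word_code ` A) \<longleftrightarrow> computable (\<lambda>w. w \<in> A)"
proof -
  let ?f = "\<lambda>n. if n \<in> word_code ` A then 1 else 0 :: nat"
  \<comment> \<open>Not every number codes a word; the codes are the numbers fixed by decoding and
    encoding again, which is a decidable condition.\<close>
  have *: "n \<in> word_code ` A \<longleftrightarrow> enc (dec n :: (nat \<times> bool) list) = n \<and> dec n \<in> A" for n
    by (auto simp: word_code_eq_enc image_iff) (metis)
  have "computable (\<lambda>w. w \<in> A) \<longleftrightarrow> rec1 ?f"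
  proof
    assume "rec1 ?f"
    from rec1_comp[OF this rec1_enc_dec[where 'a = "(nat \<times> bool) list"]]
    show "computable (\<lambda>w. w \<in> A)"
      by (simp add: * computable_def enc_bool_def of_bool_def cong: if_cong)
  next
    assume A: "computable (\<lambda>w. w \<in> A)"
    have "computable (\<lambda>n. if enc (dec n :: (nat \<times> bool) list) = n \<and> dec n \<in> A then 1 else 0 :: nat)"
      by (intro computable_intros computable_comp[OF A] computable_dec)
        (simp add: computable_def dec_nat_def enc_nat_def rec1_enc_dec)
    then show "rec1 ?f"
      by (simp add: * computable_def dec_nat_def enc_nat_def)
  qed
  then show ?thesis by (simp add: recursive_set_def rec1_def)
qed

section \<open>Values of words\<close>

type_synonym word = "(nat \<times> bool) list"

text \<open>In contrast to \<open>word_value\<close>, the generators are indexed by all natural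
  numbers, so every word has a value and validity of words need not be tracked.\<close>

definition word_val :: "('a, 'c) monoid_scheme \<Rightarrow> (nat \<Rightarrow> 'a) \<Rightarrow> word \<Rightarrow> 'a" where
  "word_val G a w = foldr (\<lambda>l x. (if snd l then a (fst l) else inv\<^bsub>G\<^esub> a (fst l)) \<otimes>\<^bsub>G\<^esub> x) w \<one>\<^bsub>G\<^esub>"

definition word_inv :: "word \<Rightarrow> word" where
  "word_inv w = rev (map (\<lambda>l. (fst l, \<not> snd l)) w)"

definition word_subst :: "(nat \<Rightarrow> word) \<Rightarrow> word \<Rightarrow> word" where
  "word_subst u w = concat (map (\<lambda>l. if snd l then u (fst l) else word_inv (u (fst l))) w)"

lemma word_val_Nil [simp]: "word_val G a [] = \<one>\<^bsub>G\<^esub>"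
  by (simp add: word_val_def)

lemma word_val_Cons:
  "word_val G a (l # w) = (if snd l then a (fst l) else inv\<^bsub>G\<^esub> a (fst l)) \<otimes>\<^bsub>G\<^esub> word_val G a w"
  by (simp add: word_val_def)

lemma word_inv_Cons: "word_inv (l # w) = word_inv w @ [(fst l, \<not> snd l)]"
  by (simp add: word_inv_def)

context group
begin

lemma word_val_closed [simp]: "range a \<subseteq> carrier G \<Longrightarrow> word_val G a w \<in> carrier G"
  by (induction w) (auto simp: word_val_Cons image_subset_iff)

lemma word_val_append:
  "range a \<subseteq> carrier G \<Longrightarrow> word_val G a (u @ v) = word_val G a u \<otimes> word_val G a v"
proof (induction u)
  case (Cons l u)
  then have "a (fst l) \<in> carrier G" by auto
  with Cons show ?case by (simp add: word_val_Cons m_assoc)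
qed simp

lemma word_val_singleton:
  "range a \<subseteq> carrier G \<Longrightarrow> word_val G a [l] = (if snd l then a (fst l) else inv a (fst l))"
  by (auto simp: word_val_Cons image_subset_iff)

lemma word_val_word_inv:
  "range a \<subseteq> carrier G \<Longrightarrow> word_val G a (word_inv w) = inv (word_val G a w)"
proof (induction w)
  case Nil
  show ?case by (simp add: word_inv_def)
next
  case (Cons l w)
  then have "a (fst l) \<in> carrier G" by auto
  with Cons show ?case
    by (simp add: word_inv_Cons word_val_append word_val_Cons inv_mult_group)
qed

lemma generate_range_eq:
  assumes "range a \<subseteq> carrier G"
  shows "generate G (range a) = range (word_val G a)"
proof
  show "generate G (range a) \<subseteq> range (word_val G a)"
  proof (rule generate_subgroup_incl)
    have "a i \<in> range (word_val G a)" for i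
      using word_val_singleton[OF assms, of "(i, True)"] by (metis fst_conv rangeI snd_conv)
    then show "range a \<subseteq> range (word_val G a)" by auto
    show "subgroup (range (word_val G a)) G"
    proof (rule subgroupI)
      show "inv x \<in> range (word_val G a)" if "x \<in> range (word_val G a)" for x
        using that by (auto simp flip: word_val_word_inv[OF assms])
      show "x \<otimes> y \<in> range (word_val G a)"
        if "x \<in> range (word_val G a)" "y \<in> range (word_val G a)" for x y
        using that by (auto simp flip: word_val_append[OF assms])
    qed (use assms in auto)
  qed
  have "word_val G a w \<in> generate G (range a)" for w
    by (induction w) (auto simp: word_val_Cons intro: generate.eng generate.one generate.incl generate.inv)
  then show "range (word_val G a) \<subseteq> generate G (range a)" by auto
qed

lemma hom_word_val:
  assumes "h \<in> hom G K" "group K" "range a \<subseteq> carrier G"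
  shows "h (word_val G a w) = word_val K (\<lambda>i. h (a i)) w"
proof -
  interpret K: group K by fact
  interpret group_hom G K h by unfold_locales (fact assms)
  show ?thesis
  proof (induction w)
    case (Cons l w)
    have "a (fst l) \<in> carrier G" using assms(3) by auto
    with Cons show ?case using assms(3) by (auto simp: word_val_Cons)
  qed simp
qed

lemma word_val_subst:
  assumes "range b \<subseteq> carrier G"
  shows "word_val G b (word_subst u w) = word_val G (\<lambda>i. word_val G b (u i)) w"
proof (induction w)
  case (Cons l w)
  then show ?case
    by (simp add: word_subst_def word_val_append[OF assms] word_val_Cons word_val_word_inv[OF assms])
qed (simp add: word_subst_def)

end

lemma computable_word_inv [computable_intros]:
  "computable f \<Longrightarrow> computable (\<lambda>x. word_inv (f x))"
  unfolding word_inv_def by (intro computable_intros computable_map)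

lemma computable_word_subst:
  assumes "computable u" "computable f"
  shows "computable (\<lambda>x. word_subst u (f x))"
  unfolding word_subst_def
  by (intro computable_intros computable_concat_map computable_comp[OF assms(1)] assms(2))

section \<open>Word problems of homomorphic images\<close>

text \<open>The image of each generator is spelled once as a word over \<open>b\<close>. Only
  finitely many generators differ from \<open>\<one>\<close>, so this substitution is computable and
  reduces the question to the word problem in \<open>K\<close>. Applications are the change of
  generators, the embedding of \<open>G\<close> into \<open>\<XX> G\<close>, and the kernels of the
  maps from \<open>\<XX> G\<close> onto \<open>G\<close>.\<close>

lemma (in group) computable_hom_word_val:
  fixes K :: "('k, 'l) monoid_scheme"
  assumes K: "group K" and h: "h \<in> hom G K"
    and a: "range a \<subseteq> carrier G" "\<And>i. n \<le> i \<Longrightarrow> a i = \<one>"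
    and b: "range b \<subseteq> carrier K" "carrier K \<subseteq> range (word_val K b)"
    and dec: "computable (\<lambda>w. word_val K b w = \<one>\<^bsub>K\<^esub>)"
  shows "computable (\<lambda>w. h (word_val G a w) = \<one>\<^bsub>K\<^esub>)"
proof -
  interpret K: group K by fact
  interpret group_hom G K h by unfold_locales (use h in auto)
  have "\<exists>w. word_val K b w = h (a i)" for i
    using b(2) a(1) by (metis hom_closed image_subset_iff imageE rangeI subsetD)
  then obtain u' where u': "\<And>i. word_val K b (u' i) = h (a i)" by metis
  define u where "u i = (if i < n then u' i else [])" for i
  have u: "word_val K b (u i) = h (a i)" for i
    using u' a(2) by (auto simp: u_def)
  have "computable u"
    by (rule computable_finite_table[of n _ "[]"]) (simp add: u_def)
  then have "computable (\<lambda>w. word_val K b (word_subst u w) = \<one>\<^bsub>K\<^esub>)"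
    by (intro computable_comp[OF dec] computable_word_subst computable_id)
  moreover have "word_val K b (word_subst u w) = h (word_val G a w)" for w
    by (simp add: K.word_val_subst[OF b(1)] u hom_word_val[OF h K a(1)])
  ultimately show ?thesis by (simp only:)
qed

text \<open>Padding by the neutral element keeps the generated subgroup and gives the total indexing
  that \<open>word_val\<close> expects.\<close>

definition gens_fun :: "('a, 'c) monoid_scheme \<Rightarrow> 'a list \<Rightarrow> nat \<Rightarrow> 'a" where
  "gens_fun G gs i = (if i < length gs then gs ! i else \<one>\<^bsub>G\<^esub>)"

context group
begin

lemma range_gens_fun: "set gs \<subseteq> carrier G \<Longrightarrow> range (gens_fun G gs) \<subseteq> carrier G"
  by (auto simp: gens_fun_def)

lemma generate_gens_fun:
  assumes "set gs \<subseteq> carrier G"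
  shows "generate G (set gs) = range (word_val G (gens_fun G gs))"
proof -
  have "generate G (range (gens_fun G gs)) = generate G (set gs)"
  proof
    show "generate G (range (gens_fun G gs)) \<subseteq> generate G (set gs)"
      by (rule generate_subgroup_incl[OF _ generate_is_subgroup[OF assms]])
        (auto simp: gens_fun_def intro: generate.incl generate.one)
    have "gs ! i \<in> range (gens_fun G gs)" if "i < length gs" for i
      using that by (intro range_eqI[of _ _ i]) (simp add: gens_fun_def)
    then show "generate G (set gs) \<subseteq> generate G (range (gens_fun G gs))"
      by (intro mono_generate) (auto simp: in_set_conv_nth)
  qed
  then show ?thesis using generate_range_eq[OF range_gens_fun[OF assms]] by simp
qed

lemma recursive_word_problem_iff:
  assumes gs: "set gs \<subseteq> carrier G"
  shows "recursive_set (word_code ` word_problem G gs)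
    \<longleftrightarrow> computable (\<lambda>w. word_val G (gens_fun G gs) w = \<one>)"
proof -
  let ?a = "gens_fun G gs"
  let ?valid = "\<lambda>w. list_all (\<lambda>l. fst l < length gs) w"
  have valid: "w \<in> lists ({..<length gs} \<times> UNIV) \<longleftrightarrow> ?valid w" for w :: word
    by (induction w) auto
  have val: "word_value G gs w = word_val G ?a w" if "?valid w" for w
    using that by (induction w) (auto simp: word_value_def word_val_Cons gens_fun_def)
  have iff: "w \<in> word_problem G gs \<longleftrightarrow> ?valid w \<and> word_val G ?a w = \<one>" for w
    by (auto simp: word_problem_def valid val)
  have "computable (\<lambda>w. w \<in> word_problem G gs) \<longleftrightarrow> computable (\<lambda>w. word_val G ?a w = \<one>)"
  proof
    \<comment> \<open>Letters beyond the tuple have the value \<open>\<one>\<close>; deleting them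
      yields a valid word with the same value.\<close>
    let ?f = "\<lambda>w :: word. concat (map (\<lambda>l. if fst l < length gs then [l] else []) w)"
    assume *: "computable (\<lambda>w. w \<in> word_problem G gs)"
    have "computable (\<lambda>w. ?f w \<in> word_problem G gs)"
      by (intro computable_comp[OF *] computable_intros computable_concat_map)
    moreover have "?valid (?f w)" for w
      by (induction w) auto
    moreover have "word_val G ?a (?f w) = word_val G ?a w" for w
      using word_val_closed[OF range_gens_fun[OF gs]]
      by (induction w) (auto simp: word_val_Cons gens_fun_def)
    ultimately show "computable (\<lambda>w. word_val G ?a w = \<one>)" by (simp add: iff)
  next
    assume *: "computable (\<lambda>w. word_val G ?a w = \<one>)"
    have "computable (\<lambda>w. ?valid w \<and> word_val G ?a w = \<one>)"
      by (intro computable_intros computable_list_all *)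
    then show "computable (\<lambda>w. w \<in> word_problem G gs)" by (simp add: iff)
  qed
  then show ?thesis by (simp add: recursive_set_word_code_iff)
qed

lemma soluble_word_problem_iff:
  "soluble_word_problem G \<longleftrightarrow> (\<exists>gs. set gs \<subseteq> carrier G \<and>
    carrier G \<subseteq> range (word_val G (gens_fun G gs)) \<and>
    computable (\<lambda>w. word_val G (gens_fun G gs) w = \<one>))"
  unfolding soluble_word_problem_def
  using recursive_word_problem_iff generate_gens_fun generate_incl by (metis order_refl order_antisym)

end

section \<open>Consequences of computably presented relators\<close>

text \<open>A move \<open>(u, v, t)\<close> names a place and a relator, which is inserted if the
  word is \<open>u @ v\<close> and deleted if it already stands there. Any other move leaves the
  word unchanged, so every list of moves is a legal derivation.\<close>

definition rel_step :: "('p \<Rightarrow> 't \<Rightarrow> 's list) \<Rightarrow> 'p \<Rightarrow> 's list \<Rightarrow> 's list \<times> 's list \<times> 't \<Rightarrow> 's list" where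
  "rel_step R p w m = (if w = fst m @ fst (snd m) then fst m @ R p (snd (snd m)) @ fst (snd m)
     else if w = fst m @ R p (snd (snd m)) @ fst (snd m) then fst m @ fst (snd m) else w)"

lemma word_cong_iff_rel_step:
  "(v, w) \<in> word_cong UNIV (range (\<lambda>t. (R p t, []))) \<longleftrightarrow> (\<exists>ms. foldl (rel_step R p) v ms = w)"
proof
  assume "(v, w) \<in> word_cong UNIV (range (\<lambda>t. (R p t, [])))"
  \<comment> \<open>Derivations in both directions are carried through the induction, so that
    symmetry merely exchanges them.\<close>
  then have "(\<exists>ms. foldl (rel_step R p) v ms = w) \<and> (\<exists>ms. foldl (rel_step R p) w ms = v)"
  proof (induction rule: word_cong.induct)
    case (base l r u v)
    then obtain t where "l = R p t" "r = []" by auto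
    then show ?case by (auto intro!: exI[of _ "[(u, v, t)]"] simp: rel_step_def)
  next
    case (refl w)
    then show ?case by (auto intro: exI[of _ "[]"])
  next
    case (trans u v w)
    then show ?case by (metis foldl_append)
  qed simp
  then show "\<exists>ms. foldl (rel_step R p) v ms = w" ..
next
  have step: "(w, rel_step R p w m) \<in> word_cong UNIV (range (\<lambda>t. (R p t, [])))" for w m
  proof -
    have "(fst m @ R p (snd (snd m)) @ fst (snd m), fst m @ [] @ fst (snd m))
        \<in> word_cong UNIV (range (\<lambda>t. (R p t, [])))"
      by (rule word_cong.base) auto
    then show ?thesis
      unfolding rel_step_def by (auto intro: word_cong.sym word_cong.refl)
  qed
  have "(v, foldl (rel_step R p) v ms) \<in> word_cong UNIV (range (\<lambda>t. (R p t, [])))" for v ms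
    by (induction ms arbitrary: v) (auto intro: word_cong.refl word_cong.trans[OF step])
  then show "\<exists>ms. foldl (rel_step R p) v ms = w \<Longrightarrow> (v, w) \<in> word_cong UNIV (range (\<lambda>t. (R p t, [])))"
    by auto
qed

text \<open>A list of moves leading from \<open>[]\<close> to the word is a certificate that can be
  checked. The parameter of \<open>R\<close> keeps the procedure uniform in the family of
  relators.\<close>

lemma semidecidable_word_cong:
  fixes R :: "'p::enc \<Rightarrow> 't::enc \<Rightarrow> 's::enc list"
  assumes R: "computable (\<lambda>q. R (fst q) (snd q))"
  shows "semidecidable (\<lambda>q. ([], snd q) \<in> word_cong UNIV (range (\<lambda>t. (R (fst q) t, []))))"
proof -
  have R': "computable (\<lambda>x. R (f x) (g x))" if "computable f" "computable g" for f g
    using computable_comp[OF R computable_Pair[OF that]] by simp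
  have "semidecidable (\<lambda>q. foldl (rel_step R (fst (fst q))) [] (snd q) = snd (fst q))"
    unfolding rel_step_def
    by (intro semidecidable_computable computable_intros computable_foldl R')
  then have "semidecidable (\<lambda>q. \<exists>ms. foldl (rel_step R (fst q)) [] ms = snd q)"
    by (rule semidecidable_ex)
  then show ?thesis by (simp add: word_cong_iff_rel_step)
qed

section \<open>Universal properties\<close>

lemma (in group) von_Dyck:
  fixes K :: "('k, 'l) monoid_scheme"
  assumes a: "range a \<subseteq> carrier G" "carrier G \<subseteq> range (word_val G a)"
    and K: "group K" and b: "range b \<subseteq> carrier K"
    and rel: "\<And>w. word_val G a w = \<one> \<Longrightarrow> word_val K b w = \<one>\<^bsub>K\<^esub>"
  obtains h where "h \<in> hom G K" "\<And>w. h (word_val G a w) = word_val K b w"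
proof -
  interpret K: group K by fact
  define h where "h g = word_val K b (SOME w. word_val G a w = g)" for g
  have eq: "word_val K b u = word_val K b v" if "word_val G a u = word_val G a v" for u v
  proof -
    have "word_val G a (u @ word_inv v) = \<one>"
      using that by (simp add: word_val_append word_val_word_inv a(1))
    from rel[OF this] show ?thesis
      by (simp add: K.word_val_append K.word_val_word_inv b K.inv_solve_right')
  qed
  have val: "h (word_val G a w) = word_val K b w" for w
    unfolding h_def by (rule eq) (rule someI[of "\<lambda>v. word_val G a v = word_val G a w"], simp)
  have "h \<in> hom G K"
  proof (rule homI)
    fix x y assume "x \<in> carrier G" "y \<in> carrier G"
    then obtain u v where uv: "x = word_val G a u" "y = word_val G a v" using a(2) by blast
    have "h (x \<otimes> y) = h (word_val G a (u @ v))" by (simp only: uv word_val_append[OF a(1)])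
    also have "\<dots> = word_val K b u \<otimes>\<^bsub>K\<^esub> word_val K b v"
      by (simp only: val K.word_val_append[OF b])
    finally show "h (x \<otimes> y) = h x \<otimes>\<^bsub>K\<^esub> h y" by (simp only: uv val)
  qed (simp add: b h_def)
  from that[OF this val] show thesis .
qed

lemma word_quotient_carrier:
  "carrier (word_quotient S E) = (\<lambda>w. word_cong S E `` {w}) ` lists S"
  by (auto simp: word_quotient_def quotient_def)

lemma word_quotient_one: "\<one>\<^bsub>word_quotient S E\<^esub> = word_cong S E `` {[]}"
  by (simp add: word_quotient_def)

lemma word_cong_class_eq:
  "u \<in> lists S \<Longrightarrow> v \<in> lists S \<Longrightarrow>
    word_cong S E `` {u} = word_cong S E `` {v} \<longleftrightarrow> (u, v) \<in> word_cong S E"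
  by (rule eq_equiv_class_iff[OF equiv_word_cong])

lemma word_quotient_universal:
  fixes K :: "('k, 'l) monoid_scheme"
  assumes K: "group K" and f: "f ` S \<subseteq> carrier K"
    and rel: "\<And>l r. (l, r) \<in> E \<Longrightarrow> l \<in> lists S \<Longrightarrow> r \<in> lists S \<Longrightarrow>
      foldr (\<lambda>s x. f s \<otimes>\<^bsub>K\<^esub> x) l \<one>\<^bsub>K\<^esub> = foldr (\<lambda>s x. f s \<otimes>\<^bsub>K\<^esub> x) r \<one>\<^bsub>K\<^esub>"
  obtains h where "h \<in> hom (word_quotient S E) K"
    "\<And>s. s \<in> S \<Longrightarrow> h (word_cong S E `` {[s]}) = f s"
proof -
  interpret K: group K by fact
  let ?v = "\<lambda>w. foldr (\<lambda>s x. f s \<otimes>\<^bsub>K\<^esub> x) w \<one>\<^bsub>K\<^esub>"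
  have f': "f s \<in> carrier K" if "s \<in> S" for s using f that by auto
  have closed: "?v w \<in> carrier K" if "w \<in> lists S" for w
    using that by (induction w) (auto simp: f')
  have app: "?v (u @ w) = ?v u \<otimes>\<^bsub>K\<^esub> ?v w" if "u \<in> lists S" "w \<in> lists S" for u w
    using that
  proof (induction u)
    case Nil
    then show ?case using closed by simp
  next
    case (Cons s u)
    then show ?case using f' closed by (simp add: K.m_assoc)
  qed
  have cong: "?v u = ?v w" if "(u, w) \<in> word_cong S E" for u w
    using that
  proof (induction rule: word_cong.induct)
    case (base l r u v)
    then have "l @ v \<in> lists S" "r @ v \<in> lists S" by auto
    with base show ?case using rel[OF base(1-3)] by (simp only: app)
  qed auto
  let ?h = "\<lambda>A. ?v (SOME w. w \<in> A)"
  have h: "?h (word_cong S E `` {w}) = ?v w" if "w \<in> lists S" for w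
    by (rule cong[symmetric]) (use someI[of "\<lambda>v. v \<in> word_cong S E `` {w}" w] that in \<open>auto intro: word_cong.refl\<close>)
  show thesis
  proof
    show "?h \<in> hom (word_quotient S E) K"
    proof (rule homI)
      fix A B assume "A \<in> carrier (word_quotient S E)" "B \<in> carrier (word_quotient S E)"
      then obtain u v where uv: "A = word_cong S E `` {u}" "B = word_cong S E `` {v}"
        "u \<in> lists S" "v \<in> lists S" by (auto simp: word_quotient_carrier)
      moreover from this have "u @ v \<in> lists S" by auto
      ultimately show "?h (A \<otimes>\<^bsub>word_quotient S E\<^esub> B) = ?h A \<otimes>\<^bsub>K\<^esub> ?h B"
        by (simp only: word_quotient_mult h app)
    next
      fix A assume "A \<in> carrier (word_quotient S E)"
      then obtain u where "A = word_cong S E `` {u}" "u \<in> lists S"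
        by (auto simp: word_quotient_carrier)
      then show "?h A \<in> carrier K" by (simp only: h closed)
    qed
    show "?h (word_cong S E `` {[s]}) = f s" if "s \<in> S" for s
      using that h[of "[s]"] f' by simp
  qed
qed

lemma (in group) normal_closure_minimal:
  "N \<lhd> G \<Longrightarrow> R \<subseteq> N \<Longrightarrow> normal_closure G R \<subseteq> N"
  by (auto simp: normal_closure_def)

lemma (in group) normal_closure_superset: "R \<subseteq> normal_closure G R"
  by (auto simp: normal_closure_def)

section \<open>Embeddings, generation and universal property of the weak commutativity group\<close>

definition \<XX>_rels :: "('a, 'c) monoid_scheme \<Rightarrow> ('a + 'a) list set set" where
  "\<XX>_rels G = {commutator (free_product G G) (free_product_inl G G g) (free_product_inr G G g) | g.
      g \<in> carrier G}"

definition \<XX>_inl :: "('a, 'c) monoid_scheme \<Rightarrow> 'a \<Rightarrow> ('a + 'a) list set set" where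
  "\<XX>_inl G g = normal_closure (free_product G G) (\<XX>_rels G) #>\<^bsub>free_product G G\<^esub> free_product_inl G G g"

definition \<XX>_inr :: "('a, 'c) monoid_scheme \<Rightarrow> 'a \<Rightarrow> ('a + 'a) list set set" where
  "\<XX>_inr G g = normal_closure (free_product G G) (\<XX>_rels G) #>\<^bsub>free_product G G\<^esub> free_product_inr G G g"

lemma (in group) inv_mult_cancel:
  assumes "a \<in> carrier G" "y \<in> carrier G"
  shows "inv a \<otimes> (a \<otimes> y) = y" "a \<otimes> (inv a \<otimes> y) = y"
  using assms by (simp_all flip: m_assoc)

lemma (in group) commutator_closed [simp]:
  "x \<in> carrier G \<Longrightarrow> y \<in> carrier G \<Longrightarrow> commutator G x y \<in> carrier G"
  by (simp add: commutator_def)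

lemma (in group) commutator_eq_one_iff:
  assumes "x \<in> carrier G" "y \<in> carrier G"
  shows "commutator G x y = \<one> \<longleftrightarrow> x \<otimes> y = y \<otimes> x"
proof -
  have "commutator G x y = (x \<otimes> y) \<otimes> inv (y \<otimes> x)"
    using assms by (simp add: commutator_def inv_mult_group m_assoc)
  with assms show ?thesis by (simp add: inv_solve_right')
qed

lemma (in group_hom) hom_commutator:
  "x \<in> carrier G \<Longrightarrow> y \<in> carrier G \<Longrightarrow> h (commutator G x y) = commutator H (h x) (h y)"
  by (simp add: commutator_def)

context group
begin

abbreviation P where "P \<equiv> free_product G G"

lemma free_product_inl_hom: "free_product_inl G G \<in> hom G P"
  and free_product_inr_hom: "free_product_inr G G \<in> hom G P"
proof -
  let ?S = "carrier G <+> carrier G" and ?E = "free_product_rels G G"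
  have base: "word_cong ?S ?E `` {l} = word_cong ?S ?E `` {r}"
    if "(l, r) \<in> ?E" "l \<in> lists ?S" "r \<in> lists ?S" for l r
    using word_cong.base[OF that, of "[]" "[]"] that by (simp add: word_cong_class_eq)
  have *: "word_cong ?S ?E `` {[Inl x]} \<otimes>\<^bsub>P\<^esub> word_cong ?S ?E `` {[Inl y]} = word_cong ?S ?E `` {[Inl (x \<otimes> y)]}"
    "word_cong ?S ?E `` {[Inr x]} \<otimes>\<^bsub>P\<^esub> word_cong ?S ?E `` {[Inr y]} = word_cong ?S ?E `` {[Inr (x \<otimes> y)]}"
    if "x \<in> carrier G" "y \<in> carrier G" for x y
  proof -
    have "([Inl x, Inl y], [Inl (x \<otimes> y)]) \<in> ?E" "([Inr x, Inr y], [Inr (x \<otimes> y)]) \<in> ?E"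
      using that by (auto simp: free_product_rels_def)
    from base[OF this(1)] base[OF this(2)] that show
      "word_cong ?S ?E `` {[Inl x]} \<otimes>\<^bsub>P\<^esub> word_cong ?S ?E `` {[Inl y]} = word_cong ?S ?E `` {[Inl (x \<otimes> y)]}"
      "word_cong ?S ?E `` {[Inr x]} \<otimes>\<^bsub>P\<^esub> word_cong ?S ?E `` {[Inr y]} = word_cong ?S ?E `` {[Inr (x \<otimes> y)]}"
      by (simp_all add: free_product_def word_quotient_mult InlI InrI)
  qed
  show "free_product_inl G G \<in> hom G P" "free_product_inr G G \<in> hom G P"
    by (rule homI; use * in \<open>auto simp: free_product_inl_def free_product_inr_def free_product_def
          word_quotient_carrier\<close>)+
qed

lemma group_P: "group P"
  by (rule group_free_product) (rule is_group)+

lemma \<XX>_rels_subset: "\<XX>_rels G \<subseteq> carrier P"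
proof -
  interpret P: group P by (rule group_P)
  show ?thesis
    using hom_in_carrier[OF free_product_inl_hom] hom_in_carrier[OF free_product_inr_hom]
    by (auto simp: \<XX>_rels_def commutator_def)
qed

lemma \<XX>_eq: "\<XX> G = P Mod normal_closure P (\<XX>_rels G)"
  by (simp add: \<XX>_def \<XX>_rels_def)

lemma normal_\<XX>_rels: "normal_closure P (\<XX>_rels G) \<lhd> P"
  by (intro group.normal_closure_normal group_P \<XX>_rels_subset)

lemma \<XX>_inl_hom: "\<XX>_inl G \<in> hom G (\<XX> G)" and \<XX>_inr_hom: "\<XX>_inr G \<in> hom G (\<XX> G)"
  using Group.hom_compose[OF free_product_inl_hom normal.r_coset_hom_Mod[OF normal_\<XX>_rels]]
    Group.hom_compose[OF free_product_inr_hom normal.r_coset_hom_Mod[OF normal_\<XX>_rels]]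
  by (simp_all add: \<XX>_eq \<XX>_inl_def[abs_def] \<XX>_inr_def[abs_def] comp_def)

lemma \<XX>_commute:
  assumes "g \<in> carrier G"
  shows "\<XX>_inl G g \<otimes>\<^bsub>\<XX> G\<^esub> \<XX>_inr G g = \<XX>_inr G g \<otimes>\<^bsub>\<XX> G\<^esub> \<XX>_inl G g"
proof -
  let ?N = "normal_closure P (\<XX>_rels G)"
  interpret P: group P by (rule group_P)
  interpret N: normal ?N P by (rule normal_\<XX>_rels)
  interpret X: group "\<XX> G" by (rule group_\<XX>) (rule is_group)
  interpret group_hom P "\<XX> G" "\<lambda>x. ?N #>\<^bsub>P\<^esub> x"
    by unfold_locales (simp add: \<XX>_eq N.r_coset_hom_Mod)
  have in_P: "free_product_inl G G g \<in> carrier P" "free_product_inr G G g \<in> carrier P"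
    using assms free_product_inl_hom free_product_inr_hom by (auto simp: hom_in_carrier)
  let ?c = "commutator P (free_product_inl G G g) (free_product_inr G G g)"
  have "?c \<in> ?N"
    using assms P.normal_closure_superset[of "\<XX>_rels G"] by (auto simp: \<XX>_rels_def)
  then have "?N #>\<^bsub>P\<^esub> ?c = \<one>\<^bsub>\<XX> G\<^esub>"
    by (simp add: \<XX>_eq N.rcos_const)
  then have "commutator (\<XX> G) (\<XX>_inl G g) (\<XX>_inr G g) = \<one>\<^bsub>\<XX> G\<^esub>"
    by (simp add: hom_commutator in_P \<XX>_inl_def \<XX>_inr_def)
  then show ?thesis
    using X.commutator_eq_one_iff hom_in_carrier[OF \<XX>_inl_hom assms] hom_in_carrier[OF \<XX>_inr_hom assms]
    by blast
qed

lemma \<XX>_generated: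
  assumes S: "subgroup S (\<XX> G)" and sub: "\<XX>_inl G ` carrier G \<subseteq> S" "\<XX>_inr G ` carrier G \<subseteq> S"
  shows "S = carrier (\<XX> G)"
proof
  show "S \<subseteq> carrier (\<XX> G)" using S by (rule subgroup.subset)
  let ?N = "normal_closure P (\<XX>_rels G)" and ?S = "carrier G <+> carrier G"
  let ?cl = "\<lambda>w. word_cong ?S (free_product_rels G G) `` {w}"
  interpret P: group P by (rule group_P)
  interpret N: normal ?N P by (rule normal_\<XX>_rels)
  interpret X: group "\<XX> G" by (rule group_\<XX>) (rule is_group)
  interpret h: group_hom P "\<XX> G" "\<lambda>x. ?N #>\<^bsub>P\<^esub> x"
    by unfold_locales (simp add: \<XX>_eq N.r_coset_hom_Mod)
  have cl: "?cl w \<in> carrier P" if "w \<in> lists ?S" for w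
    using that by (simp add: free_product_def word_quotient_carrier)
  have "?N #>\<^bsub>P\<^esub> ?cl w \<in> S" if "w \<in> lists ?S" for w
    using that
  proof (induction w)
    case Nil
    have "?cl [] = \<one>\<^bsub>P\<^esub>" by (simp add: free_product_def word_quotient_one)
    then show ?case using subgroup.one_closed[OF S] by simp
  next
    case (Cons s w)
    then have s: "s \<in> ?S" "w \<in> lists ?S" by auto
    have "?cl (s # w) = ?cl [s] \<otimes>\<^bsub>P\<^esub> ?cl w"
      using s by (simp add: free_product_def word_quotient_mult)
    then have "?N #>\<^bsub>P\<^esub> ?cl (s # w) = (?N #>\<^bsub>P\<^esub> ?cl [s]) \<otimes>\<^bsub>\<XX> G\<^esub> (?N #>\<^bsub>P\<^esub> ?cl w)"
      using s cl[of "[s]"] cl[of w] by simp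
    moreover have "?N #>\<^bsub>P\<^esub> ?cl [s] \<in> S"
      using s(1) sub by (auto simp: \<XX>_inl_def \<XX>_inr_def free_product_inl_def free_product_inr_def)
    ultimately show ?case using Cons subgroup.m_closed[OF S] by simp
  qed
  then show "carrier (\<XX> G) \<subseteq> S"
    by (auto simp: \<XX>_eq carrier_FactGroup) (auto simp: free_product_def word_quotient_carrier)
qed

lemma \<XX>_universal:
  fixes K :: "('k, 'l) monoid_scheme"
  assumes K: "group K" and \<alpha>: "\<alpha> \<in> hom G K" and \<beta>: "\<beta> \<in> hom G K"
    and comm: "\<And>g. g \<in> carrier G \<Longrightarrow> \<alpha> g \<otimes>\<^bsub>K\<^esub> \<beta> g = \<beta> g \<otimes>\<^bsub>K\<^esub> \<alpha> g"
  obtains \<gamma> where "\<gamma> \<in> hom (\<XX> G) K" "\<And>g. g \<in> carrier G \<Longrightarrow> \<gamma> (\<XX>_inl G g) = \<alpha> g"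
    "\<And>g. g \<in> carrier G \<Longrightarrow> \<gamma> (\<XX>_inr G g) = \<beta> g"
proof -
  let ?N = "normal_closure P (\<XX>_rels G)" and ?S = "carrier G <+> carrier G"
  interpret P: group P by (rule group_P)
  interpret N: normal ?N P by (rule normal_\<XX>_rels)
  interpret K: group K by fact
  interpret \<alpha>: group_hom G K \<alpha> by unfold_locales fact
  interpret \<beta>: group_hom G K \<beta> by unfold_locales fact
  obtain \<delta> where \<delta>: "\<delta> \<in> hom P K" and
    ev: "\<And>s. s \<in> ?S \<Longrightarrow> \<delta> (word_cong ?S (free_product_rels G G) `` {[s]}) = case_sum \<alpha> \<beta> s"
    unfolding free_product_def
    by (rule word_quotient_universal[OF K, of "case_sum \<alpha> \<beta>" ?S "free_product_rels G G"])
      (auto simp: free_product_rels_def)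
  interpret \<delta>: group_hom P K \<delta> by unfold_locales fact
  have ev': "\<delta> (free_product_inl G G g) = \<alpha> g" "\<delta> (free_product_inr G G g) = \<beta> g"
    "free_product_inl G G g \<in> carrier P" "free_product_inr G G g \<in> carrier P" if "g \<in> carrier G" for g
    using that ev[of "Inl g"] ev[of "Inr g"]
    by (auto simp: free_product_inl_def free_product_inr_def InlI InrI free_product_def word_quotient_carrier)
  have "\<XX>_rels G \<subseteq> kernel P K \<delta>"
    using \<XX>_rels_subset comm
    by (auto simp: kernel_def) (auto simp: \<XX>_rels_def \<delta>.hom_commutator ev' K.commutator_eq_one_iff)
  then have "?N \<subseteq> kernel P K \<delta>"
    by (intro P.normal_closure_minimal \<delta>.normal_kernel)
  from \<delta>.FactGroup_universal_kernel[OF normal_\<XX>_rels this]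
  obtain \<gamma> where "\<gamma> \<in> hom (\<XX> G) K" "\<And>x. x \<in> carrier P \<Longrightarrow> \<gamma> (?N #>\<^bsub>P\<^esub> x) = \<delta> x"
    unfolding \<XX>_eq by metis
  with ev' that show thesis by (simp add: \<XX>_inl_def \<XX>_inr_def)
qed

end

section \<open>Normal closures in the weak commutativity group are semidecidable\<close>

text \<open>The generators of the two copies of \<open>G\<close> are interleaved:
  \<open>c = 0\<close> selects the even indices for the first copy, \<open>c = 1\<close> the odd
  ones for the second.\<close>

definition word_embed :: "nat \<Rightarrow> word \<Rightarrow> word" where
  "word_embed c w = map (\<lambda>l. (2 * fst l + c, snd l)) w"

lemma word_val_embed: "word_val K e (word_embed c w) = word_val K (\<lambda>i. e (2 * i + c)) w"
  by (induction w) (simp_all add: word_embed_def word_val_Cons)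

lemma computable_word_embed [computable_intros]:
  "computable f \<Longrightarrow> computable (\<lambda>x. word_embed c (f x))"
  unfolding word_embed_def mult_2 by (intro computable_intros computable_map)

definition \<XX>_gens :: "('a, 'c) monoid_scheme \<Rightarrow> (nat \<Rightarrow> 'a) \<Rightarrow> nat \<Rightarrow> ('a + 'a) list set set" where
  "\<XX>_gens G a i = (if even i then \<XX>_inl G (a (i div 2)) else \<XX>_inr G (a (i div 2)))"

text \<open>
  A single computable family of relators, where \<open>ps\<close> lists the words that are additionally killed.
  Parameters that describe no relator yield the empty word.
\<close>

definition \<XX>_relator ::
  "('a, 'c) monoid_scheme \<Rightarrow> (nat \<Rightarrow> 'a) \<Rightarrow> word list \<Rightarrow> nat \<times> word \<times> word \<Rightarrow> word" where
  "\<XX>_relator G a ps t =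
    (if fst t = 0 then if word_val G a (fst (snd t)) = \<one>\<^bsub>G\<^esub> then word_embed 0 (fst (snd t)) else []
     else if fst t = 1 then if word_val G a (fst (snd t)) = \<one>\<^bsub>G\<^esub> then word_embed 1 (fst (snd t)) else []
     else if fst t = 2 then word_embed 0 (fst (snd t)) @ word_embed 1 (fst (snd t)) @
       word_inv (word_embed 0 (fst (snd t))) @ word_inv (word_embed 1 (fst (snd t)))
     else if fst t = 3 then fst (snd t) @ word_inv (fst (snd t))
     else if fst (snd t) \<in> set ps then fst (snd t) else [])"

lemma computable_\<XX>_relator:
  assumes "computable (\<lambda>w. word_val G a w = \<one>\<^bsub>G\<^esub>)"
  shows "computable (\<lambda>q. \<XX>_relator G a (fst q) (snd q))"
proof -
  have mem: "w \<in> set ps \<longleftrightarrow> \<not> list_all (\<lambda>v. v \<noteq> w) ps" for w and ps :: "word list"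
    by (auto simp: list_all_iff)
  show ?thesis
    unfolding \<XX>_relator_def mem
    by (intro computable_intros computable_list_all computable_comp[OF assms])
qed

abbreviation word_class :: "(word \<times> word) set \<Rightarrow> word \<Rightarrow> word set" where
  "word_class E w \<equiv> word_cong UNIV E `` {w}"

text \<open>In the free monoid of words the letters \<open>(i, True)\<close> and
  \<open>(i, False)\<close> are unrelated; inverses have to come from the relators, namely from
  those with tag 3 in \<open>\<XX>_relator\<close>.\<close>

lemma group_word_quotient_inverses:
  assumes "\<And>w. (w @ word_inv w, []) \<in> E"
  shows "group (word_quotient UNIV E)"
proof (rule group_word_quotient)
  fix s :: "nat \<times> bool"
  have "([] @ ([(fst s, \<not> snd s)] @ word_inv [(fst s, \<not> snd s)]) @ [], [] @ [] @ []) \<in> word_cong UNIV E"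
    by (rule word_cong.base[OF assms]) auto
  then show "\<exists>t\<in>UNIV. ([t, s], []) \<in> word_cong UNIV E"
    by (intro bexI[of _ "(fst s, \<not> snd s)"]) (simp_all add: word_inv_def)
qed

lemma class_eq_word_val:
  assumes E: "\<And>w. (w @ word_inv w, []) \<in> E"
  shows "word_class E w = word_val (word_quotient UNIV E) (\<lambda>i. word_class E [(i, True)]) w"
proof -
  let ?K = "word_quotient UNIV E"
  interpret K: group ?K using E by (rule group_word_quotient_inverses)
  have closed: "word_class E w \<in> carrier ?K" for w
    by (auto simp: word_quotient_carrier)
  have "word_class E [(i, False)] \<otimes>\<^bsub>?K\<^esub> word_class E [(i, True)] = \<one>\<^bsub>?K\<^esub>" for i
    using word_cong.base[OF E[of "[(i, False)]"], of UNIV "[]" "[]"]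
    by (simp add: word_quotient_mult word_quotient_one word_cong_class_eq word_inv_def)
  then have inv: "inv\<^bsub>?K\<^esub> word_class E [(i, True)] = word_class E [(i, False)]" for i
    by (intro K.inv_equality closed)
  show ?thesis
  proof (induction w)
    case Nil
    show ?case by (simp add: word_quotient_one)
  next
    case (Cons l w)
    have "word_class E (l # w) = word_class E [l] \<otimes>\<^bsub>?K\<^esub> word_class E w"
      by (simp add: word_quotient_mult)
    with Cons show ?case
      by (cases l) (auto simp: word_val_Cons inv)
  qed
qed

lemma (in group) word_val_word_cong:
  assumes b: "range b \<subseteq> carrier G"
    and rel: "\<And>l r. (l, r) \<in> E \<Longrightarrow> word_val G b l = word_val G b r"
    and "(u, v) \<in> word_cong UNIV E"
  shows "word_val G b u = word_val G b v"
  using assms(3) by (induction rule: word_cong.induct) (simp_all add: word_val_append b rel)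

lemma (in group) \<XX>_gens_closed:
  assumes "range a \<subseteq> carrier G"
  shows "range (\<XX>_gens G a) \<subseteq> carrier (\<XX> G)"
  using assms hom_in_carrier[OF \<XX>_inl_hom] hom_in_carrier[OF \<XX>_inr_hom]
  by (auto simp: \<XX>_gens_def image_subset_iff)

lemma (in group) word_val_\<XX>_gens_embed:
  assumes "range a \<subseteq> carrier G"
  shows "word_val (\<XX> G) (\<XX>_gens G a) (word_embed 0 w) = \<XX>_inl G (word_val G a w)"
    "word_val (\<XX> G) (\<XX>_gens G a) (word_embed 1 w) = \<XX>_inr G (word_val G a w)"
  using assms hom_word_val[OF \<XX>_inl_hom group_\<XX>[OF is_group]]
    hom_word_val[OF \<XX>_inr_hom group_\<XX>[OF is_group]]
  by (simp_all add: word_val_embed \<XX>_gens_def)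

lemma (in group) \<XX>_gens_generate:
  assumes "range a \<subseteq> carrier G" "carrier G \<subseteq> range (word_val G a)"
  shows "range (word_val (\<XX> G) (\<XX>_gens G a)) = carrier (\<XX> G)"
proof (rule \<XX>_generated)
  interpret X: group "\<XX> G" by (rule group_\<XX>) (rule is_group)
  note closed = \<XX>_gens_closed[OF assms(1)]
  show "subgroup (range (word_val (\<XX> G) (\<XX>_gens G a))) (\<XX> G)"
    using X.generate_is_subgroup[OF closed] X.generate_range_eq[OF closed] by simp
  have "\<XX>_inl G g \<in> range (word_val (\<XX> G) (\<XX>_gens G a)) \<and> \<XX>_inr G g \<in> range (word_val (\<XX> G) (\<XX>_gens G a))"
    if g: "g \<in> carrier G" for g
  proof -
    obtain w where w: "g = word_val G a w" using subsetD[OF assms(2) g] by (rule rangeE)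
    show ?thesis unfolding w word_val_\<XX>_gens_embed[OF assms(1), symmetric] by blast
  qed
  then show "\<XX>_inl G ` carrier G \<subseteq> range (word_val (\<XX> G) (\<XX>_gens G a))"
    "\<XX>_inr G ` carrier G \<subseteq> range (word_val (\<XX> G) (\<XX>_gens G a))" by blast+
qed

text \<open>In one direction, every relator becomes trivial modulo the normal closure. Conversely,
  the words modulo the relators form a group \<open>?K\<close>. Tags 0 and 1 give two homomorphisms
  from \<open>G\<close> to \<open>?K\<close> by von Dyck, tag 2 lets them commute elementwise as the
  universal property demands, and tag 4 puts the closure into the kernel of the resulting map from
  \<open>\<XX> G\<close>.\<close>

lemma (in group) word_cong_\<XX>_relator_iff:
  assumes a: "range a \<subseteq> carrier G" "carrier G \<subseteq> range (word_val G a)"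
  shows "([], w) \<in> word_cong UNIV (range (\<lambda>t. (\<XX>_relator G a ps t, []))) \<longleftrightarrow>
    word_val (\<XX> G) (\<XX>_gens G a) w \<in> normal_closure (\<XX> G) (word_val (\<XX> G) (\<XX>_gens G a) ` set ps)"
    (is "_ \<longleftrightarrow> ?val w \<in> ?N")
proof
  let ?E = "range (\<lambda>t. (\<XX>_relator G a ps t, []))"
  interpret X: group "\<XX> G" by (rule group_\<XX>) (rule is_group)
  note closed = \<XX>_gens_closed[OF a(1)]
  have "?val ` set ps \<subseteq> carrier (\<XX> G)" using X.word_val_closed[OF closed] by auto
  then interpret N: normal ?N "\<XX> G" by (rule X.normal_closure_normal)
  interpret inl: group_hom G "\<XX> G" "\<XX>_inl G" by unfold_locales (rule \<XX>_inl_hom)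
  interpret inr: group_hom G "\<XX> G" "\<XX>_inr G" by unfold_locales (rule \<XX>_inr_hom)
  {
    interpret Q: group "\<XX> G Mod ?N" by (rule N.factorgroup_is_group)
    interpret q: group_hom "\<XX> G" "\<XX> G Mod ?N" "\<lambda>x. ?N #>\<^bsub>\<XX> G\<^esub> x"
      by unfold_locales (rule N.r_coset_hom_Mod)
    let ?b = "\<lambda>i. ?N #>\<^bsub>\<XX> G\<^esub> \<XX>_gens G a i"
    have b: "range ?b \<subseteq> carrier (\<XX> G Mod ?N)" using closed q.hom_closed by auto
    have val: "?N #>\<^bsub>\<XX> G\<^esub> ?val w = word_val (\<XX> G Mod ?N) ?b w" for w
      by (rule X.hom_word_val[OF q.homh Q.is_group closed])
    have one_iff: "word_val (\<XX> G Mod ?N) ?b w = \<one>\<^bsub>\<XX> G Mod ?N\<^esub> \<longleftrightarrow> ?val w \<in> ?N" for w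
      using X.coset_join1[of ?N "?val w"] X.coset_join2[of "?val w" ?N] X.word_val_closed[OF closed, of w]
        N.subgroup_axioms by (auto simp flip: val)
    have N: "?val (\<XX>_relator G a ps t) \<in> ?N" for t
    proof -
      have *: "?val (u @ word_inv u) \<in> ?N" for u
        by (simp add: X.word_val_append X.word_val_word_inv closed)
      have "?val (word_embed 0 u @ word_embed 1 u @ word_inv (word_embed 0 u) @ word_inv (word_embed 1 u)) \<in> ?N" for u
      proof -
        let ?g = "word_val G a u"
        have g: "\<XX>_inl G ?g \<in> carrier (\<XX> G)" "\<XX>_inr G ?g \<in> carrier (\<XX> G)"
          using word_val_closed[OF a(1)] by auto
        have "?val (word_embed 0 u @ word_embed 1 u @ word_inv (word_embed 0 u) @ word_inv (word_embed 1 u))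
            = commutator (\<XX> G) (\<XX>_inl G ?g) (\<XX>_inr G ?g)"
          using g by (simp add: X.word_val_append X.word_val_word_inv closed word_val_\<XX>_gens_embed[OF a(1)]
              commutator_def X.m_assoc del: One_nat_def)
        also have "\<dots> = \<one>\<^bsub>\<XX> G\<^esub>"
          using \<XX>_commute[OF word_val_closed[OF a(1)]] g by (simp add: X.commutator_eq_one_iff)
        finally show ?thesis by simp
      qed
      moreover have "?val u \<in> ?N" if "u \<in> set ps" for u
        using that by (blast intro: subsetD[OF X.normal_closure_superset])
      ultimately show ?thesis
        using * by (auto simp: \<XX>_relator_def word_val_\<XX>_gens_embed[OF a(1)]
            simp del: One_nat_def)
    qed
    assume w: "([], w) \<in> word_cong UNIV ?E"
    have "word_val (\<XX> G Mod ?N) ?b u = word_val (\<XX> G Mod ?N) ?b v" if "(u, v) \<in> ?E" for u v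
    proof -
      from that obtain t where "u = \<XX>_relator G a ps t" "v = []" by blast
      with N show ?thesis by (simp only: one_iff word_val_Nil)
    qed
    from Q.word_val_word_cong[OF b this w] have "word_val (\<XX> G Mod ?N) ?b w = \<one>\<^bsub>\<XX> G Mod ?N\<^esub>" by (simp only: word_val_Nil)
    then show "?val w \<in> ?N" by (simp only: one_iff)
  }
  let ?K = "word_quotient UNIV ?E"
  have E: "(w @ word_inv w, []) \<in> ?E" for w
    by (rule range_eqI[of _ _ "(3, w, [])"]) (simp add: \<XX>_relator_def)
  interpret K: group ?K using E by (rule group_word_quotient_inverses)
  let ?e = "\<lambda>i. word_class ?E [(i, True)]"
  have e: "range ?e \<subseteq> carrier ?K" by (auto simp: word_quotient_carrier)
  have e': "range (\<lambda>i. ?e (2 * i + c)) \<subseteq> carrier ?K" for c by (auto simp: word_quotient_carrier)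
  have cls: "word_class ?E w = word_val ?K ?e w" for w
    using E by (rule class_eq_word_val)
  have one_iff: "word_val ?K ?e w = \<one>\<^bsub>?K\<^esub> \<longleftrightarrow> ([], w) \<in> word_cong UNIV ?E" for w
    unfolding cls[symmetric] word_quotient_one using word_cong.sym
    by (subst word_cong_class_eq) auto
  have rel: "word_val ?K ?e (\<XX>_relator G a ps t) = \<one>\<^bsub>?K\<^esub>" for t
    unfolding one_iff using word_cong.base[of "\<XX>_relator G a ps t" "[]" ?E UNIV "[]" "[]"]
    by (auto intro: word_cong.sym)
  have "word_val ?K (\<lambda>i. ?e (2 * i + 0)) u = \<one>\<^bsub>?K\<^esub>" if "word_val G a u = \<one>" for u
  proof -
    have "\<XX>_relator G a ps (0, u, []) = word_embed 0 u" using that by (simp add: \<XX>_relator_def)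
    with rel[of "(0, u, [])"] show ?thesis by (simp only: word_val_embed)
  qed
  then obtain \<alpha> where \<alpha>: "\<alpha> \<in> hom G ?K"
    "\<And>u. \<alpha> (word_val G a u) = word_val ?K ?e (word_embed 0 u)"
    unfolding word_val_embed using von_Dyck[OF a K.is_group e'[of 0]] by blast
  have "word_val ?K (\<lambda>i. ?e (2 * i + 1)) u = \<one>\<^bsub>?K\<^esub>" if "word_val G a u = \<one>" for u
  proof -
    have "\<XX>_relator G a ps (1, u, []) = word_embed 1 u" using that by (simp add: \<XX>_relator_def)
    with rel[of "(1, u, [])"] show ?thesis by (simp only: word_val_embed)
  qed
  then obtain \<beta> where \<beta>: "\<beta> \<in> hom G ?K"
    "\<And>u. \<beta> (word_val G a u) = word_val ?K ?e (word_embed 1 u)"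
    unfolding word_val_embed using von_Dyck[OF a K.is_group e'[of 1]] by blast
  have comm: "\<alpha> g \<otimes>\<^bsub>?K\<^esub> \<beta> g = \<beta> g \<otimes>\<^bsub>?K\<^esub> \<alpha> g" if g_in: "g \<in> carrier G" for g
  proof -
    obtain u where g: "g = word_val G a u" using subsetD[OF a(2) g_in] by (rule rangeE)
    have "commutator ?K (\<alpha> g) (\<beta> g) = \<one>\<^bsub>?K\<^esub>"
    proof -
      have "\<XX>_relator G a ps (2, u, []) = word_embed 0 u @ word_embed 1 u @
          word_inv (word_embed 0 u) @ word_inv (word_embed 1 u)" by (simp add: \<XX>_relator_def)
      moreover have "word_val ?K ?e w \<in> carrier ?K" for w using e by (rule K.word_val_closed)
      ultimately show ?thesis
        using rel[of "(2, u, [])"]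
        by (simp only: K.word_val_append[OF e] K.word_val_word_inv[OF e] commutator_def g \<alpha>(2) \<beta>(2)
            K.m_assoc K.inv_closed K.m_closed)
    qed
    then show ?thesis
      using K.commutator_eq_one_iff hom_in_carrier[OF \<alpha>(1) g_in] hom_in_carrier[OF \<beta>(1) g_in] by blast
  qed
  obtain \<gamma> where \<gamma>: "\<gamma> \<in> hom (\<XX> G) ?K" "\<And>g. g \<in> carrier G \<Longrightarrow> \<gamma> (\<XX>_inl G g) = \<alpha> g"
    "\<And>g. g \<in> carrier G \<Longrightarrow> \<gamma> (\<XX>_inr G g) = \<beta> g"
    by (rule \<XX>_universal[OF K.is_group \<alpha>(1) \<beta>(1) comm], assumption) (rule that)
  interpret \<gamma>: group_hom "\<XX> G" ?K \<gamma> by unfold_locales (rule \<gamma>)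
  have ab: "\<alpha> (a i) = ?e (2 * i)" "\<beta> (a i) = ?e (2 * i + 1)" for i
    using \<alpha>(2)[of "[(i, True)]"] \<beta>(2)[of "[(i, True)]"]
    by (simp_all add: word_val_singleton[OF a(1)] K.word_val_singleton[OF e] word_embed_def)
  have "\<gamma> (\<XX>_gens G a i) = ?e i" for i
  proof -
    have "a (i div 2) \<in> carrier G" using a by auto
    moreover have "2 * (i div 2) = i" if "even i" using that by simp
    moreover have "2 * (i div 2) + 1 = i" if "odd i" using that by simp
    ultimately show ?thesis
      using ab[of "i div 2"] by (cases "even i") (simp_all only: \<XX>_gens_def \<gamma> if_True if_False simp_thms)
  qed
  then have \<gamma>_val: "\<gamma> (?val w) = word_val ?K ?e w" for w
    using X.hom_word_val[OF \<gamma>(1) K.is_group closed] by simp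
  have "word_val ?K ?e p = \<one>\<^bsub>?K\<^esub>" if "p \<in> set ps" for p
  proof -
    have "\<XX>_relator G a ps (4, p, []) = p" using that by (simp add: \<XX>_relator_def)
    with rel[of "(4, p, [])"] show ?thesis by (simp only:)
  qed
  then have "?N \<subseteq> kernel (\<XX> G) ?K \<gamma>"
    by (intro X.normal_closure_minimal \<gamma>.normal_kernel)
      (auto simp: kernel_def \<gamma>_val X.word_val_closed[OF closed])
  then show "?val w \<in> ?N \<Longrightarrow> ([], w) \<in> word_cong UNIV ?E"
    using \<gamma>_val one_iff by (auto simp: kernel_def)
qed

text \<open>The list of killed words is part of the input. This uniformity matters in
  \<open>semidecidable_not_mem_field\<close>, where the tested word itself is killed.\<close>

lemma (in group) semidecidable_normal_closure_\<XX>: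
  assumes "range a \<subseteq> carrier G" "carrier G \<subseteq> range (word_val G a)"
    and "computable (\<lambda>w. word_val G a w = \<one>)"
  shows "semidecidable (\<lambda>q. word_val (\<XX> G) (\<XX>_gens G a) (snd q) \<in>
    normal_closure (\<XX> G) (word_val (\<XX> G) (\<XX>_gens G a) ` set (fst q)))"
  using semidecidable_word_cong[OF computable_\<XX>_relator[OF assms(3)]]
  by (simp add: word_cong_\<XX>_relator_iff assms(1,2))

section \<open>The subgroups D and L\<close>

lemma (in group) subgroup_centralizing:
  assumes "A \<subseteq> carrier G"
  shows "subgroup {x \<in> carrier G. \<forall>a\<in>A. x \<otimes> a = a \<otimes> x} G"
proof (rule subgroupI)
  show "inv x \<in> {x \<in> carrier G. \<forall>a\<in>A. x \<otimes> a = a \<otimes> x}"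
    if "x \<in> {x \<in> carrier G. \<forall>a\<in>A. x \<otimes> a = a \<otimes> x}" for x
  proof -
    have "inv x \<otimes> a = a \<otimes> inv x" if "a \<in> A" for a
    proof -
      have "x \<in> carrier G" "a \<in> carrier G" "x \<otimes> a = a \<otimes> x"
        using \<open>x \<in> _\<close> that assms by auto
      then show ?thesis by (metis inv_closed inv_solve_left inv_solve_right m_assoc m_closed)
    qed
    with that show ?thesis by auto
  qed
  show "x \<otimes> y \<in> {x \<in> carrier G. \<forall>a\<in>A. x \<otimes> a = a \<otimes> x}"
    if "x \<in> {x \<in> carrier G. \<forall>a\<in>A. x \<otimes> a = a \<otimes> x}" "y \<in> {x \<in> carrier G. \<forall>a\<in>A. x \<otimes> a = a \<otimes> x}" for x y
  proof -
    have "x \<otimes> y \<otimes> a = a \<otimes> (x \<otimes> y)" if "a \<in> A" for a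
    proof -
      have "x \<in> carrier G" "y \<in> carrier G" "a \<in> carrier G" "x \<otimes> a = a \<otimes> x" "y \<otimes> a = a \<otimes> y"
        using \<open>x \<in> _\<close> \<open>y \<in> _\<close> that assms by auto
      then show ?thesis by (metis m_assoc)
    qed
    with that show ?thesis by auto
  qed
qed (use assms in \<open>auto intro!: exI[of _ \<one>]\<close>)

lemma (in group) commutator_mult_right:
  assumes "x \<in> carrier G" "y \<in> carrier G" "z \<in> carrier G"
  shows "commutator G x (y \<otimes> z) = commutator G x y \<otimes> (y \<otimes> commutator G x z \<otimes> inv y)"
  using assms by (simp add: commutator_def inv_mult_group m_assoc inv_mult_cancel)

lemma (in group) commutator_mult_left:
  assumes "x \<in> carrier G" "y \<in> carrier G" "z \<in> carrier G"
  shows "commutator G (x \<otimes> y) z = x \<otimes> commutator G y z \<otimes> inv x \<otimes> commutator G x z"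
  using assms by (simp add: commutator_def inv_mult_group m_assoc inv_mult_cancel)

text \<open>The formal core of \<open>commutator_swap\<close>: there \<open>a\<close>,
  \<open>b\<close> are first copies and \<open>c\<close>, \<open>d\<close> second copies of two
  elements, and the last hypothesis says that the two copies of their product commute.\<close>

lemma (in group) conj_swap:
  assumes cl: "a \<in> carrier G" "b \<in> carrier G" "c \<in> carrier G" "d \<in> carrier G"
    and ac: "a \<otimes> c = c \<otimes> a" and bd: "b \<otimes> d = d \<otimes> b"
    and abcd: "a \<otimes> b \<otimes> c \<otimes> d = c \<otimes> d \<otimes> a \<otimes> b"
  shows "inv c \<otimes> b \<otimes> c \<otimes> inv b = inv a \<otimes> d \<otimes> a \<otimes> inv d"
proof -
  have "inv a \<otimes> (inv c \<otimes> (a \<otimes> b \<otimes> c \<otimes> d)) = inv a \<otimes> (inv c \<otimes> (c \<otimes> d \<otimes> a \<otimes> b))"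
    using abcd by simp
  moreover have "inv a \<otimes> (inv c \<otimes> (c \<otimes> d \<otimes> a \<otimes> b)) = inv a \<otimes> d \<otimes> a \<otimes> b"
    using cl by (simp add: m_assoc inv_solve_left')
  moreover have "inv a \<otimes> (inv c \<otimes> (a \<otimes> b \<otimes> c \<otimes> d)) = inv c \<otimes> b \<otimes> c \<otimes> d"
  proof -
    have "inv a \<otimes> inv c = inv c \<otimes> inv a"
      using ac cl by (metis inv_mult_group)
    then have "inv a \<otimes> (inv c \<otimes> y) = inv c \<otimes> (inv a \<otimes> y)" if "y \<in> carrier G" for y
      using cl that by (simp flip: m_assoc)
    then have "inv a \<otimes> (inv c \<otimes> (a \<otimes> b \<otimes> c \<otimes> d)) = inv c \<otimes> (inv a \<otimes> (a \<otimes> b \<otimes> c \<otimes> d))"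
      using cl by simp
    also have "\<dots> = inv c \<otimes> (b \<otimes> c \<otimes> d)"
      using cl by (simp add: m_assoc inv_mult_cancel)
    finally show ?thesis using cl by (simp add: m_assoc)
  qed
  ultimately have "(inv c \<otimes> b \<otimes> c) \<otimes> d = (inv a \<otimes> d \<otimes> a) \<otimes> b" by simp
  then have "inv c \<otimes> b \<otimes> c = (inv a \<otimes> d \<otimes> a) \<otimes> b \<otimes> inv d"
    using cl by (simp add: inv_solve_right)
  also have "\<dots> = (inv a \<otimes> d \<otimes> a) \<otimes> inv d \<otimes> b"
  proof -
    have "b \<otimes> inv d = inv d \<otimes> b"
      using bd cl by (metis inv_closed inv_solve_left inv_solve_right m_assoc m_closed)
    then show ?thesis using cl by (simp add: m_assoc)
  qed
  finally show ?thesis using cl by (simp add: inv_solve_right')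
qed

lemma subgroup_equalizer:
  assumes "group G" "group H" "f \<in> hom G H" "g \<in> hom G H"
  shows "subgroup {x \<in> carrier G. f x = g x} G"
proof -
  interpret G: group G by fact
  interpret H: group H by fact
  interpret f: group_hom G H f by unfold_locales fact
  interpret g: group_hom G H g by unfold_locales fact
  show ?thesis by (rule G.subgroupI) auto
qed

lemma subgroup_vimage:
  assumes "group G" "group H" "f \<in> hom G H" "subgroup C H"
  shows "subgroup {x \<in> carrier G. f x \<in> C} G"
proof -
  interpret G: group G by fact
  interpret H: group H by fact
  interpret f: group_hom G H f by unfold_locales fact
  interpret C: subgroup C H by fact
  show ?thesis by (rule G.subgroupI) (auto intro: exI[of _ "\<one>\<^bsub>G\<^esub>"])
qed

text \<open>Collects what Sidki's argument uses about \<open>\<XX> G\<close>: \<open>p\<close> and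
  \<open>q\<close> each kill one copy of \<open>G\<close>, and \<open>r\<close> folds the two copies
  together. The assumption \<open>generated\<close> serves as an induction principle over
  \<open>X\<close>.\<close>

locale weakly_commuting = G: group G + X: group X
  for G :: "('a, 'c) monoid_scheme" and X :: "('b, 'd) monoid_scheme" (structure) +
  fixes i j :: "'a \<Rightarrow> 'b" and p q r :: "'b \<Rightarrow> 'a"
  assumes i: "i \<in> hom G X" and j: "j \<in> hom G X"
    and commute: "g \<in> carrier G \<Longrightarrow> i g \<otimes> j g = j g \<otimes> i g"
    and generated: "\<lbrakk>subgroup S X; i ` carrier G \<subseteq> S; j ` carrier G \<subseteq> S\<rbrakk> \<Longrightarrow> S = carrier X"
    and p: "p \<in> hom X G" "g \<in> carrier G \<Longrightarrow> p (i g) = g" "g \<in> carrier G \<Longrightarrow> p (j g) = \<one>\<^bsub>G\<^esub>"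
    and q: "q \<in> hom X G" "g \<in> carrier G \<Longrightarrow> q (i g) = \<one>\<^bsub>G\<^esub>" "g \<in> carrier G \<Longrightarrow> q (j g) = g"
    and r: "r \<in> hom X G" "g \<in> carrier G \<Longrightarrow> r (i g) = g" "g \<in> carrier G \<Longrightarrow> r (j g) = g"
begin

sublocale i: group_hom G X i by unfold_locales (rule i)
sublocale j: group_hom G X j by unfold_locales (rule j)
sublocale p: group_hom X G p by unfold_locales (rule p)
sublocale q: group_hom X G q by unfold_locales (rule q)
sublocale r: group_hom X G r by unfold_locales (rule r)

definition D where "D = kernel X G p \<inter> kernel X G q"
definition L where "L = kernel X G r"

lemma normal_D: "D \<lhd> X"
proof (rule X.normal_invI)
  show "subgroup D X"
    unfolding D_def using p.subgroup_kernel q.subgroup_kernel by (rule X.subgroups_Inter_pair)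
qed (auto simp: D_def kernel_def)

lemma normal_L: "L \<lhd> X"
  unfolding L_def by (rule r.normal_kernel)

lemma hom_eqI:
  assumes "group K" "f \<in> hom X K" "f' \<in> hom X K" "x \<in> carrier X"
    "\<And>g. g \<in> carrier G \<Longrightarrow> f (i g) = f' (i g)" "\<And>g. g \<in> carrier G \<Longrightarrow> f (j g) = f' (j g)"
  shows "f x = f' x"
proof -
  have "{x \<in> carrier X. f x = f' x} = carrier X"
    using assms by (intro generated subgroup_equalizer X.is_group) auto
  with assms(4) show ?thesis by auto
qed

text \<open>Modulo \<open>N\<close> the two copies of \<open>G\<close> commute elementwise, so
  sending \<open>x\<close> to the class of \<open>i (p x) \<otimes> j (q x)\<close> is a
  homomorphism. It agrees with the projection on both copies, hence everywhere, and it is trivial on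
  \<open>D\<close>.\<close>

lemma D_subset_normal:
  assumes N: "N \<lhd> X" and c: "\<And>g h. g \<in> carrier G \<Longrightarrow> h \<in> carrier G \<Longrightarrow> commutator X (i g) (j h) \<in> N"
  shows "D \<subseteq> N"
proof
  interpret N: normal N X by fact
  interpret Q: group "X Mod N" by (rule N.factorgroup_is_group)
  interpret \<pi>: group_hom X "X Mod N" "\<lambda>x. N #> x" by unfold_locales (rule N.r_coset_hom_Mod)
  let ?f = "\<lambda>x. (N #> i (p x)) \<otimes>\<^bsub>X Mod N\<^esub> (N #> j (q x))"
  have comm: "(N #> i g) \<otimes>\<^bsub>X Mod N\<^esub> (N #> j h) = (N #> j h) \<otimes>\<^bsub>X Mod N\<^esub> (N #> i g)"
    if "g \<in> carrier G" "h \<in> carrier G" for g h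
  proof -
    have "commutator (X Mod N) (N #> i g) (N #> j h) = \<one>\<^bsub>X Mod N\<^esub>"
      using c[OF that] that N.rcos_const by (simp flip: \<pi>.hom_commutator)
    then show ?thesis using Q.commutator_eq_one_iff that \<pi>.hom_closed by simp
  qed
  have f: "?f \<in> hom X (X Mod N)"
  proof (rule homI)
    fix x y assume xy: "x \<in> carrier X" "y \<in> carrier X"
    let ?a = "N #> i (p x)" and ?b = "N #> i (p y)" and ?c = "N #> j (q x)" and ?d = "N #> j (q y)"
    have cl: "?a \<in> carrier (X Mod N)" "?b \<in> carrier (X Mod N)" "?c \<in> carrier (X Mod N)" "?d \<in> carrier (X Mod N)"
      using xy \<pi>.hom_closed by auto
    have "?f (x \<otimes> y) = (?a \<otimes>\<^bsub>X Mod N\<^esub> ?b) \<otimes>\<^bsub>X Mod N\<^esub> (?c \<otimes>\<^bsub>X Mod N\<^esub> ?d)"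
      using xy by (simp del: mult_FactGroup)
    also have "\<dots> = ?a \<otimes>\<^bsub>X Mod N\<^esub> (?b \<otimes>\<^bsub>X Mod N\<^esub> ?c) \<otimes>\<^bsub>X Mod N\<^esub> ?d"
      using cl by (simp only: Q.m_assoc Q.m_closed)
    also have "?b \<otimes>\<^bsub>X Mod N\<^esub> ?c = ?c \<otimes>\<^bsub>X Mod N\<^esub> ?b"
      using comm xy by simp
    finally show "?f (x \<otimes> y) = ?f x \<otimes>\<^bsub>X Mod N\<^esub> ?f y"
      using cl by (simp only: Q.m_assoc Q.m_closed)
  next
    show "?f x \<in> carrier (X Mod N)" if "x \<in> carrier X" for x
      using that by (intro Q.m_closed \<pi>.hom_closed) auto
  qed
  fix x assume x: "x \<in> D"
  then have "x \<in> carrier X" by (auto simp: D_def kernel_def)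
  from hom_eqI[OF Q.is_group \<pi>.homh f this] have "N #> x = ?f x"
    by (simp add: p q \<pi>.hom_one del: mult_FactGroup one_FactGroup)
  also have "\<dots> = N"
    using x by (simp add: D_def kernel_def \<pi>.hom_one) (metis Q.l_one Q.one_closed mult_FactGroup one_FactGroup)
  finally show "x \<in> N"
    using X.coset_join1[OF _ \<open>x \<in> carrier X\<close> N.subgroup_axioms] N.subset by blast
qed

text \<open>Modulo \<open>N\<close> the two copies coincide, so \<open>x\<close> and
  \<open>i (r x)\<close> have the same class, which is trivial for \<open>x\<close> in
  \<open>L\<close>.\<close>

lemma L_subset_normal:
  assumes N: "N \<lhd> X" and c: "\<And>g. g \<in> carrier G \<Longrightarrow> inv i g \<otimes> j g \<in> N"
  shows "L \<subseteq> N"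
proof
  interpret N: normal N X by fact
  interpret Q: group "X Mod N" by (rule N.factorgroup_is_group)
  interpret \<pi>: group_hom X "X Mod N" "\<lambda>x. N #> x" by unfold_locales (rule N.r_coset_hom_Mod)
  have f: "(\<lambda>x. N #> i (r x)) \<in> hom X (X Mod N)"
    by (rule homI) (simp_all del: mult_FactGroup)
  have eq: "N #> j g = N #> i g" if "g \<in> carrier G" for g
  proof -
    have "j g = i g \<otimes> (inv i g \<otimes> j g)"
      using that by (simp flip: X.m_assoc)
    also have "N #> \<dots> = (N #> i g) \<otimes>\<^bsub>X Mod N\<^esub> \<one>\<^bsub>X Mod N\<^esub>"
      using that N.rcos_const[OF X.is_group c[OF that]] by (subst \<pi>.hom_mult) auto
    finally show ?thesis using that by (simp del: mult_FactGroup one_FactGroup)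
  qed
  fix x assume x: "x \<in> L"
  then have "x \<in> carrier X" by (auto simp: L_def kernel_def)
  from hom_eqI[OF Q.is_group \<pi>.homh f this] have "N #> x = N #> i (r x)"
    by (simp add: r eq)
  also have "\<dots> = N"
    using x by (simp add: L_def kernel_def \<pi>.hom_one)
  finally show "x \<in> N"
    using X.coset_join1[OF _ \<open>x \<in> carrier X\<close> N.subgroup_axioms] N.subset by blast
qed

text \<open>Sidki's identity, extracted from the single fact that the two copies of the product of
  the inverse of \<open>g\<close> with \<open>h\<close> commute.\<close>

lemma commutator_swap:
  assumes "g \<in> carrier G" "h \<in> carrier G"
  shows "commutator X (i g) (j h) = commutator X (j g) (i h)"
proof -
  let ?g = "inv\<^bsub>G\<^esub> g"
  have "i (?g \<otimes>\<^bsub>G\<^esub> h) \<otimes> j (?g \<otimes>\<^bsub>G\<^esub> h) = j (?g \<otimes>\<^bsub>G\<^esub> h) \<otimes> i (?g \<otimes>\<^bsub>G\<^esub> h)"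
    using assms by (intro commute) auto
  then have "inv j ?g \<otimes> i h \<otimes> j ?g \<otimes> inv i h
      = inv i ?g \<otimes> j h \<otimes> i ?g \<otimes> inv j h"
    using assms commute[of ?g] commute[of h]
    by (intro X.conj_swap) (auto simp: X.m_assoc simp del: i.hom_inv j.hom_inv)
  then show ?thesis
    using assms by (simp add: commutator_def)
qed

text \<open>The right-hand side lies in the subgroup generated by all these commutators, which is
  thereby stable under conjugation by the first copy of \<open>G\<close>.\<close>

lemma conj_i_commutator:
  assumes "g \<in> carrier G" "h \<in> carrier G" "k \<in> carrier G"
  shows "i k \<otimes> commutator X (i g) (j h) \<otimes> inv i k
    = commutator X (i (k \<otimes>\<^bsub>G\<^esub> g)) (j h) \<otimes> inv commutator X (i k) (j h)"
proof -
  have "commutator X (i (k \<otimes>\<^bsub>G\<^esub> g)) (j h)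
      = i k \<otimes> commutator X (i g) (j h) \<otimes> inv i k \<otimes> commutator X (i k) (j h)"
    using assms by (simp add: X.commutator_mult_left del: i.hom_inv)
  then show ?thesis using assms by (simp add: X.m_assoc del: i.hom_inv)
qed

text \<open>
  Conjugation by the two copies of \<open>k\<close> agrees on the commutators that generate \<open>D\<close>; hence \<open>D\<close>
  centralizes \<open>L\<close>.
\<close>

lemma conj_j_commutator:
  assumes "g \<in> carrier G" "h \<in> carrier G" "k \<in> carrier G"
  shows "j k \<otimes> commutator X (i g) (j h) \<otimes> inv j k
    = i k \<otimes> commutator X (i g) (j h) \<otimes> inv i k"
proof -
  \<comment> \<open>One commutator with a product in the second argument is expanded before and
    after \<open>commutator_swap\<close>; the common first factor then cancels.\<close>
  have "commutator X (i g) (j k) \<otimes> (j k \<otimes> commutator X (i g) (j h) \<otimes> inv j k)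
      = commutator X (i g) (j (k \<otimes>\<^bsub>G\<^esub> h))"
    using assms by (simp add: X.commutator_mult_right del: j.hom_inv)
  also have "\<dots> = commutator X (j g) (i (k \<otimes>\<^bsub>G\<^esub> h))"
    using assms by (intro commutator_swap) auto
  also have "\<dots> = commutator X (j g) (i k) \<otimes> (i k \<otimes> commutator X (j g) (i h) \<otimes> inv i k)"
    using assms by (simp add: X.commutator_mult_right del: i.hom_inv)
  also have "\<dots> = commutator X (i g) (j k) \<otimes> (i k \<otimes> commutator X (i g) (j h) \<otimes> inv i k)"
    using assms by (simp add: commutator_swap)
  finally show ?thesis using assms by (simp del: i.hom_inv j.hom_inv)
qed

text \<open>The commutators generate \<open>D\<close> even without taking conjugates: the subgroup
  they generate is mapped to itself under conjugation by \<open>i k\<close> and \<open>j k\<close>,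
  so it is normal and \<open>D_subset_normal\<close> applies.\<close>

lemma D_subset_generate:
  "D \<subseteq> generate X {commutator X (i g) (j h) | g h. g \<in> carrier G \<and> h \<in> carrier G}"
    (is "_ \<subseteq> generate X ?T")
proof (rule D_subset_normal)
  have T: "?T \<subseteq> carrier X" by auto
  interpret H: subgroup "generate X ?T" X by (rule X.generate_is_subgroup[OF T])
  have conj: "x \<otimes> t \<otimes> inv x \<in> generate X ?T"
    if x: "x \<in> carrier X" and t: "t \<in> generate X ?T"
      and T': "\<And>s. s \<in> ?T \<Longrightarrow> x \<otimes> s \<otimes> inv x \<in> generate X ?T" for x t
  proof -
    interpret c: group_hom X X "\<lambda>t. x \<otimes> t \<otimes> inv x"
      by unfold_locales (use x in \<open>auto simp: hom_def X.m_assoc X.inv_mult_cancel\<close>)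
    have "(\<lambda>t. x \<otimes> t \<otimes> inv x) ` generate X ?T \<subseteq> generate X ?T"
      unfolding c.generate_img[OF T, symmetric]
      by (rule X.generate_subgroup_incl[OF _ H.subgroup_axioms]) (use T' in blast)
    with t show ?thesis by blast
  qed
  \<comment> \<open>Conjugation by \<open>x\<close> and by its inverse are both recorded, so that
    the set is closed under inverses.\<close>
  let ?S = "{x \<in> carrier X. \<forall>t\<in>generate X ?T. x \<otimes> t \<otimes> inv x \<in> generate X ?T
    \<and> inv x \<otimes> t \<otimes> x \<in> generate X ?T}"
  have S: "subgroup ?S X"
  proof (rule X.subgroupI)
    have "\<one> \<in> ?S" using X.generate_in_carrier[OF T] by auto
    then show "?S \<noteq> {}" by blast
    show "x \<otimes> y \<in> ?S" if x: "x \<in> ?S" and y: "y \<in> ?S" for x y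
    proof -
      have "(x \<otimes> y) \<otimes> t \<otimes> inv (x \<otimes> y) \<in> generate X ?T
          \<and> inv (x \<otimes> y) \<otimes> t \<otimes> (x \<otimes> y) \<in> generate X ?T" if t: "t \<in> generate X ?T" for t
      proof -
        have "t \<in> carrier X" using t X.generate_in_carrier[OF T] by auto
        then have "(x \<otimes> y) \<otimes> t \<otimes> inv (x \<otimes> y) = x \<otimes> (y \<otimes> t \<otimes> inv y) \<otimes> inv x"
          "inv (x \<otimes> y) \<otimes> t \<otimes> (x \<otimes> y) = inv y \<otimes> (inv x \<otimes> t \<otimes> x) \<otimes> y"
          using x y by (simp_all add: X.m_assoc X.inv_mult_group)
        with x y t show ?thesis by simp
      qed
      then show ?thesis using x y by simp
    qed
  qed auto
  have i_conj: "i k \<otimes> s \<otimes> inv i k \<in> generate X ?T" if "k \<in> carrier G" "s \<in> ?T" for k s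
  proof -
    from that obtain g h where s: "s = commutator X (i g) (j h)" "g \<in> carrier G" "h \<in> carrier G" by auto
    show ?thesis
      unfolding s(1) conj_i_commutator[OF s(2,3) that(1)]
      using s that by (intro H.m_closed H.m_inv_closed generate.incl) blast+
  qed
  have j_conj: "j k \<otimes> s \<otimes> inv j k \<in> generate X ?T" if "k \<in> carrier G" "s \<in> ?T" for k s
    using i_conj[OF that] that conj_j_commutator by auto
  have "?S = carrier X"
  proof (rule generated[OF S])
    show "i ` carrier G \<subseteq> ?S"
    proof
      fix x assume "x \<in> i ` carrier G"
      then obtain k where k: "x = i k" "k \<in> carrier G" by auto
      then show "x \<in> ?S"
        using conj[OF _ _ i_conj[OF k(2)]] conj[OF _ _ i_conj[OF G.inv_closed[OF k(2)]]] by simp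
    qed
    show "j ` carrier G \<subseteq> ?S"
    proof
      fix x assume "x \<in> j ` carrier G"
      then obtain k where k: "x = j k" "k \<in> carrier G" by auto
      then show "x \<in> ?S"
        using conj[OF _ _ j_conj[OF k(2)]] conj[OF _ _ j_conj[OF G.inv_closed[OF k(2)]]] by simp
    qed
  qed
  then show "generate X ?T \<lhd> X"
    by (intro X.normal_invI H.subgroup_axioms) blast
  show "commutator X (i g) (j h) \<in> generate X ?T" if "g \<in> carrier G" "h \<in> carrier G" for g h
    using that by (intro generate.incl) blast
qed

text \<open>The centralizer of \<open>D\<close> is normal because \<open>D\<close> is, and it
  contains every \<open>inv i k \<otimes> j k\<close>, since the two copies of \<open>k\<close> act
  alike on the generators of \<open>D\<close>. By \<open>L_subset_normal\<close> these elements
  suffice for \<open>L\<close>.\<close>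

lemma D_L_commute:
  assumes "d \<in> D" "l \<in> L"
  shows "d \<otimes> l = l \<otimes> d"
proof -
  interpret D: normal D X by (rule normal_D)
  let ?Z = "{x \<in> carrier X. \<forall>d\<in>D. x \<otimes> d = d \<otimes> x}"
  have "?Z \<lhd> X"
  proof (rule X.normal_invI)
    show "subgroup ?Z X" by (rule X.subgroup_centralizing) (rule D.subset)
    fix x z assume x: "x \<in> carrier X" and z: "z \<in> ?Z"
    have "x \<otimes> z \<otimes> inv x \<otimes> d = d \<otimes> (x \<otimes> z \<otimes> inv x)" if d: "d \<in> D" for d
    proof -
      let ?d = "inv x \<otimes> d \<otimes> x"
      have "?d \<in> D" using D.inv_op_closed1[OF x d] .
      then have "z \<otimes> ?d = ?d \<otimes> z" using z by auto
      moreover have "d \<in> carrier X" using d D.subset by auto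
      moreover have "x \<otimes> (z \<otimes> ?d) \<otimes> inv x = x \<otimes> z \<otimes> inv x \<otimes> d"
        "x \<otimes> (?d \<otimes> z) \<otimes> inv x = d \<otimes> (x \<otimes> z \<otimes> inv x)"
        using x z calculation(2) by (simp_all add: X.m_assoc X.inv_mult_cancel)
      ultimately show ?thesis by simp
    qed
    then show "x \<otimes> z \<otimes> inv x \<in> ?Z" using x z by auto
  qed
  moreover have "inv i k \<otimes> j k \<in> ?Z" if k: "k \<in> carrier G" for k
  proof -
    let ?z = "inv i k \<otimes> j k"
    have z: "?z \<in> carrier X" using k by (intro X.m_closed X.inv_closed) auto
    let ?M = "{x \<in> carrier X. \<forall>a\<in>{?z}. x \<otimes> a = a \<otimes> x}"
    have "commutator X (i g) (j h) \<otimes> ?z = ?z \<otimes> commutator X (i g) (j h)"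
      if gh: "g \<in> carrier G" "h \<in> carrier G" for g h
    proof -
      let ?c = "commutator X (i g) (j h)"
      have cl: "?c \<in> carrier X" "i k \<in> carrier X" "j k \<in> carrier X" using gh k by auto
      have "?c \<otimes> ?z = inv i k \<otimes> (i k \<otimes> ?c \<otimes> inv i k) \<otimes> j k"
        using cl by (simp add: X.m_assoc X.inv_mult_cancel del: i.hom_inv)
      also have "\<dots> = inv i k \<otimes> (j k \<otimes> ?c \<otimes> inv j k) \<otimes> j k"
        by (simp only: conj_j_commutator[OF gh k])
      also have "\<dots> = ?z \<otimes> ?c"
        using cl by (simp add: X.m_assoc X.inv_mult_cancel del: i.hom_inv j.hom_inv)
      finally show ?thesis .
    qed
    then have "generate X {commutator X (i g) (j h) | g h. g \<in> carrier G \<and> h \<in> carrier G} \<subseteq> ?M"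
      by (intro X.generate_subgroup_incl X.subgroup_centralizing) (use z in auto)
    with D_subset_generate have "D \<subseteq> ?M" by (rule order_trans)
    then show ?thesis using z by fastforce
  qed
  ultimately have "L \<subseteq> ?Z" by (rule L_subset_normal)
  with assms show ?thesis by auto
qed

lemma commutator_in_D:
  assumes "g \<in> carrier G" "h \<in> carrier G"
  shows "commutator X (i g) (j h) \<in> D"
  using assms by (simp add: D_def kernel_def p.hom_commutator q.hom_commutator p q)
    (simp add: commutator_def)

text \<open>This expresses that \<open>X\<close> modulo \<open>D\<close> and \<open>L\<close> is
  abelian: the commutator of \<open>i (r x)\<close> and \<open>j (r y)\<close> lies in
  \<open>D\<close> and has the required image under \<open>r\<close>.\<close>

lemma commutator_eq_mod_L:
  assumes "x \<in> carrier X" "y \<in> carrier X"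
  obtains d where "d \<in> D" "r d = r (commutator X x y)"
proof
  let ?d = "commutator X (i (r x)) (j (r y))"
  show "?d \<in> D"
    using assms by (intro commutator_in_D) auto
  show "r ?d = r (commutator X x y)"
    using assms by (simp add: r.hom_commutator r)
qed

text \<open>Modulo \<open>N\<close> the generators of the two copies commute. Centralizers are
  subgroups, so this extends from generators to all elements in one copy first and then in the
  other.\<close>

lemma D_subset_normal_gens:
  assumes N: "N \<lhd> X" and A: "A \<subseteq> carrier G" "generate G A = carrier G"
    and c: "\<And>a b. a \<in> A \<Longrightarrow> b \<in> A \<Longrightarrow> commutator X (i a) (j b) \<in> N"
  shows "D \<subseteq> N"
proof (rule D_subset_normal[OF N])
  interpret N: normal N X by fact
  interpret Q: group "X Mod N" by (rule N.factorgroup_is_group)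
  interpret \<pi>: group_hom X "X Mod N" "\<lambda>x. N #> x" by unfold_locales (rule N.r_coset_hom_Mod)
  have in_N: "commutator X x y \<in> N \<longleftrightarrow>
      (N #> x) \<otimes>\<^bsub>X Mod N\<^esub> (N #> y) = (N #> y) \<otimes>\<^bsub>X Mod N\<^esub> (N #> x)"
    if "x \<in> carrier X" "y \<in> carrier X" for x y
  proof -
    have "commutator X x y \<in> N \<longleftrightarrow> N #> commutator X x y = \<one>\<^bsub>X Mod N\<^esub>"
      using X.coset_join1[of N "commutator X x y"] X.coset_join2[of "commutator X x y" N]
        N.subgroup_axioms N.subset that by auto
    then show ?thesis
      using Q.commutator_eq_one_iff that \<pi>.hom_closed by (simp only: \<pi>.hom_commutator)
  qed
  let ?C = "\<lambda>B. {x \<in> carrier (X Mod N). \<forall>b\<in>B. x \<otimes>\<^bsub>X Mod N\<^esub> b = b \<otimes>\<^bsub>X Mod N\<^esub> x}"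
  have sub: "subgroup {g \<in> carrier G. N #> f g \<in> ?C B} G"
    if f: "f \<in> hom G X" and B: "B \<subseteq> carrier (X Mod N)" for f B
    using subgroup_vimage[OF G.is_group Q.is_group Group.hom_compose[OF f \<pi>.homh] Q.subgroup_centralizing[OF B]]
    by (simp only: comp_def)
  have cl: "N #> i g \<in> carrier (X Mod N)" "N #> j g \<in> carrier (X Mod N)" if "g \<in> carrier G" for g
    using that by (auto intro!: \<pi>.hom_closed)
  have all: "S = carrier G" if "subgroup S G" "A \<subseteq> S" for S
    using G.generate_subgroup_incl[OF that(2,1)] A(2) subgroup.subset[OF that(1)] by blast
  have 1: "N #> i g \<in> ?C ((\<lambda>b. N #> j b) ` A)" if "g \<in> carrier G" for g
  proof -
    have "{g \<in> carrier G. N #> i g \<in> ?C ((\<lambda>b. N #> j b) ` A)} = carrier G"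
      using c in_N A(1) cl
      by (intro all sub i.homh) (auto simp: subset_iff simp del: mult_FactGroup)
    with that show ?thesis by blast
  qed
  have 2: "N #> j h \<in> ?C ((\<lambda>b. N #> i b) ` carrier G)" if "h \<in> carrier G" for h
  proof -
    have "{g \<in> carrier G. N #> j g \<in> ?C ((\<lambda>b. N #> i b) ` carrier G)} = carrier G"
      using 1 A(1) cl
      by (intro all sub j.homh) (auto simp: subset_iff simp del: mult_FactGroup)
    with that show ?thesis by blast
  qed
  show "commutator X (i g) (j h) \<in> N" if "g \<in> carrier G" "h \<in> carrier G" for g h
    using 2[OF that(2)] that by (subst in_N) (auto simp del: mult_FactGroup)
qed

lemma normal_W: "D \<inter> L \<lhd> X"
proof (rule X.normal_invI)
  interpret D: normal D X by (rule normal_D)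
  interpret L: normal L X by (rule normal_L)
  show "subgroup (D \<inter> L) X"
    by (rule X.subgroups_Inter_pair[OF D.subgroup_axioms L.subgroup_axioms])
  show "x \<otimes> w \<otimes> inv x \<in> D \<inter> L" if "x \<in> carrier X" "w \<in> D \<inter> L" for x w
    using that D.inv_op_closed2 L.inv_op_closed2 by blast
qed

text \<open>The commutator of \<open>x\<close> and \<open>y\<close> is \<open>d \<otimes> l\<close>
  with \<open>d\<close> in \<open>D\<close> and \<open>l\<close> in \<open>L\<close>. Elements of
  \<open>D \<inter> L\<close> commute with both factors, so the commutator acts trivially on
  them.\<close>

lemma W_conj_commute:
  assumes x: "x \<in> carrier X" and y: "y \<in> carrier X" and w: "w \<in> D \<inter> L"
  shows "x \<otimes> (y \<otimes> w \<otimes> inv y) \<otimes> inv x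
    = y \<otimes> (x \<otimes> w \<otimes> inv x) \<otimes> inv y"
proof -
  interpret W: normal "D \<inter> L" X by (rule normal_W)
  interpret D: normal D X by (rule normal_D)
  let ?c = "commutator X x y" and ?v = "y \<otimes> (x \<otimes> w \<otimes> inv x) \<otimes> inv y"
  have v: "?v \<in> D \<inter> L" using x y w W.inv_op_closed2 by simp
  have cX: "?c \<in> carrier X" "?v \<in> carrier X" "w \<in> carrier X" using x y v w W.mem_carrier by auto
  obtain d where d: "d \<in> D" "r d = r ?c" using commutator_eq_mod_L[OF x y] by blast
  have dX: "d \<in> carrier X" using d D.mem_carrier by blast
  let ?l = "inv d \<otimes> ?c"
  have l: "?l \<in> L" using d dX cX unfolding L_def kernel_def by simp
  have lX: "?l \<in> carrier X" using dX cX by simp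
  have "?c \<otimes> ?v = d \<otimes> (?l \<otimes> ?v)" using dX cX by (simp add: X.m_assoc X.inv_mult_cancel)
  also have "?l \<otimes> ?v = ?v \<otimes> ?l" using D_L_commute[of ?v ?l] v l by auto
  also have "d \<otimes> (?v \<otimes> ?l) = ?v \<otimes> (d \<otimes> ?l)"
  proof -
    have "d \<otimes> ?v = ?v \<otimes> d" using D_L_commute[OF d(1), of ?v] v by auto
    then show ?thesis using dX cX(2) lX by (simp only: X.m_assoc[symmetric])
  qed
  also have "d \<otimes> ?l = ?c" using dX cX by (simp add: X.inv_mult_cancel)
  finally have "?c \<otimes> ?v = ?v \<otimes> ?c" .
  then have "?c \<otimes> ?v \<otimes> inv ?c = ?v" using cX(1,2) by (simp only: X.m_assoc X.r_inv X.r_one X.inv_closed)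
  moreover have "?c \<otimes> ?v \<otimes> inv ?c = x \<otimes> (y \<otimes> w \<otimes> inv y) \<otimes> inv x"
    using x y cX(3) by (simp add: commutator_def X.m_assoc X.inv_mult_group X.inv_mult_cancel)
  ultimately show ?thesis by simp
qed

end

section \<open>Sections over subgroups of free groups\<close>

text \<open>A right transversal, normalized on \<open>K\<close> itself. Because of this
  normalization the lifted path of an element of \<open>K\<close> lies over that element and not
  over a conjugate.\<close>

lemma (in group) coset_representatives:
  assumes K: "subgroup K G"
  obtains rep where "\<And>g. g \<in> carrier G \<Longrightarrow> rep g \<in> carrier G"
    "\<And>g. g \<in> carrier G \<Longrightarrow> g \<otimes> inv rep g \<in> K" "\<And>g. g \<in> K \<Longrightarrow> rep g = \<one>"
    "\<And>g h. g \<in> carrier G \<Longrightarrow> h \<in> carrier G \<Longrightarrow> g \<otimes> inv h \<in> K \<Longrightarrow> rep g = rep h"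
proof -
  interpret K: subgroup K G by fact
  define rep where "rep g = (if g \<in> K then \<one> else SOME x. x \<in> K #> g)" for g
  have rep: "rep g \<in> K #> g" if g: "g \<in> carrier G" for g
  proof (cases "g \<in> K")
    case True
    then show ?thesis using coset_join2[OF g K] by (simp add: rep_def)
  next
    case False
    then show ?thesis using rcos_self[OF g K] someI[of "\<lambda>x. x \<in> K #> g" g] by (simp add: rep_def)
  qed
  have closed: "rep g \<in> carrier G" if "g \<in> carrier G" for g
    using rep[OF that] r_coset_subset_G[OF K.subset that] by blast
  show thesis
  proof
    show "rep g \<in> carrier G" if "g \<in> carrier G" for g using closed that .
    show "rep g = \<one>" if "g \<in> K" for g using that by (simp add: rep_def)
    show "g \<otimes> inv rep g \<in> K" if g: "g \<in> carrier G" for g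
    proof -
      obtain k where k: "k \<in> K" "rep g = k \<otimes> g" using rep[OF g] by (auto simp: r_coset_def)
      then have "g \<otimes> inv rep g = inv k" using g by (simp add: inv_mult_group flip: m_assoc)
      with k show ?thesis by simp
    qed
    show "rep g = rep h" if g: "g \<in> carrier G" and h: "h \<in> carrier G" and gh: "g \<otimes> inv h \<in> K" for g h
    proof -
      have "g \<in> K #> h"
        using gh g h unfolding r_coset_def by (intro UN_I[OF gh]) (simp add: m_assoc)
      then have *: "K #> h = K #> g" using repr_independence[OF _ h K] by simp
      then have "g \<in> K \<longleftrightarrow> h \<in> K"
        using coset_join1[OF _ _ K] coset_join2[OF _ K] g h by metis
      with * show ?thesis by (simp add: rep_def)
    qed
  qed
qed

text \<open>
  A subgroup of a free group is projective. The section is the Schreier cocycle: reading a word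
  letter by letter, one lifts the elements \<open>rep g \<cdot> s \<cdot> rep (g \<cdot> s)\<^sup>-\<^sup>1\<close>,
  which lie in the subgroup.
\<close>

lemma free_group_section:
  fixes I :: "'x set" and X :: "('b, 'd) monoid_scheme" and G :: "('a, 'c) monoid_scheme" (structure)
  assumes X: "group X" and G: "group G" and r: "r \<in> hom X G" and \<phi>: "\<phi> \<in> hom (free_group I) G"
    and D: "subgroup D X"
  obtains \<sigma> where
    "\<And>f. f \<in> carrier (free_group I) \<Longrightarrow> \<phi> f \<in> r ` D \<Longrightarrow> \<sigma> f \<in> D \<and> r (\<sigma> f) = \<phi> f"
    "\<And>f f'. f \<in> carrier (free_group I) \<Longrightarrow> f' \<in> carrier (free_group I) \<Longrightarrow> \<phi> f \<in> r ` D \<Longrightarrow>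
      \<phi> f' \<in> r ` D \<Longrightarrow> \<sigma> (f \<otimes>\<^bsub>free_group I\<^esub> f') = \<sigma> f \<otimes>\<^bsub>X\<^esub> \<sigma> f'"
proof -
  interpret X: group X by fact
  interpret G: group G by fact
  let ?F = "free_group I"
  interpret F: group ?F by (rule group_free_group)
  interpret r: group_hom X G r by unfold_locales fact
  interpret \<phi>: group_hom ?F G \<phi> by unfold_locales fact
  interpret D: subgroup D X by fact
  define K where "K = r ` D"
  have K: "subgroup K G" unfolding K_def by (rule r.subgroup_img_is_subgroup[OF D])
  interpret K: subgroup K G by fact
  define S where "S = I \<times> (UNIV :: bool set)"
  define E :: "(('x \<times> bool) list \<times> ('x \<times> bool) list) set" where "E = {([(x, b), (x, \<not> b)], []) |x b. x \<in> I}"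
  define cl where "cl w = word_cong S E `` {w}" for w
  have F: "?F = word_quotient S E" by (simp add: free_group_def S_def E_def)
  have F_carr: "carrier ?F = cl ` lists S" by (simp add: F word_quotient_carrier cl_def)
  have cl_append: "cl (u @ v) = cl u \<otimes>\<^bsub>?F\<^esub> cl v" if "u \<in> lists S" "v \<in> lists S" for u v
    using that by (simp add: F cl_def word_quotient_mult)
  have cl_Nil: "cl [] = \<one>\<^bsub>?F\<^esub>" by (simp add: F cl_def word_quotient_one)
  have cl_in: "cl w \<in> carrier ?F" if "w \<in> lists S" for w using that by (simp add: F_carr)
  define \<psi> where "\<psi> s = \<phi> (cl [s])" for s
  define val where "val w = \<phi> (cl w)" for w
  have \<psi>_in: "\<psi> s \<in> carrier G" if "s \<in> S" for s using that by (simp add: \<psi>_def cl_in)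
  have val_in: "val w \<in> carrier G" if "w \<in> lists S" for w using that by (simp add: val_def cl_in)
  have val_Nil: "val [] = \<one>" by (simp add: val_def cl_Nil)
  have val_append: "val (u @ v) = val u \<otimes> val v" if "u \<in> lists S" "v \<in> lists S" for u v
    using that by (simp add: val_def cl_append cl_in)
  have val_Cons: "val (s # w) = \<psi> s \<otimes> val w" if "s \<in> S" "w \<in> lists S" for s w
    using val_append[of "[s]" w] that by (simp add: val_def \<psi>_def)
  have \<psi>_cancel: "\<psi> (x, b) \<otimes> \<psi> (x, \<not> b) = \<one>" if "x \<in> I" for x b
  proof -
    have "([(x, b), (x, \<not> b)], []) \<in> word_cong S E"
      using word_cong.base[of "[(x, b), (x, \<not> b)]" "[]" E S "[]" "[]"] that by (auto simp: E_def S_def)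
    then have "cl [(x, b), (x, \<not> b)] = cl []"
      unfolding cl_def using that by (subst word_cong_class_eq) (auto simp: S_def)
    then have "val [(x, b), (x, \<not> b)] = \<one>" by (simp add: val_def cl_Nil)
    then show ?thesis using that \<psi>_in by (simp add: val_Cons val_Nil S_def)
  qed
  have \<psi>_False: "\<psi> (x, False) = inv \<psi> (x, True)" if "x \<in> I" for x
    using \<psi>_cancel[OF that, of False] \<psi>_in that by (intro G.inv_equality[symmetric]) (auto simp: S_def)
  obtain rep where rep: "\<And>g. g \<in> carrier G \<Longrightarrow> rep g \<in> carrier G"
    "\<And>g. g \<in> carrier G \<Longrightarrow> g \<otimes> inv rep g \<in> K" "\<And>g. g \<in> K \<Longrightarrow> rep g = \<one>"
    "\<And>g h. g \<in> carrier G \<Longrightarrow> h \<in> carrier G \<Longrightarrow> g \<otimes> inv h \<in> K \<Longrightarrow> rep g = rep h"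
    using G.coset_representatives[OF K] by blast
  have trans: "rep g \<otimes> y \<otimes> inv rep (g \<otimes> y) \<in> K" if "g \<in> carrier G" "y \<in> carrier G" for g y
  proof -
    have "inv (g \<otimes> inv rep g) \<otimes> ((g \<otimes> y) \<otimes> inv rep (g \<otimes> y)) \<in> K"
      using that rep(2) by simp
    moreover have "inv (g \<otimes> inv rep g) \<otimes> ((g \<otimes> y) \<otimes> inv rep (g \<otimes> y))
        = rep g \<otimes> y \<otimes> inv rep (g \<otimes> y)"
      using that rep(1) by (simp add: G.inv_mult_group G.m_assoc G.inv_solve_left')
    ultimately show ?thesis by simp
  qed
  define lift where "lift k = (SOME d. d \<in> D \<and> r d = k)" for k
  have lift: "lift k \<in> D" "r (lift k) = k" if "k \<in> K" for k
    using someI_ex[of "\<lambda>d. d \<in> D \<and> r d = k"] that by (auto simp: lift_def K_def)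
  define pos where "pos g x = lift (rep g \<otimes> \<psi> (x, True) \<otimes> inv rep (g \<otimes> \<psi> (x, True)))" for g x
  \<comment> \<open>An inverse letter retraces the positive edge that ends at the coset of
    \<open>g\<close>. Inverting that lift, instead of choosing another one, makes
    \<open>step_cancel\<close> hold exactly.\<close>
  define step where "step g s = (if snd s then pos g (fst s)
    else inv\<^bsub>X\<^esub> pos (g \<otimes> inv \<psi> (fst s, True)) (fst s))" for g s
  have pos: "pos g x \<in> D" "r (pos g x) = rep g \<otimes> \<psi> (x, True) \<otimes> inv rep (g \<otimes> \<psi> (x, True))"
    if "g \<in> carrier G" "x \<in> I" for g x
    using lift trans \<psi>_in that by (auto simp: pos_def S_def)
  have step: "step g s \<in> D" "r (step g s) = rep g \<otimes> \<psi> s \<otimes> inv rep (g \<otimes> \<psi> s)"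
    if g: "g \<in> carrier G" and s: "s \<in> S" for g s
  proof -
    obtain x b where xb: "s = (x, b)" "x \<in> I" using s by (auto simp: S_def)
    have \<psi>T: "\<psi> (x, True) \<in> carrier G" using xb \<psi>_in by (auto simp: S_def)
    show "step g s \<in> D" using pos xb g \<psi>T by (auto simp: step_def)
    show "r (step g s) = rep g \<otimes> \<psi> s \<otimes> inv rep (g \<otimes> \<psi> s)"
    proof (cases b)
      case False
      have "pos (g \<otimes> inv \<psi> (x, True)) x \<in> carrier X"
        using pos(1)[of "g \<otimes> inv \<psi> (x, True)" x] g \<psi>T xb by auto
      then show ?thesis
        using False xb g \<psi>T pos(2)[of "g \<otimes> inv \<psi> (x, True)" x] rep(1)
        by (simp add: step_def \<psi>_False G.m_assoc G.inv_mult_group)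
    qed (use pos g xb in \<open>auto simp: step_def\<close>)
  qed
  have step_cancel: "step g (x, b) \<otimes>\<^bsub>X\<^esub> step (g \<otimes> \<psi> (x, b)) (x, \<not> b) = \<one>\<^bsub>X\<^esub>"
    if g: "g \<in> carrier G" and x: "x \<in> I" for g x b
  proof -
    have \<psi>T: "\<psi> (x, True) \<in> carrier G" using x \<psi>_in by (auto simp: S_def)
    have in_X: "pos h x \<in> carrier X" if "h \<in> carrier G" for h using pos(1)[OF that x] by simp
    show ?thesis
      using g \<psi>T in_X[of g] in_X[of "g \<otimes> inv \<psi> (x, True)"]
      by (cases b) (simp_all add: step_def \<psi>_False[OF x] G.m_assoc)
  qed
  have rep_mult: "rep (g \<otimes> y) = rep (h \<otimes> y)"
    if "g \<in> carrier G" "h \<in> carrier G" "y \<in> carrier G" "g \<otimes> inv h \<in> K" for g h y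
  proof (rule rep(4))
    have "g \<otimes> y \<otimes> inv (h \<otimes> y) = g \<otimes> inv h"
      using that by (simp add: G.inv_mult_group G.m_assoc G.inv_mult_cancel)
    with that show "g \<otimes> y \<otimes> inv (h \<otimes> y) \<in> K" by simp
  qed (use that in auto)
  have coset_mult: "(g \<otimes> y) \<otimes> inv (h \<otimes> y) \<in> K"
    if "g \<in> carrier G" "h \<in> carrier G" "y \<in> carrier G" "g \<otimes> inv h \<in> K" for g h y
    using that by (simp add: G.inv_mult_group G.m_assoc G.inv_mult_cancel)
  \<comment> \<open>The lifts depend on the coset of \<open>g\<close> only; this later permits
    restarting a path at \<open>\<one>\<close>.\<close>
  have step_coset: "step g s = step h s"
    if gh: "g \<in> carrier G" "h \<in> carrier G" and sS: "s \<in> S" and gK: "g \<otimes> inv h \<in> K" for g h s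
  proof -
    obtain x b where xb: "s = (x, b)" "x \<in> I" using sS by (auto simp: S_def)
    have \<psi>T: "\<psi> (x, True) \<in> carrier G" using xb \<psi>_in by (auto simp: S_def)
    have "pos g' x = pos h' x" if "g' \<in> carrier G" "h' \<in> carrier G" "g' \<otimes> inv h' \<in> K" for g' h'
      using rep(4)[OF that] rep_mult[OF that(1,2) \<psi>T that(3)] by (simp add: pos_def)
    from this[of g h] this[of "g \<otimes> inv \<psi> (x, True)" "h \<otimes> inv \<psi> (x, True)"]
    show ?thesis
      using gh gK \<psi>T xb coset_mult[of g h "inv \<psi> (x, True)"] by (simp add: step_def)
  qed
  \<comment> \<open>\<open>c w g\<close> is the product of the lifted edges along the path that
    reads \<open>w\<close> from the coset of \<open>g\<close>.\<close>
  define c where "c = rec_list (\<lambda>g. \<one>\<^bsub>X\<^esub>) (\<lambda>s w f g. step g s \<otimes>\<^bsub>X\<^esub> f (g \<otimes> \<psi> s))"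
  have c_Nil: "c [] g = \<one>\<^bsub>X\<^esub>" and c_Cons: "c (s # w) g = step g s \<otimes>\<^bsub>X\<^esub> c w (g \<otimes> \<psi> s)" for s w g
    by (simp_all add: c_def)
  have c_in: "c w g \<in> D" if "w \<in> lists S" "g \<in> carrier G" for w g
    using that by (induction w arbitrary: g) (auto simp: c_Nil c_Cons step \<psi>_in)
  have c_r: "r (c w g) = rep g \<otimes> val w \<otimes> inv rep (g \<otimes> val w)" if "w \<in> lists S" "g \<in> carrier G" for w g
    using that
  proof (induction w arbitrary: g)
    case Nil
    then show ?case by (simp add: c_Nil val_Nil rep(1))
  next
    case (Cons s w)
    then have s: "s \<in> S" "w \<in> lists S" by auto
    have "r (c (s # w) g) = r (step g s) \<otimes> r (c w (g \<otimes> \<psi> s))"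
      using Cons.prems s step(1)[of g s] c_in[of w "g \<otimes> \<psi> s"] \<psi>_in by (simp add: c_Cons)
    also have "\<dots> = rep g \<otimes> \<psi> s \<otimes> inv rep (g \<otimes> \<psi> s) \<otimes>
        (rep (g \<otimes> \<psi> s) \<otimes> val w \<otimes> inv rep (g \<otimes> \<psi> s \<otimes> val w))"
      using Cons s \<psi>_in by (simp add: step)
    also have "\<dots> = rep g \<otimes> val (s # w) \<otimes> inv rep (g \<otimes> val (s # w))"
      using Cons.prems s \<psi>_in val_in rep(1)
      by (simp add: val_Cons G.m_assoc G.inv_mult_cancel)
    finally show ?case .
  qed
  have c_append: "c (u @ v) g = c u g \<otimes>\<^bsub>X\<^esub> c v (g \<otimes> val u)"
    if "u \<in> lists S" "v \<in> lists S" "g \<in> carrier G" for u v g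
    using that
  proof (induction u arbitrary: g)
    case Nil
    then show ?case using c_in[of v g] by (simp add: c_Nil val_Nil)
  next
    case (Cons s u)
    then have s: "s \<in> S" "u \<in> lists S" by auto
    have "g \<otimes> \<psi> s \<in> carrier G" "g \<otimes> val (s # u) \<in> carrier G"
      using Cons.prems s \<psi>_in val_in by auto
    then have "step g s \<in> carrier X" "c u (g \<otimes> \<psi> s) \<in> carrier X" "c v (g \<otimes> val (s # u)) \<in> carrier X"
      using Cons.prems s step(1) c_in by auto
    then show ?case
      using Cons.IH[of "g \<otimes> \<psi> s"] Cons.prems s \<psi>_in val_in
      by (simp add: c_Cons val_Cons X.m_assoc G.m_assoc)
  qed
  have c_coset: "c w g = c w h"
    if "w \<in> lists S" "g \<in> carrier G" "h \<in> carrier G" "g \<otimes> inv h \<in> K" for w g h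
    using that
  proof (induction w arbitrary: g h)
    case (Cons s w)
    then have s: "s \<in> S" "w \<in> lists S" by auto
    from Cons.IH[OF _ _ coset_mult[OF Cons.prems(1,2) \<psi>_in[OF s(1)] Cons.prems(3)]]
      step_coset[OF Cons.prems(1,2) s(1) Cons.prems(3)] Cons.prems s \<psi>_in
    show ?case by (simp add: c_Cons)
  qed (simp add: c_Nil)
  have c_cong: "c u g = c v g" if "(u, v) \<in> word_cong S E" "g \<in> carrier G" for u v g
    using that
  proof (induction arbitrary: g rule: word_cong.induct)
    case (base l r' u v)
    then obtain x b where xb: "l = [(x, b), (x, \<not> b)]" "r' = []" "x \<in> I" by (auto simp: E_def)
    let ?h = "g \<otimes> val u"
    have h: "?h \<in> carrier G" using base val_in by simp
    have xS: "(x, b) \<in> S" "(x, \<not> b) \<in> S" using xb by (auto simp: S_def)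
    have "c ([(x, b), (x, \<not> b)] @ v) ?h
        = step ?h (x, b) \<otimes>\<^bsub>X\<^esub> (step (?h \<otimes> \<psi> (x, b)) (x, \<not> b) \<otimes>\<^bsub>X\<^esub> c v (?h \<otimes> \<psi> (x, b) \<otimes> \<psi> (x, \<not> b)))"
      by (simp add: c_Cons)
    also have "?h \<otimes> \<psi> (x, b) \<otimes> \<psi> (x, \<not> b) = ?h"
      using \<psi>_cancel[OF xb(3)] h \<psi>_in[OF xS(1)] \<psi>_in[OF xS(2)] by (simp only: G.m_assoc G.r_one)
    also have "step ?h (x, b) \<otimes>\<^bsub>X\<^esub> (step (?h \<otimes> \<psi> (x, b)) (x, \<not> b) \<otimes>\<^bsub>X\<^esub> c v ?h) = c v ?h"
    proof -
      have "step ?h (x, b) \<in> carrier X" "step (?h \<otimes> \<psi> (x, b)) (x, \<not> b) \<in> carrier X" "c v ?h \<in> carrier X"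
        using step(1)[OF h xS(1)] step(1)[OF _ xS(2)] c_in[of v ?h] h base \<psi>_in[OF xS(1)] by auto
      then show ?thesis using step_cancel[OF h xb(3), of b] by (simp flip: X.m_assoc)
    qed
    finally show ?case
      using base xb xS c_append[of u "[(x, b), (x, \<not> b)] @ v" g] c_append[of u v g] by simp
  next
    case (trans u v w)
    then show ?case by metis
  qed auto
  define \<sigma> where "\<sigma> f = c (SOME w. w \<in> f) \<one>" for f
  have \<sigma>: "\<sigma> (cl w) = c w \<one>" if "w \<in> lists S" for w
  proof -
    have "(SOME v. v \<in> cl w) \<in> cl w"
      using word_cong.refl[OF that] by (intro someI[of "\<lambda>v. v \<in> cl w" w]) (simp add: cl_def)
    then show ?thesis unfolding \<sigma>_def using c_cong[of w _ "\<one>"] by (auto simp: cl_def)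
  qed
  have rep1: "rep \<one> = \<one>" using rep(3) K.one_closed by blast
  show thesis
  proof
    fix f assume f: "f \<in> carrier ?F" "\<phi> f \<in> r ` D"
    then obtain w where w: "f = cl w" "w \<in> lists S" by (auto simp: F_carr)
    have val: "\<phi> f = val w" by (simp add: w val_def)
    have "rep (val w) = \<one>" using f(2) rep(3) by (simp add: val K_def)
    then show "\<sigma> f \<in> D \<and> r (\<sigma> f) = \<phi> f"
      unfolding val unfolding w(1)
      using c_in[OF w(2), of "\<one>"] c_r[OF w(2), of "\<one>"] val_in[OF w(2)]
      by (simp add: \<sigma>[OF w(2)] rep1)
    fix f' assume f': "f' \<in> carrier ?F" "\<phi> f' \<in> r ` D"
    then obtain w' where w': "f' = cl w'" "w' \<in> lists S" by (auto simp: F_carr)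
    \<comment> \<open>As \<open>val w\<close> lies in \<open>K\<close>, the cocycle rule
      \<open>c_append\<close> loses its twist and becomes multiplicativity.\<close>
    have "c w' (val w) = c w' \<one>"
      using f(2) val_in[OF w(2)] by (intro c_coset w') (auto simp: val K_def)
    then show "\<sigma> (f \<otimes>\<^bsub>?F\<^esub> f') = \<sigma> f \<otimes>\<^bsub>X\<^esub> \<sigma> f'"
      using c_append[OF w(2) w'(2), of "\<one>"] w w' val_in[OF w(2)]
      by (simp add: \<sigma> flip: cl_append)
  qed
qed

section \<open>Chain conditions\<close>

definition acc_sets :: "'a set set \<Rightarrow> bool" where
  "acc_sets F \<longleftrightarrow> (\<forall>f :: nat \<Rightarrow> 'a set. (\<forall>n. f n \<in> F \<and> f n \<subseteq> f (Suc n)) \<longrightarrow> (\<exists>m. \<forall>n\<ge>m. f n = f m))"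

lemma acc_setsD:
  assumes "acc_sets F" "\<And>n. f n \<in> F" "\<And>n. f n \<subseteq> f (Suc n)"
  obtains m where "\<And>n. m \<le> n \<Longrightarrow> f n = f m"
  using assms unfolding acc_sets_def by meson

text \<open>The operators in \<open>T\<close> play the role of polynomial variables, so these are
  the submodules of \<open>U\<close>; for empty \<open>T\<close> they are the submodules over the
  integers.\<close>

definition stable_subgroups :: "('a, 'b) monoid_scheme \<Rightarrow> ('a \<Rightarrow> 'a) set \<Rightarrow> 'a set \<Rightarrow> 'a set set" where
  "stable_subgroups G T U = {N. subgroup N G \<and> N \<subseteq> U \<and> (\<forall>\<tau>\<in>T. \<tau> ` N \<subseteq> N)}"

text \<open>The integers are Noetherian: the least positive element occurring anywhere in the chain
  generates every member, so the chain is constant from the index where that element first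
  appears.\<close>

lemma acc_int_ideals:
  fixes f :: "nat \<Rightarrow> int set"
  assumes zero: "\<And>n. 0 \<in> f n" and diff: "\<And>n x y. x \<in> f n \<Longrightarrow> y \<in> f n \<Longrightarrow> x - y \<in> f n"
    and mono: "\<And>n. f n \<subseteq> f (Suc n)"
  obtains m where "\<And>n. m \<le> n \<Longrightarrow> f n = f m"
proof -
  have mono': "f m \<subseteq> f n" if "m \<le> n" for m n
    using mono that by (rule lift_Suc_mono_le)
  have neg: "- x \<in> f n" if "x \<in> f n" for x n
    using diff[OF zero that] by simp
  have mult: "x * k \<in> f n" if "x \<in> f n" for x k n
  proof -
    have "x * int k \<in> f n" for k
    proof (induction k)
      case (Suc k)
      from diff[OF Suc neg[OF that]] show ?case by (simp add: algebra_simps)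
    qed (simp add: zero)
    from this[of "nat k"] neg[OF this[of "nat (- k)"]] show ?thesis
      by (cases "k \<ge> 0") auto
  qed
  define P where "P d \<longleftrightarrow> 0 < d \<and> (\<exists>n. int d \<in> f n)" for d
  show thesis
  proof (cases "\<exists>d. P d")
    case True
    define d where "d = (LEAST d. P d)"
    have "P d" unfolding d_def using True by (rule LeastI_ex)
    then obtain m where d: "0 < d" "int d \<in> f m" by (auto simp: P_def)
    have "f n \<subseteq> f m" for n
    proof
      fix x assume "x \<in> f n"
      then have "x - int d * (x div int d) \<in> f (max m n)"
        using mono'[of n "max m n"] mono'[of m "max m n"] d(2) by (intro diff mult) auto
      then have "int (nat (x mod int d)) \<in> f (max m n)"
        using d by (simp add: minus_mult_div_eq_mod)
      moreover have "nat (x mod int d) < d" using d by (simp add: nat_less_iff)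
      then have "\<not> P (nat (x mod int d))" unfolding d_def by (rule not_less_Least)
      ultimately have "nat (x mod int d) = 0" unfolding P_def by (meson gr0I)
      then have "x mod int d = 0" using d pos_mod_sign[of "int d" x] by linarith
      then have "x = int d * (x div int d)" by auto
      with mult[OF d(2)] show "x \<in> f m" by metis
    qed
    with mono' show thesis using that[of m] by blast
  next
    case False
    have "x = 0" if "x \<in> f n" for x n
    proof (rule ccontr)
      assume "x \<noteq> 0"
      moreover have "\<bar>x\<bar> \<in> f n" using that neg by (auto simp: abs_if)
      ultimately have "P (nat \<bar>x\<bar>)" by (auto simp: P_def)
      with False show False by blast
    qed
    then have "f n = {0}" for n using zero by blast
    then show thesis using that by blast
  qed
qed

lemma (in group) hom_funpow: "\<tau> \<in> hom G G \<Longrightarrow> (\<tau> ^^ n) \<in> hom G G"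
  by (induction n) (auto simp: hom_def Pi_iff)

context comm_group
begin

text \<open>Nested subgroups of \<open>U'\<close> coincide once they have the same intersection with
  \<open>U\<close> and the same exponents of \<open>b\<close> in their elements. The former is
  controlled by \<open>acc\<close>, the latter form ideals of the integers.\<close>

lemma acc_add_generator:
  assumes U: "subgroup U G" and acc: "acc_sets (stable_subgroups G {} U)" and b: "b \<in> carrier G"
  obtains U' where "subgroup U' G" "U \<subseteq> U'" "b \<in> U'" "acc_sets (stable_subgroups G {} U')"
proof -
  interpret U: subgroup U G by fact
  define U' where "U' = {u \<otimes> b [^] (k::int) | u k. u \<in> U}"
  have sub: "subgroup U' G"
  proof (rule subgroupI)
    show "U' \<subseteq> carrier G" using b U.subset by (auto simp: U'_def)
    show "U' \<noteq> {}" using U.one_closed unfolding U'_def by blast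
    fix x y assume "x \<in> U'" "y \<in> U'"
    then obtain u v k l where x: "x = u \<otimes> b [^] (k::int)" "u \<in> U" and y: "y = v \<otimes> b [^] (l::int)" "v \<in> U"
      by (auto simp: U'_def)
    have "inv x = inv u \<otimes> b [^] (- k)"
      using x b by (simp add: inv_mult int_pow_neg)
    then show "inv x \<in> U'" using x unfolding U'_def by blast
    have "x \<otimes> y = (u \<otimes> v) \<otimes> b [^] (k + l)"
      using x y b by (simp add: int_pow_mult m_ac)
    then show "x \<otimes> y \<in> U'" using x y unfolding U'_def by blast
  qed
  have "U \<subseteq> U'"
  proof
    fix u assume "u \<in> U"
    then show "u \<in> U'" unfolding U'_def by (intro CollectI exI[of _ u] exI[of _ 0]) auto
  qed
  moreover have "b \<in> U'"
    unfolding U'_def using b by (intro CollectI exI[of _ \<one>] exI[of _ 1]) (auto simp: int_pow_1)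
  moreover have "acc_sets (stable_subgroups G {} U')"
    unfolding acc_sets_def
  proof (intro allI impI)
    fix f :: "nat \<Rightarrow> 'a set" assume f: "\<forall>n. f n \<in> stable_subgroups G {} U' \<and> f n \<subseteq> f (Suc n)"
    then have fsub: "subgroup (f n) G" and fU: "f n \<subseteq> U'" and fS: "f n \<subseteq> f (Suc n)" for n
      by (auto simp: stable_subgroups_def)
    have fm: "f m \<subseteq> f n" if "m \<le> n" for m n using fS that by (rule lift_Suc_mono_le)
    obtain m1 where m1: "\<And>n. m1 \<le> n \<Longrightarrow> f n \<inter> U = f m1 \<inter> U"
    proof (rule acc_setsD[OF acc, of "\<lambda>n. f n \<inter> U"])
      show "f n \<inter> U \<in> stable_subgroups G {} U" for n
        using subgroups_Inter_pair[OF fsub U] by (simp add: stable_subgroups_def)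
      show "f n \<inter> U \<subseteq> f (Suc n) \<inter> U" for n using fS by blast
    qed (rule that)
    let ?I = "\<lambda>n. {k::int. \<exists>u\<in>U. u \<otimes> b [^] k \<in> f n}"
    obtain m2 where m2: "\<And>n. m2 \<le> n \<Longrightarrow> ?I n = ?I m2"
    proof -
      assume m2: "\<And>m2. (\<And>n. m2 \<le> n \<Longrightarrow> ?I n = ?I m2) \<Longrightarrow> thesis"
      show thesis
    proof (rule acc_int_ideals[of ?I])
      fix n
      interpret F: subgroup "f n" G by (rule fsub)
      show "0 \<in> ?I n" using F.one_closed U.one_closed by (auto intro!: bexI[of _ \<one>])
      show "?I n \<subseteq> ?I (Suc n)" using fS by blast
      show thesis if "\<And>n. m \<le> n \<Longrightarrow> ?I n = ?I m" for m using m2 that .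
      fix k l assume "k \<in> ?I n" "l \<in> ?I n"
      then obtain u v where uv: "u \<in> U" "u \<otimes> b [^] k \<in> f n" "v \<in> U" "v \<otimes> b [^] l \<in> f n" by auto
      then have "(u \<otimes> b [^] k) \<otimes> inv (v \<otimes> b [^] l) \<in> f n" by auto
      moreover have "(u \<otimes> b [^] k) \<otimes> inv (v \<otimes> b [^] l) = (u \<otimes> inv v) \<otimes> b [^] (k - l)"
        using uv b by (simp add: inv_mult int_pow_diff m_ac)
      moreover have "u \<otimes> inv v \<in> U" using uv by auto
      ultimately show "k - l \<in> ?I n" by auto
    qed
    qed
    have "f n \<subseteq> f (max m1 m2)" if n: "max m1 m2 \<le> n" for n
    proof
      let ?m = "max m1 m2"
      interpret Fn: subgroup "f n" G by (rule fsub)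
      interpret Fm: subgroup "f ?m" G by (rule fsub)
      fix x assume x: "x \<in> f n"
      then obtain u k where u: "x = u \<otimes> b [^] (k::int)" "u \<in> U" using fU unfolding U'_def by blast
      with x have "k \<in> ?I n" by auto
      then have "k \<in> ?I ?m" using m2[of n] m2[of ?m] n by auto
      then obtain v where v: "v \<in> U" "v \<otimes> b [^] k \<in> f ?m" by auto
      have eq: "x \<otimes> inv (v \<otimes> b [^] k) = u \<otimes> inv v"
      proof -
        have "x \<otimes> inv (v \<otimes> b [^] k) = (u \<otimes> inv v) \<otimes> (b [^] k \<otimes> inv (b [^] k))"
          using u v b by (simp add: inv_mult m_ac del: r_inv)
        then show ?thesis using u v b by simp
      qed
      have "x \<otimes> inv (v \<otimes> b [^] k) \<in> f n" using x v fm[OF n] by auto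
      then have "u \<otimes> inv v \<in> f n \<inter> U" using eq u v by auto
      then have "u \<otimes> inv v \<in> f ?m" using m1[of n] m1[of ?m] n by auto
      then have "(u \<otimes> inv v) \<otimes> (v \<otimes> b [^] k) \<in> f ?m" using v by auto
      moreover have "(u \<otimes> inv v) \<otimes> (v \<otimes> b [^] k) = x"
        using u v b by (simp add: m_assoc) (simp add: m_assoc[symmetric])
      ultimately show "x \<in> f ?m" by simp
    qed
    with fm show "\<exists>m. \<forall>n\<ge>m. f n = f m" by (intro exI[of _ "max m1 m2"]) blast
  qed
  ultimately show thesis using that sub by blast
qed

text \<open>The argument of Hilbert's basis theorem, with \<open>lc n N\<close> as the leading coefficients in degree \<open>n\<close>.\<close>

lemma acc_add_endomorphism:
  assumes U: "subgroup U G" and UT: "\<And>\<sigma>. \<sigma> \<in> T \<Longrightarrow> \<sigma> ` U \<subseteq> U"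
    and acc: "acc_sets (stable_subgroups G T U)"
    and \<tau>: "\<tau> \<in> hom G G" and T: "T \<subseteq> hom G G"
    and comm: "\<And>\<sigma> x. \<sigma> \<in> T \<Longrightarrow> x \<in> carrier G \<Longrightarrow> \<sigma> (\<tau> x) = \<tau> (\<sigma> x)"
  obtains U' where "subgroup U' G" "U \<subseteq> U'" "\<And>\<sigma>. \<sigma> \<in> insert \<tau> T \<Longrightarrow> \<sigma> ` U' \<subseteq> U'"
    "acc_sets (stable_subgroups G (insert \<tau> T) U')"
proof -
  interpret U: subgroup U G by fact
  interpret \<tau>: group_hom G G \<tau> by unfold_locales fact
  interpret \<tau>n: group_hom G G "\<tau> ^^ n" for n by unfold_locales (rule hom_funpow[OF \<tau>])
  have T_hom: "\<sigma> x \<in> carrier G" "\<sigma> (x \<otimes> y) = \<sigma> x \<otimes> \<sigma> y" if "\<sigma> \<in> T" "x \<in> carrier G" "y \<in> carrier G" for \<sigma> x y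
    using subsetD[OF T that(1)] that by (auto simp: hom_def)
  have commn: "\<sigma> ((\<tau> ^^ n) x) = (\<tau> ^^ n) (\<sigma> x)" if "\<sigma> \<in> T" "x \<in> carrier G" for \<sigma> n x
    using that by (induction n) (auto simp: comm)
  have dist: "\<sigma> (v \<otimes> (\<tau> ^^ n) u) = \<sigma> v \<otimes> (\<tau> ^^ n) (\<sigma> u)"
    if "\<sigma> \<in> T" "v \<in> carrier G" "u \<in> carrier G" for \<sigma> n u v
    using that by (simp add: T_hom commn)
  \<comment> \<open>\<open>S n\<close> consists of the polynomials in \<open>\<tau>\<close> of
    degree less than \<open>n\<close> with coefficients in \<open>U\<close>.\<close>
  define S where "S = rec_nat {\<one>} (\<lambda>n A. {v \<otimes> (\<tau> ^^ n) u | v u. v \<in> A \<and> u \<in> U})"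
  have S0: "S 0 = {\<one>}" and S_Suc: "S (Suc n) = {v \<otimes> (\<tau> ^^ n) u | v u. v \<in> S n \<and> u \<in> U}" for n
    by (simp_all add: S_def)
  have S_sub: "subgroup (S n) G" for n
  proof (induction n)
    case 0
    show ?case unfolding S0 by (rule triv_subgroup)
  next
    case (Suc n)
    interpret Sn: subgroup "S n" G by fact
    show ?case
    proof (rule subgroupI)
      show "S (Suc n) \<subseteq> carrier G" by (auto simp: S_Suc)
      show "S (Suc n) \<noteq> {}" using Sn.one_closed U.one_closed unfolding S_Suc by blast
      fix x y assume "x \<in> S (Suc n)" "y \<in> S (Suc n)"
      then obtain v u v' u' where x: "x = v \<otimes> (\<tau> ^^ n) u" "v \<in> S n" "u \<in> U"
        and y: "y = v' \<otimes> (\<tau> ^^ n) u'" "v' \<in> S n" "u' \<in> U" unfolding S_Suc by blast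
      have "inv x = inv v \<otimes> (\<tau> ^^ n) (inv u)" using x by (simp add: inv_mult)
      then show "inv x \<in> S (Suc n)" using x unfolding S_Suc by blast
      have "x \<otimes> y = (v \<otimes> v') \<otimes> (\<tau> ^^ n) (u \<otimes> u')" using x y by (simp add: m_ac)
      then show "x \<otimes> y \<in> S (Suc n)" using x y unfolding S_Suc by blast
    qed
  qed
  interpret S: subgroup "S n" G for n by (rule S_sub)
  have S_mono1: "S n \<subseteq> S (Suc n)" for n
  proof
    fix x assume "x \<in> S n"
    then show "x \<in> S (Suc n)" unfolding S_Suc by (intro CollectI exI[of _ x] exI[of _ \<one>]) auto
  qed
  have S_mono: "S m \<subseteq> S n" if "m \<le> n" for m n
    using S_mono1 that by (rule lift_Suc_mono_le)
  have S_\<tau>: "\<tau> x \<in> S (Suc n)" if "x \<in> S n" for x n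
    using that
  proof (induction n arbitrary: x)
    case 0
    then show ?case using S.one_closed by (simp add: S0)
  next
    case (Suc n)
    then obtain v u where x: "x = v \<otimes> (\<tau> ^^ n) u" "v \<in> S n" "u \<in> U" unfolding S_Suc by blast
    then have "\<tau> x = \<tau> v \<otimes> (\<tau> ^^ Suc n) u" by simp
    with Suc.IH[OF x(2)] x(3) show ?case unfolding S_Suc[of "Suc n"] by blast
  qed
  have S_T: "\<sigma> x \<in> S n" if \<sigma>: "\<sigma> \<in> T" and "x \<in> S n" for \<sigma> x n
    using that(2)
  proof (induction n arbitrary: x)
    case 0
    interpret \<sigma>: group_hom G G \<sigma> by unfold_locales (use T \<sigma> in blast)
    show ?case using 0 by (simp add: S0)
  next
    case (Suc n)
    then obtain v u where x: "x = v \<otimes> (\<tau> ^^ n) u" "v \<in> S n" "u \<in> U" unfolding S_Suc by blast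
    then have "\<sigma> x = \<sigma> v \<otimes> (\<tau> ^^ n) (\<sigma> u)" using \<sigma> by (simp add: dist)
    with Suc.IH[OF x(2)] UT[OF \<sigma>] x(3) show ?case unfolding S_Suc by blast
  qed
  define U' where "U' = (\<Union>n. S n)"
  have U'_sub: "subgroup U' G"
  proof (rule subgroupI)
    show "U' \<subseteq> carrier G" by (auto simp: U'_def)
    show "U' \<noteq> {}" using S.one_closed unfolding U'_def by blast
    fix x y assume "x \<in> U'" "y \<in> U'"
    then obtain m n where "x \<in> S m" "y \<in> S n" by (auto simp: U'_def)
    then have "x \<in> S (max m n)" "y \<in> S (max m n)" using S_mono[of m "max m n"] S_mono[of n "max m n"] by auto
    then have "inv x \<in> S (max m n)" "x \<otimes> y \<in> S (max m n)" by auto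
    then show "inv x \<in> U'" "x \<otimes> y \<in> U'" by (auto simp: U'_def)
  qed
  have "U \<subseteq> U'"
  proof
    fix u assume "u \<in> U"
    then have "u \<in> S (Suc 0)"
      unfolding S_Suc S0 by (intro CollectI exI[of _ \<one>] exI[of _ u]) auto
    then show "u \<in> U'" unfolding U'_def by blast
  qed
  moreover have "\<sigma> ` U' \<subseteq> U'" if "\<sigma> \<in> insert \<tau> T" for \<sigma>
    using that S_\<tau> S_T unfolding U'_def by blast
  moreover have "acc_sets (stable_subgroups G (insert \<tau> T) U')"
    unfolding acc_sets_def
  proof (intro allI impI)
    fix f :: "nat \<Rightarrow> 'a set"
    assume f: "\<forall>n. f n \<in> stable_subgroups G (insert \<tau> T) U' \<and> f n \<subseteq> f (Suc n)"
    then have fsub: "subgroup (f n) G" and fU: "f n \<subseteq> U'" and fS: "f n \<subseteq> f (Suc n)"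
      and f\<tau>: "\<tau> ` f n \<subseteq> f n" and fT: "\<And>\<sigma>. \<sigma> \<in> T \<Longrightarrow> \<sigma> ` f n \<subseteq> f n" for n
      by (auto simp: stable_subgroups_def)
    have fm: "f m \<subseteq> f n" if "m \<le> n" for m n using fS that by (rule lift_Suc_mono_le)
    interpret F: subgroup "f n" G for n by (rule fsub)
    define lc where "lc n i = {u \<in> U. \<exists>v\<in>S n. v \<otimes> (\<tau> ^^ n) u \<in> f i}" for n i
    have lc_i: "lc n i \<subseteq> lc n j" if "i \<le> j" for n i j
      using fm[OF that] by (auto simp: lc_def)
    have lc_Suc: "lc n i \<subseteq> lc (Suc n) i" for n i
    proof
      fix u assume "u \<in> lc n i"
      then obtain v where v: "u \<in> U" "v \<in> S n" "v \<otimes> (\<tau> ^^ n) u \<in> f i" by (auto simp: lc_def)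
      then have "\<tau> (v \<otimes> (\<tau> ^^ n) u) \<in> f i" using f\<tau> by blast
      then have "\<tau> v \<otimes> (\<tau> ^^ Suc n) u \<in> f i" using v by simp
      with v S_\<tau> show "u \<in> lc (Suc n) i" unfolding lc_def by blast
    qed
    have lc_n: "lc n i \<subseteq> lc m i" if "n \<le> m" for n m i
      using lc_Suc that by (rule lift_Suc_mono_le)
    have lc_in: "lc n i \<in> stable_subgroups G T U" for n i
    proof -
      have "subgroup (lc n i) G"
      proof (rule subgroupI)
        show "lc n i \<subseteq> carrier G" by (auto simp: lc_def)
        have "\<one> \<in> lc n i"
          using U.one_closed S.one_closed F.one_closed by (auto simp: lc_def intro!: bexI[of _ \<one>])
        then show "lc n i \<noteq> {}" by blast
        fix x y assume "x \<in> lc n i" "y \<in> lc n i"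
        then obtain v v' where x: "x \<in> U" "v \<in> S n" "v \<otimes> (\<tau> ^^ n) x \<in> f i"
          and y: "y \<in> U" "v' \<in> S n" "v' \<otimes> (\<tau> ^^ n) y \<in> f i" by (auto simp: lc_def)
        have "inv (v \<otimes> (\<tau> ^^ n) x) = inv v \<otimes> (\<tau> ^^ n) (inv x)" using x by (simp add: inv_mult)
        then have "inv v \<otimes> (\<tau> ^^ n) (inv x) \<in> f i" using F.m_inv_closed[OF x(3)] by simp
        then show "inv x \<in> lc n i" using x by (auto simp: lc_def intro!: bexI[of _ "inv v"])
        have "(v \<otimes> (\<tau> ^^ n) x) \<otimes> (v' \<otimes> (\<tau> ^^ n) y) = (v \<otimes> v') \<otimes> (\<tau> ^^ n) (x \<otimes> y)"
          using x y by (simp add: m_ac)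
        then have "(v \<otimes> v') \<otimes> (\<tau> ^^ n) (x \<otimes> y) \<in> f i" using F.m_closed[OF x(3) y(3)] by simp
        then show "x \<otimes> y \<in> lc n i" unfolding lc_def using x y by blast
      qed
      moreover have "\<sigma> ` lc n i \<subseteq> lc n i" if \<sigma>: "\<sigma> \<in> T" for \<sigma>
      proof (rule image_subsetI)
        fix u assume "u \<in> lc n i"
        then obtain v where u: "u \<in> U" "v \<in> S n" "v \<otimes> (\<tau> ^^ n) u \<in> f i" by (auto simp: lc_def)
        then have "\<sigma> (v \<otimes> (\<tau> ^^ n) u) \<in> f i" using fT[OF \<sigma>] by blast
        then have "\<sigma> v \<otimes> (\<tau> ^^ n) (\<sigma> u) \<in> f i" using \<sigma> u by (simp add: dist)
        moreover have "\<sigma> v \<in> S n" "\<sigma> u \<in> U" using u S_T[OF \<sigma>] UT[OF \<sigma>] by auto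
        ultimately show "\<sigma> u \<in> lc n i" unfolding lc_def by blast
      qed
      ultimately show ?thesis by (auto simp: stable_subgroups_def lc_def)
    qed
    \<comment> \<open>\<open>lc\<close> grows in both indices. Stabilization along the diagonal
      settles all degrees from \<open>m0\<close> on; the finitely many smaller degrees stabilize one
      by one, at \<open>k n\<close>.\<close>
    obtain m0 where m0: "\<And>n. m0 \<le> n \<Longrightarrow> lc n n = lc m0 m0"
    proof (rule acc_setsD[OF acc, of "\<lambda>n. lc n n"])
      show "lc n n \<subseteq> lc (Suc n) (Suc n)" for n using lc_i[of n "Suc n" n] lc_Suc[of n "Suc n"] by simp
    qed (rule lc_in, rule that)
    have "\<exists>k. \<forall>i\<ge>k. lc n i = lc n k" for n
    proof (rule acc_setsD[OF acc, of "lc n"])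
      show "lc n i \<subseteq> lc n (Suc i)" for i by (rule lc_i) simp
    qed (auto intro: lc_in)
    then obtain k where k: "\<And>n i. k n \<le> i \<Longrightarrow> lc n i = lc n (k n)" by metis
    define m where "m = Max (insert m0 (k ` {..<m0}))"
    have m: "m0 \<le> m" "\<And>n. n < m0 \<Longrightarrow> k n \<le> m" unfolding m_def by (auto intro!: Max_ge)
    have lc_const: "lc n i \<subseteq> lc n m" if "m \<le> i" for n i
    proof (cases "n < m0")
      case True
      then show ?thesis using k[of n i] k[of n m] m(2)[of n] that by simp
    next
      case False
      have "lc n i \<subseteq> lc (max n i) (max n i)"
        using lc_i[of i "max n i" n] lc_n[of n "max n i" "max n i"] by simp
      also have "\<dots> = lc m0 m0" using False by (intro m0) simp
      also have "\<dots> \<subseteq> lc n m"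
        using lc_i[of m0 m m0] lc_n[of m0 n m] m(1) False by simp
      finally show ?thesis .
    qed
    have "f i \<subseteq> f m" if i: "m \<le> i" for i
    proof
      have in_S: "x \<in> f m" if "x \<in> f i" "x \<in> S n" for x n
        using that
      proof (induction n arbitrary: x)
        case 0
        then show ?case by (simp add: S0)
      next
        case (Suc n)
        then obtain v u where x: "x = v \<otimes> (\<tau> ^^ n) u" "v \<in> S n" "u \<in> U" unfolding S_Suc by blast
        with Suc.prems have "u \<in> lc n i" by (auto simp: lc_def)
        \<comment> \<open>Dividing by an element of \<open>f m\<close> with the same leading
          coefficient lowers the degree, so the induction hypothesis applies to the
          quotient.\<close>
        then obtain v' where v': "v' \<in> S n" "v' \<otimes> (\<tau> ^^ n) u \<in> f m" using lc_const[OF i] by (auto simp: lc_def)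
        have "x \<otimes> inv (v' \<otimes> (\<tau> ^^ n) u) \<in> f i" using Suc.prems v' fm[OF i] by auto
        moreover have "x \<otimes> inv (v' \<otimes> (\<tau> ^^ n) u) = v \<otimes> inv v'"
        proof -
          have "x \<otimes> inv (v' \<otimes> (\<tau> ^^ n) u) = (v \<otimes> inv v') \<otimes> ((\<tau> ^^ n) u \<otimes> inv (\<tau> ^^ n) u)"
            using x v' by (simp add: inv_mult m_ac del: r_inv)
          then show ?thesis using x v' by simp
        qed
        ultimately have "v \<otimes> inv v' \<in> f m" using x v' by (intro Suc.IH) auto
        then have "(v \<otimes> inv v') \<otimes> (v' \<otimes> (\<tau> ^^ n) u) \<in> f m" using v' by auto
        moreover have "(v \<otimes> inv v') \<otimes> (v' \<otimes> (\<tau> ^^ n) u) = x"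
          using x v' by (simp add: m_assoc) (simp add: m_assoc[symmetric])
        ultimately show ?case by simp
      qed
      fix x assume x: "x \<in> f i"
      then obtain n where "x \<in> S n" using fU[of i] unfolding U'_def by blast
      with in_S x show "x \<in> f m" by blast
    qed
    with fm show "\<exists>m. \<forall>n\<ge>m. f n = f m" by (intro exI[of _ m]) blast
  qed
  ultimately show thesis using that U'_sub by blast
qed

text \<open>The generators in \<open>B\<close> are adjoined over the integers first; then the
  operators are added one at a time, each enlarging \<open>U\<close> so that it becomes stable under
  the new operator and remains stable under the old ones.\<close>

theorem acc_commuting_endomorphisms:
  assumes "finite T" "finite B" "B \<subseteq> carrier G" and T: "T \<subseteq> hom G G"
    and comm: "\<And>\<sigma> \<tau> x. \<sigma> \<in> T \<Longrightarrow> \<tau> \<in> T \<Longrightarrow> x \<in> carrier G \<Longrightarrow> \<sigma> (\<tau> x) = \<tau> (\<sigma> x)"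
  obtains U where "subgroup U G" "B \<subseteq> U" "\<And>\<sigma>. \<sigma> \<in> T \<Longrightarrow> \<sigma> ` U \<subseteq> U" "acc_sets (stable_subgroups G T U)"
proof -
  have "\<exists>U. subgroup U G \<and> B \<subseteq> U \<and> acc_sets (stable_subgroups G {} U)"
    using assms(2,3)
  proof (induction rule: finite_induct)
    case empty
    have "N = {\<one>}" if "N \<in> stable_subgroups G {} {\<one>}" for N
      using that subgroup.one_closed by (auto simp: stable_subgroups_def)
    then have "acc_sets (stable_subgroups G {} {\<one>})" unfolding acc_sets_def by blast
    with triv_subgroup show ?case by blast
  next
    case (insert b B)
    then obtain U where U: "subgroup U G" "B \<subseteq> U" "acc_sets (stable_subgroups G {} U)" by auto
    obtain U' where "subgroup U' G" "U \<subseteq> U'" "b \<in> U'" "acc_sets (stable_subgroups G {} U')"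
      using acc_add_generator[OF U(1,3)] insert.prems by blast
    with U(2) show ?case by (intro exI[of _ U']) auto
  qed
  then obtain U0 where U0: "subgroup U0 G" "B \<subseteq> U0" "acc_sets (stable_subgroups G {} U0)" by blast
  have "\<exists>U. subgroup U G \<and> B \<subseteq> U \<and> (\<forall>\<sigma>\<in>T. \<sigma> ` U \<subseteq> U) \<and> acc_sets (stable_subgroups G T U)"
    using assms(1) T comm
  proof (induction rule: finite_induct)
    case empty
    then show ?case using U0 by blast
  next
    case (insert \<tau> T)
    have "\<exists>U. subgroup U G \<and> B \<subseteq> U \<and> (\<forall>\<sigma>\<in>T. \<sigma> ` U \<subseteq> U) \<and> acc_sets (stable_subgroups G T U)"
      by (rule insert.IH) (use insert.prems in auto)
    then obtain U where U: "subgroup U G" "B \<subseteq> U" "\<forall>\<sigma>\<in>T. \<sigma> ` U \<subseteq> U" "acc_sets (stable_subgroups G T U)"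
      by blast
    obtain U' where "subgroup U' G" "U \<subseteq> U'" "\<And>\<sigma>. \<sigma> \<in> insert \<tau> T \<Longrightarrow> \<sigma> ` U' \<subseteq> U'"
      "acc_sets (stable_subgroups G (insert \<tau> T) U')"
    proof (rule acc_add_endomorphism[where \<tau> = \<tau> and T = T, OF U(1) _ U(4)])
      show "\<And>\<sigma>. \<sigma> \<in> T \<Longrightarrow> \<sigma> ` U \<subseteq> U" using U(3) by blast
    qed (use insert.prems in auto)
    with U(2) show ?case by (intro exI[of _ U']) auto
  qed
  with that show thesis by blast
qed

end

section \<open>The chain condition inside the kernel\<close>

text \<open>Cosets are sets, so the induced map is taken to be the image map. Surjectivity of
  \<open>\<kappa>\<close> makes the derived subgroup its own image; hence the image of a coset is
  again a full coset.\<close>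

lemma (in group) abelianization_endomorphism:
  assumes \<kappa>: "\<kappa> \<in> hom G G" and surj: "\<kappa> ` carrier G = carrier G"
  defines "C \<equiv> derived G (carrier G)"
  shows "\<And>m. m \<in> carrier G \<Longrightarrow> \<kappa> ` (C #> m) = C #> \<kappa> m"
    and "(`) \<kappa> \<in> hom (G Mod C) (G Mod C)"
proof -
  interpret \<kappa>: group_hom G G \<kappa> by unfold_locales fact
  interpret C: normal C G
    unfolding C_def by (rule derived_is_normal[OF normal_self])
  interpret Q: group "G Mod C" by (rule C.factorgroup_is_group)
  interpret \<pi>: group_hom G "G Mod C" "\<lambda>x. C #> x" by unfold_locales (rule C.r_coset_hom_Mod)
  have C: "\<kappa> ` C = C"
    using \<kappa>.derived_img[of "carrier G"] surj by (simp add: C_def)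
  show coset: "\<kappa> ` (C #> m) = C #> \<kappa> m" if m: "m \<in> carrier G" for m
  proof -
    have coset_image: "C #> x = (\<lambda>c. c \<otimes> x) ` C" for x by (auto simp: r_coset_def)
    have "\<kappa> ` (C #> m) = (\<lambda>c. \<kappa> c \<otimes> \<kappa> m) ` C"
      unfolding coset_image image_image by (rule image_cong) (use m in auto)
    also have "\<dots> = (\<lambda>c. c \<otimes> \<kappa> m) ` (\<kappa> ` C)" by (simp only: image_image)
    also have "\<dots> = C #> \<kappa> m" unfolding C coset_image ..
    finally show ?thesis .
  qed
  have carr: "carrier (G Mod C) = (\<lambda>x. C #> x) ` carrier G" by (rule carrier_FactGroup)
  show "(`) \<kappa> \<in> hom (G Mod C) (G Mod C)"
  proof (rule homI)
    show "\<kappa> ` A \<in> carrier (G Mod C)" if "A \<in> carrier (G Mod C)" for A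
      using that coset by (auto simp: carr)
    fix A B assume "A \<in> carrier (G Mod C)" "B \<in> carrier (G Mod C)"
    then obtain a b where ab: "A = C #> a" "B = C #> b" "a \<in> carrier G" "b \<in> carrier G" by (auto simp: carr)
    have "A \<otimes>\<^bsub>G Mod C\<^esub> B = C #> (a \<otimes> b)" using ab by (simp only: \<pi>.hom_mult)
    moreover have "\<kappa> ` (C #> (a \<otimes> b)) = C #> (\<kappa> a \<otimes> \<kappa> b)"
      using ab by (simp only: coset m_closed \<kappa>.hom_mult)
    moreover have "C #> (\<kappa> a \<otimes> \<kappa> b) = \<kappa> ` A \<otimes>\<^bsub>G Mod C\<^esub> \<kappa> ` B"
      using ab by (simp only: coset \<pi>.hom_mult \<kappa>.hom_closed)
    ultimately show "\<kappa> ` (A \<otimes>\<^bsub>G Mod C\<^esub> B) = \<kappa> ` A \<otimes>\<^bsub>G Mod C\<^esub> \<kappa> ` B" by (simp only:)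
  qed
qed

text \<open>\<open>A\<close>, \<open>Y\<close> and \<open>R\<close> are the finite data: normal
  generators of \<open>D\<close>, generators of \<open>X\<close>, and normal generators of the
  kernel of the cover \<open>\<phi>\<close>. They make the abelianized pullback finitely generated
  as a module, while the section \<open>\<sigma>\<close> embeds
  \<open>D \<inter> kernel X G r\<close> in it.\<close>

locale lifted_crossed_module =
  X: group X + G: group G + F: group F + r: group_hom X G r + \<phi>: group_hom F G \<phi> + D: normal D X
  for X :: "('b, 'd) monoid_scheme" (structure) and G :: "('a, 'c) monoid_scheme" and F :: "('e, 'f) monoid_scheme"
    and r :: "'b \<Rightarrow> 'a" and \<phi> :: "'e \<Rightarrow> 'a" and D :: "'b set" +
  fixes A Y :: "'b set" and R :: "'e set" and \<sigma> :: "'e \<Rightarrow> 'b"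
  assumes r_surj: "r ` carrier X = carrier G" and \<phi>_surj: "\<phi> ` carrier F = carrier G"
    and D_commute: "\<And>d l. d \<in> D \<Longrightarrow> l \<in> kernel X G r \<Longrightarrow> d \<otimes> l = l \<otimes> d"
    and commutator_mod: "\<And>x y. x \<in> carrier X \<Longrightarrow> y \<in> carrier X \<Longrightarrow> \<exists>d\<in>D. r d = r (commutator X x y)"
    and A: "finite A" "A \<subseteq> D" "\<And>N. N \<lhd> X \<Longrightarrow> A \<subseteq> N \<Longrightarrow> D \<subseteq> N"
    and Y: "finite Y" "Y \<subseteq> carrier X" "carrier X \<subseteq> generate X Y"
    and R: "finite R" "R \<subseteq> kernel F G \<phi>" "\<And>N. N \<lhd> F \<Longrightarrow> R \<subseteq> N \<Longrightarrow> kernel F G \<phi> \<subseteq> N"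
    and \<sigma>: "\<And>f. f \<in> carrier F \<Longrightarrow> \<phi> f \<in> r ` D \<Longrightarrow> \<sigma> f \<in> D \<and> r (\<sigma> f) = \<phi> f"
    and \<sigma>_mult: "\<And>f f'. f \<in> carrier F \<Longrightarrow> f' \<in> carrier F \<Longrightarrow> \<phi> f \<in> r ` D \<Longrightarrow> \<phi> f' \<in> r ` D \<Longrightarrow>
      \<sigma> (f \<otimes>\<^bsub>F\<^esub> f') = \<sigma> f \<otimes> \<sigma> f'"
begin

text \<open>
  Since \<open>D\<close> commutes with the kernel of \<open>r\<close>, the map \<open>r\<close> makes \<open>D\<close> a crossed module over \<open>G\<close>.
  Its pullback \<open>M\<close> along the free cover \<open>\<phi>\<close> is finitely generated as a normal subgroup of \<open>H\<close>, and
  \<open>H\<close> acts on the abelianization of \<open>M\<close> by commuting endomorphisms.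
\<close>

definition H where "H = {h \<in> carrier X \<times> carrier F. r (fst h) = \<phi> (snd h)}"

definition M where "M = (X \<times>\<times> F)\<lparr>carrier := {m \<in> H. fst m \<in> D}\<rparr>"

definition C where "C = derived M (carrier M)"

definition conj where
  "conj h m = (fst h \<otimes> fst m \<otimes> inv fst h, snd h \<otimes>\<^bsub>F\<^esub> snd m \<otimes>\<^bsub>F\<^esub> inv\<^bsub>F\<^esub> snd h)"

lemma M_carrier: "m \<in> carrier M \<longleftrightarrow> fst m \<in> D \<and> snd m \<in> carrier F \<and> r (fst m) = \<phi> (snd m)"
  by (cases m) (auto simp: M_def H_def)

lemma H_iff: "h \<in> H \<longleftrightarrow> fst h \<in> carrier X \<and> snd h \<in> carrier F \<and> r (fst h) = \<phi> (snd h)"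
  by (cases h) (auto simp: H_def)

lemma M_mult: "m \<otimes>\<^bsub>M\<^esub> n = (fst m \<otimes> fst n, snd m \<otimes>\<^bsub>F\<^esub> snd n)"
  by (cases m; cases n) (simp add: M_def)

lemma M_one: "\<one>\<^bsub>M\<^esub> = (\<one>, \<one>\<^bsub>F\<^esub>)"
  by (simp add: M_def)

sublocale M: group M
proof (rule groupI)
  show "m \<otimes>\<^bsub>M\<^esub> n \<in> carrier M" if "m \<in> carrier M" "n \<in> carrier M" for m n
    using that by (auto simp: M_carrier M_mult)
  show "\<one>\<^bsub>M\<^esub> \<in> carrier M" by (simp add: M_carrier M_one)
  show "m \<otimes>\<^bsub>M\<^esub> n \<otimes>\<^bsub>M\<^esub> k = m \<otimes>\<^bsub>M\<^esub> (n \<otimes>\<^bsub>M\<^esub> k)"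
    if "m \<in> carrier M" "n \<in> carrier M" "k \<in> carrier M" for m n k
    using that by (auto simp: M_carrier M_mult X.m_assoc F.m_assoc)
  show "\<one>\<^bsub>M\<^esub> \<otimes>\<^bsub>M\<^esub> m = m" if "m \<in> carrier M" for m
    using that by (auto simp: M_carrier M_mult M_one)
  show "\<exists>n\<in>carrier M. n \<otimes>\<^bsub>M\<^esub> m = \<one>\<^bsub>M\<^esub>" if "m \<in> carrier M" for m
    using that by (intro bexI[of _ "(inv fst m, inv\<^bsub>F\<^esub> snd m)"]) (auto simp: M_carrier M_mult M_one)
qed

lemma M_inv: "m \<in> carrier M \<Longrightarrow> inv\<^bsub>M\<^esub> m = (inv fst m, inv\<^bsub>F\<^esub> snd m)"
  by (rule M.inv_equality) (auto simp: M_carrier M_mult M_one)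

sublocale C: normal C M
  unfolding C_def by (rule M.derived_is_normal[OF M.normal_self])

sublocale V: comm_group "M Mod C"
  unfolding C_def by (rule M.derived_quot_is_comm_group)

sublocale \<pi>: group_hom M "M Mod C" "\<lambda>m. C #>\<^bsub>M\<^esub> m"
  by unfold_locales (rule C.r_coset_hom_Mod)

lemma coset_eq_iff:
  assumes "m \<in> carrier M" "n \<in> carrier M"
  shows "C #>\<^bsub>M\<^esub> m = C #>\<^bsub>M\<^esub> n \<longleftrightarrow> m \<otimes>\<^bsub>M\<^esub> inv\<^bsub>M\<^esub> n \<in> C"
proof -
  have "C #>\<^bsub>M\<^esub> m = C #>\<^bsub>M\<^esub> n \<longleftrightarrow> C #>\<^bsub>M\<^esub> (m \<otimes>\<^bsub>M\<^esub> inv\<^bsub>M\<^esub> n) = \<one>\<^bsub>M Mod C\<^esub>"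
    using assms V.inv_solve_right'[of "\<one>\<^bsub>M Mod C\<^esub>" "C #>\<^bsub>M\<^esub> m" "C #>\<^bsub>M\<^esub> n"] \<pi>.hom_closed
    by (simp del: mult_FactGroup one_FactGroup)
  also have "\<dots> \<longleftrightarrow> m \<otimes>\<^bsub>M\<^esub> inv\<^bsub>M\<^esub> n \<in> C"
  proof -
    have "m \<otimes>\<^bsub>M\<^esub> inv\<^bsub>M\<^esub> n \<in> carrier M" using assms by simp
    then show ?thesis
      using M.coset_join1[OF _ _ C.subgroup_axioms] M.coset_join2[OF _ C.subgroup_axioms]
      unfolding one_FactGroup by blast
  qed
  finally show ?thesis .
qed

text \<open>
  The section splits the central extension \<open>M\<close>, so that a retraction of \<open>M\<close> onto the abelian
  group \<open>D \<inter> kernel X G r\<close> exists. Hence that group meets the derived subgroup of \<open>M\<close> trivially.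
\<close>

lemma derived_M_trivial:
  assumes "(w, \<one>\<^bsub>F\<^esub>) \<in> C"
  shows "w = \<one>"
proof -
  \<comment> \<open>The deviation of \<open>m\<close> from the section lies in the kernel of
    \<open>r\<close> and so commutes with \<open>D\<close>; this is what makes \<open>\<rho>\<close>
    multiplicative.\<close>
  define \<rho> where "\<rho> m = fst m \<otimes> inv \<sigma> (snd m)" for m
  have \<sigma>M: "\<sigma> (snd m) \<in> D" "r (\<sigma> (snd m)) = \<phi> (snd m)" "\<phi> (snd m) \<in> r ` D" if "m \<in> carrier M" for m
  proof -
    show "\<phi> (snd m) \<in> r ` D" using that by (metis M_carrier imageI)
    then show "\<sigma> (snd m) \<in> D" "r (\<sigma> (snd m)) = \<phi> (snd m)" using that \<sigma> by (auto simp: M_carrier)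
  qed
  have \<rho>W: "\<rho> m \<in> D" "\<rho> m \<in> kernel X G r" if "m \<in> carrier M" for m
    using that \<sigma>M[OF that] by (auto simp: \<rho>_def kernel_def M_carrier)
  have \<rho>_mult: "\<rho> (m \<otimes>\<^bsub>M\<^esub> n) = \<rho> m \<otimes> \<rho> n" if m: "m \<in> carrier M" and n: "n \<in> carrier M" for m n
  proof -
    have cl: "fst m \<in> carrier X" "\<sigma> (snd m) \<in> carrier X" "fst n \<in> carrier X" "\<sigma> (snd n) \<in> carrier X" "\<rho> n \<in> carrier X"
      using m n \<sigma>M(1) \<rho>W(1)[OF n] by (auto simp: M_carrier)
    have "\<rho> (m \<otimes>\<^bsub>M\<^esub> n) = fst m \<otimes> (\<rho> n \<otimes> inv \<sigma> (snd m))"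
      using m n cl \<sigma>M[OF m] \<sigma>M[OF n]
      by (simp add: \<rho>_def M_mult \<sigma>_mult M_carrier X.inv_mult_group X.m_assoc)
    also have "\<rho> n \<otimes> inv \<sigma> (snd m) = inv \<sigma> (snd m) \<otimes> \<rho> n"
      using D_commute[of "inv \<sigma> (snd m)" "\<rho> n"] \<sigma>M(1)[OF m] \<rho>W(2)[OF n] by simp
    finally show ?thesis using cl by (simp add: \<rho>_def X.m_assoc)
  qed
  have \<rho>: "\<rho> \<in> hom M X"
    by (rule homI) (use \<rho>_mult \<rho>W(1) in auto)
  interpret \<rho>: group_hom M X \<rho> by unfold_locales (rule \<rho>)
  have "C \<subseteq> kernel M X \<rho>"
    unfolding C_def derived_def
  proof (rule M.generate_subgroup_incl[OF _ \<rho>.subgroup_kernel])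
    show "derived_set M (carrier M) \<subseteq> kernel M X \<rho>"
    proof
      fix x assume "x \<in> derived_set M (carrier M)"
      then obtain m n where mn: "m \<in> carrier M" "n \<in> carrier M"
        "x = m \<otimes>\<^bsub>M\<^esub> n \<otimes>\<^bsub>M\<^esub> inv\<^bsub>M\<^esub> m \<otimes>\<^bsub>M\<^esub> inv\<^bsub>M\<^esub> n" by auto
      have "\<rho> m \<otimes> \<rho> n = \<rho> n \<otimes> \<rho> m"
        using D_commute \<rho>W mn by blast
      then have "\<rho> x = \<one>" using mn by (simp add: X.m_assoc X.inv_mult_cancel)
      with mn show "x \<in> kernel M X \<rho>" by (simp add: kernel_def)
    qed
  qed
  with assms have "\<rho> (w, \<one>\<^bsub>F\<^esub>) = \<one>" and w: "(w, \<one>\<^bsub>F\<^esub>) \<in> carrier M" by (auto simp: kernel_def)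
  moreover have "\<sigma> \<one>\<^bsub>F\<^esub> = \<one>"
  proof -
    have "\<rho> \<one>\<^bsub>M\<^esub> = \<one>" by (rule \<rho>.hom_one)
    moreover have "\<sigma> \<one>\<^bsub>F\<^esub> \<in> carrier X" using \<sigma>M(1)[OF M.one_closed] by (simp add: M_one)
    ultimately show ?thesis by (simp add: \<rho>_def M_one)
  qed
  ultimately show ?thesis by (auto simp: \<rho>_def M_carrier)
qed

section \<open>Action of the fibre product on the abelianized pullback\<close>

lemma conj_M: "h \<in> H \<Longrightarrow> m \<in> carrier M \<Longrightarrow> conj h m \<in> carrier M"
  by (auto simp: H_iff M_carrier conj_def D.inv_op_closed2)

lemma conj_mult_arg:
  "h \<in> H \<Longrightarrow> m \<in> carrier M \<Longrightarrow> n \<in> carrier M \<Longrightarrow> conj h (m \<otimes>\<^bsub>M\<^esub> n) = conj h m \<otimes>\<^bsub>M\<^esub> conj h n"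
  by (auto simp: H_iff M_carrier conj_def M_mult X.m_assoc F.m_assoc X.inv_mult_cancel F.inv_mult_cancel)

definition H_mult where "H_mult h k = (fst h \<otimes> fst k, snd h \<otimes>\<^bsub>F\<^esub> snd k)"
definition H_inv where "H_inv h = (inv fst h, inv\<^bsub>F\<^esub> snd h)"

lemma H_mult_closed: "h \<in> H \<Longrightarrow> k \<in> H \<Longrightarrow> H_mult h k \<in> H"
  and H_inv_closed: "h \<in> H \<Longrightarrow> H_inv h \<in> H"
  by (auto simp: H_iff H_mult_def H_inv_def)

lemma conj_H_mult: "h \<in> H \<Longrightarrow> k \<in> H \<Longrightarrow> m \<in> carrier M \<Longrightarrow> conj (H_mult h k) m = conj h (conj k m)"
  by (auto simp: H_iff H_mult_def M_carrier conj_def X.m_assoc F.m_assoc X.inv_mult_group F.inv_mult_group)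

lemma conj_H_inv:
  assumes "h \<in> H" "m \<in> carrier M"
  shows "conj (H_inv h) (conj h m) = m" "conj h (conj (H_inv h) m) = m"
  using assms by (auto simp: H_iff H_inv_def M_carrier conj_def X.m_assoc F.m_assoc X.inv_mult_cancel F.inv_mult_cancel)

lemma conj_hom: "h \<in> H \<Longrightarrow> conj h \<in> hom M M"
  by (rule homI) (auto simp: conj_M conj_mult_arg)

lemma conj_surj:
  assumes "h \<in> H"
  shows "conj h ` carrier M = carrier M"
proof
  show "conj h ` carrier M \<subseteq> carrier M" using assms by (auto simp: conj_M)
  show "carrier M \<subseteq> conj h ` carrier M"
  proof
    fix m assume "m \<in> carrier M"
    then have "m = conj h (conj (H_inv h) m)" "conj (H_inv h) m \<in> carrier M"
      using assms by (simp_all add: conj_H_inv conj_M H_inv_closed)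
    then show "m \<in> conj h ` carrier M" by (rule image_eqI)
  qed
qed

lemma conj_coset:
  "h \<in> H \<Longrightarrow> m \<in> carrier M \<Longrightarrow> conj h ` (C #>\<^bsub>M\<^esub> m) = C #>\<^bsub>M\<^esub> conj h m"
  unfolding C_def by (rule M.abelianization_endomorphism(1)[OF conj_hom conj_surj])

text \<open>\<open>fst h\<close> is \<open>d\<close> times an element of the kernel of
  \<open>r\<close>, which centralizes \<open>D\<close>. So \<open>h\<close> acts on \<open>M\<close>
  like the element \<open>(d, snd h)\<close> of \<open>M\<close>, and inner automorphisms are
  trivial on the abelianization.\<close>

lemma conj_coset_trivial:
  assumes h: "h \<in> H" and d: "d \<in> D" "r d = r (fst h)" and m: "m \<in> carrier M"
  shows "C #>\<^bsub>M\<^esub> conj h m = C #>\<^bsub>M\<^esub> m"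
proof -
  let ?l = "inv d \<otimes> fst h" and ?n = "(d, snd h)"
  have dX: "d \<in> carrier X" "fst m \<in> carrier X" using d m by (auto simp: M_carrier)
  have l: "?l \<in> kernel X G r" using h d dX by (auto simp: H_iff kernel_def)
  then have lX: "?l \<in> carrier X" by (simp add: kernel_def)
  have n: "?n \<in> carrier M" using h d by (auto simp: H_iff M_carrier)
  have "fst h = d \<otimes> ?l" using h dX by (simp add: H_iff X.inv_mult_cancel)
  then have "fst h \<otimes> fst m \<otimes> inv fst h
      = (d \<otimes> ?l) \<otimes> fst m \<otimes> inv (d \<otimes> ?l)" by simp
  also have "\<dots> = d \<otimes> (?l \<otimes> fst m \<otimes> inv ?l) \<otimes> inv d"
    using dX lX by (subst X.inv_mult_group) (auto simp only: X.m_assoc X.m_closed X.inv_closed)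
  also have "?l \<otimes> fst m = fst m \<otimes> ?l"
    using D_commute[of "fst m" ?l] m l by (simp add: M_carrier)
  also have "fst m \<otimes> ?l \<otimes> inv ?l = fst m"
    using dX lX by (simp only: X.m_assoc X.r_inv X.inv_closed X.r_one)
  finally have "conj h m = ?n \<otimes>\<^bsub>M\<^esub> m \<otimes>\<^bsub>M\<^esub> inv\<^bsub>M\<^esub> ?n"
    using n by (simp add: conj_def M_mult M_inv)
  then have "C #>\<^bsub>M\<^esub> conj h m = (C #>\<^bsub>M\<^esub> ?n) \<otimes>\<^bsub>M Mod C\<^esub> (C #>\<^bsub>M\<^esub> m) \<otimes>\<^bsub>M Mod C\<^esub> inv\<^bsub>M Mod C\<^esub> (C #>\<^bsub>M\<^esub> ?n)"
    using n m by (simp del: mult_FactGroup)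
  also have "\<dots> = C #>\<^bsub>M\<^esub> m"
    using \<pi>.hom_closed[OF n] \<pi>.hom_closed[OF m]
    by (simp only: V.m_comm[of "C #>\<^bsub>M\<^esub> ?n" "C #>\<^bsub>M\<^esub> m"] V.m_assoc V.r_inv V.inv_closed V.r_one)
  finally show ?thesis .
qed

text \<open>By \<open>commutator_mod\<close>, the commutator of \<open>h\<close> and
  \<open>k\<close> has the same image under \<open>r\<close> as an element of \<open>D\<close>,
  hence acts trivially.\<close>

lemma conj_coset_commute:
  assumes h: "h \<in> H" and k: "k \<in> H" and m: "m \<in> carrier M"
  shows "C #>\<^bsub>M\<^esub> conj h (conj k m) = C #>\<^bsub>M\<^esub> conj k (conj h m)"
proof -
  let ?c = "H_mult (H_mult h k) (H_mult (H_inv h) (H_inv k))"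
  have c: "?c \<in> H" by (intro H_mult_closed H_inv_closed h k)
  have "fst ?c = commutator X (fst h) (fst k)"
    using h k by (simp add: H_iff H_mult_def H_inv_def commutator_def X.m_assoc)
  then obtain d where d: "d \<in> D" "r d = r (fst ?c)"
    using commutator_mod[of "fst h" "fst k"] h k by (auto simp: H_iff)
  have "conj h (conj k m) = conj ?c (conj k (conj h m))"
    using h k m by (simp add: conj_H_mult conj_M H_mult_closed H_inv_closed conj_H_inv)
  then show ?thesis
    using conj_coset_trivial[OF c d, of "conj k (conj h m)"] h k m by (simp add: conj_M)
qed

lemma fibre_lift: "x \<in> carrier X \<Longrightarrow> \<exists>f\<in>carrier F. \<phi> f = r x"
  and fibre_lift': "f \<in> carrier F \<Longrightarrow> \<exists>x\<in>carrier X. r x = \<phi> f"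
  using r_surj \<phi>_surj r.hom_closed \<phi>.hom_closed by (metis imageE)+

text \<open>The normal subgroups in question are mapped to stable subgroups of
  \<open>M Mod C\<close>, and \<open>derived_M_trivial\<close> shows that no information is lost, so
  the chain condition can be pulled back. Most of the proof shows that the Noetherian submodule
  \<open>U\<close> is everything.\<close>

theorem acc_normal_subgroups: "acc_sets {N. N \<lhd> X \<and> N \<subseteq> D \<inter> kernel X G r}"
proof -
  obtain s where s: "\<And>x. x \<in> carrier X \<Longrightarrow> s x \<in> carrier F \<and> \<phi> (s x) = r x"
    using fibre_lift by metis
  have sH: "(x, s x) \<in> H" if "x \<in> carrier X" for x using s[OF that] that by (simp add: H_iff)
  \<comment> \<open>Inverses are included because stability under an operator does not give
    stability under its inverse.\<close>
  define gens where "gens = (\<lambda>y. (y, s y)) ` Y \<union> (\<lambda>y. H_inv (y, s y)) ` Y"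
  have gens_H: "gens \<subseteq> H" using sH Y(2) H_inv_closed by (auto simp: gens_def)
  define T where "T = (\<lambda>h. (`) (conj h)) ` gens"
  define B where "B = (\<lambda>m. C #>\<^bsub>M\<^esub> m) ` ((\<lambda>a. (a, s a)) ` A \<union> (\<lambda>\<rho>. (\<one>, \<rho>)) ` R)"
  have gens_M: "(\<lambda>a. (a, s a)) ` A \<union> (\<lambda>\<rho>. (\<one>, \<rho>)) ` R \<subseteq> carrier M"
    using A(2) R(2) s D.subset by (auto simp: M_carrier kernel_def)
  have carr: "carrier (M Mod C) = (\<lambda>m. C #>\<^bsub>M\<^esub> m) ` carrier M" by (rule carrier_FactGroup)
  obtain U where U: "subgroup U (M Mod C)" "B \<subseteq> U" "\<And>\<tau>. \<tau> \<in> T \<Longrightarrow> \<tau> ` U \<subseteq> U"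
    "acc_sets (stable_subgroups (M Mod C) T U)"
  proof (rule V.acc_commuting_endomorphisms[of T B])
    show "finite T" "finite B" using A(1) Y(1) R(1) by (auto simp: T_def B_def gens_def)
    show "B \<subseteq> carrier (M Mod C)" unfolding B_def carr using gens_M by blast
    show "T \<subseteq> hom (M Mod C) (M Mod C)"
      unfolding T_def C_def using M.abelianization_endomorphism(2)[OF conj_hom conj_surj] gens_H by blast
    show "\<tau> (\<tau>' v) = \<tau>' (\<tau> v)" if "\<tau> \<in> T" "\<tau>' \<in> T" "v \<in> carrier (M Mod C)" for \<tau> \<tau>' v
    proof -
      obtain h where h: "h \<in> H" "\<tau> = (`) (conj h)" using \<open>\<tau> \<in> T\<close> gens_H unfolding T_def by blast
      obtain k where k: "k \<in> H" "\<tau>' = (`) (conj k)" using \<open>\<tau>' \<in> T\<close> gens_H unfolding T_def by blast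
      obtain m where m: "m \<in> carrier M" "v = C #>\<^bsub>M\<^esub> m"
        using \<open>v \<in> carrier (M Mod C)\<close> unfolding carr by blast
      show ?thesis unfolding h(2) k(2) m(2) using m(1) h(1) k(1)
        by (simp only: conj_coset conj_M conj_coset_commute)
    qed
  qed (use that in blast)
  interpret U: subgroup U "M Mod C" by fact
  define stab where "stab h \<longleftrightarrow> (\<forall>m\<in>carrier M. C #>\<^bsub>M\<^esub> m \<in> U \<longrightarrow> C #>\<^bsub>M\<^esub> conj h m \<in> U)" for h
  have stab_mult: "stab (H_mult h k)" if "stab h" "stab k" "h \<in> H" "k \<in> H" for h k
    using that by (simp add: stab_def conj_H_mult conj_M)
  \<comment> \<open>Elements over \<open>\<one>\<close> act trivially. Hence only the component in
    \<open>X\<close> matters, and the finite set \<open>Y\<close> suffices whatever lifts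
    \<open>s\<close> has chosen.\<close>
  have stab_trivial: "stab (\<one>, f)" if "(\<one>, f) \<in> H" for f
    unfolding stab_def using conj_coset_trivial[OF that, of "\<one>"] by simp
  have stab_gen: "stab h" if "h \<in> gens" for h
  proof -
    have "conj h ` A \<in> U" if "A \<in> U" for A
      using U(3)[of "(`) (conj h)"] \<open>h \<in> gens\<close> that unfolding T_def by blast
    moreover have "conj h ` (C #>\<^bsub>M\<^esub> m) = C #>\<^bsub>M\<^esub> conj h m" if "m \<in> carrier M" for m
      using conj_coset[OF _ that] \<open>h \<in> gens\<close> gens_H by blast
    ultimately show ?thesis unfolding stab_def by metis
  qed
  have stab_ex: "\<exists>f. (x, f) \<in> H \<and> stab (x, f)" if "x \<in> generate X Y" for x
    using that
  proof (induction rule: generate.induct)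
    case one
    have "(\<one>, \<one>\<^bsub>F\<^esub>) \<in> H" by (simp add: H_iff)
    then show ?case using stab_trivial by blast
  next
    case (incl y)
    then have "(y, s y) \<in> gens" by (simp add: gens_def)
    then show ?case using stab_gen gens_H by blast
  next
    case (inv y)
    then have "H_inv (y, s y) \<in> gens" by (simp add: gens_def)
    then show ?case using stab_gen gens_H unfolding H_inv_def by auto
  next
    case (eng x y)
    then obtain f g where "(x, f) \<in> H" "stab (x, f)" "(y, g) \<in> H" "stab (y, g)" by blast
    with stab_mult[of "(x, f)" "(y, g)"] H_mult_closed[of "(x, f)" "(y, g)"] show ?case
      by (auto simp: H_mult_def)
  qed
  have stab: "stab h" if h: "h \<in> H" for h
  proof -
    obtain f where f: "(fst h, f) \<in> H" "stab (fst h, f)"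
      using stab_ex[of "fst h"] Y(3) h by (auto simp: H_iff)
    let ?k = "(\<one>, inv\<^bsub>F\<^esub> f \<otimes>\<^bsub>F\<^esub> snd h)"
    have k: "?k \<in> H" using f h by (auto simp: H_iff)
    have "H_mult (fst h, f) ?k = h"
      using f h by (auto simp: H_iff H_mult_def F.inv_mult_cancel prod_eq_iff)
    with stab_mult[OF f(2) stab_trivial[OF k] f(1) k] show ?thesis by simp
  qed
  define U' where "U' = {m \<in> carrier M. C #>\<^bsub>M\<^esub> m \<in> U}"
  have U'_sub: "subgroup U' M"
    unfolding U'_def
  proof (rule M.subgroupI)
    show "{m \<in> carrier M. C #>\<^bsub>M\<^esub> m \<in> U} \<noteq> {}"
      using U.one_closed \<pi>.hom_one M.one_closed by (metis (mono_tags, lifting) empty_iff mem_Collect_eq)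
    show "inv\<^bsub>M\<^esub> m \<in> {m \<in> carrier M. C #>\<^bsub>M\<^esub> m \<in> U}" if "m \<in> {m \<in> carrier M. C #>\<^bsub>M\<^esub> m \<in> U}" for m
      using that U.m_inv_closed[of "C #>\<^bsub>M\<^esub> m"] by simp
    show "m \<otimes>\<^bsub>M\<^esub> n \<in> {m \<in> carrier M. C #>\<^bsub>M\<^esub> m \<in> U}"
      if "m \<in> {m \<in> carrier M. C #>\<^bsub>M\<^esub> m \<in> U}" "n \<in> {m \<in> carrier M. C #>\<^bsub>M\<^esub> m \<in> U}" for m n
      using that U.m_closed[of "C #>\<^bsub>M\<^esub> m" "C #>\<^bsub>M\<^esub> n"] by (simp del: mult_FactGroup)
  qed auto
  interpret U': subgroup U' M by (rule U'_sub)
  have U'_conj: "conj h m \<in> U'" if "h \<in> H" "m \<in> U'" for h m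
  proof -
    have m: "m \<in> carrier M" "C #>\<^bsub>M\<^esub> m \<in> U" using that(2) unfolding U'_def by auto
    have "C #>\<^bsub>M\<^esub> conj h m \<in> U"
      using stab[OF that(1)] m unfolding stab_def by blast
    with conj_M[OF that(1) m(1)] show ?thesis unfolding U'_def by simp
  qed
  have gens_U': "(\<lambda>a. (a, s a)) ` A \<union> (\<lambda>\<rho>. (\<one>, \<rho>)) ` R \<subseteq> U'"
    using gens_M U(2) unfolding B_def U'_def by blast
  \<comment> \<open>The elements \<open>f\<close> with \<open>(\<one>, f)\<close> in
    \<open>U'\<close> form a normal subgroup of \<open>F\<close> containing the relators
    \<open>R\<close>.\<close>
  have kernel_U': "(\<one>, f) \<in> U'" if "f \<in> kernel F G \<phi>" for f
  proof -
    let ?N = "{f \<in> carrier F. (\<one>, f) \<in> U'}"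
    have "?N \<lhd> F"
    proof (rule F.normal_invI)
      show "subgroup ?N F"
      proof (rule F.subgroupI)
        show "?N \<noteq> {}" using U'.one_closed by (auto simp: M_one)
        show "inv\<^bsub>F\<^esub> f \<in> ?N" if "f \<in> ?N" for f
          using that U'.m_inv_closed[of "(\<one>, f)"] M_inv[of "(\<one>, f)"] by auto
        show "f \<otimes>\<^bsub>F\<^esub> g \<in> ?N" if "f \<in> ?N" "g \<in> ?N" for f g
          using that U'.m_closed[of "(\<one>, f)" "(\<one>, g)"] by (auto simp: M_mult)
      qed auto
      fix g f assume g: "g \<in> carrier F" and f: "f \<in> ?N"
      obtain x where x: "x \<in> carrier X" "r x = \<phi> g" using fibre_lift'[OF g] by blast
      then have "(x, g) \<in> H" using g by (simp add: H_iff)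
      from U'_conj[OF this, of "(\<one>, f)"] x f g
      show "g \<otimes>\<^bsub>F\<^esub> f \<otimes>\<^bsub>F\<^esub> inv\<^bsub>F\<^esub> g \<in> ?N" by (simp add: conj_def)
    qed
    moreover have "R \<subseteq> ?N" using gens_U' R(2) by (auto simp: kernel_def)
    ultimately have "kernel F G \<phi> \<subseteq> ?N" by (rule R(3))
    with that show ?thesis by blast
  qed
  have D_U': "\<exists>f. (d, f) \<in> U'" if "d \<in> D" for d
  proof -
    let ?N = "{d \<in> D. \<exists>f. (d, f) \<in> U'}"
    have "?N \<lhd> X"
    proof (rule X.normal_invI)
      show "subgroup ?N X"
      proof (rule X.subgroupI)
        show "?N \<subseteq> carrier X" using D.subset by blast
        show "?N \<noteq> {}" using U'.one_closed D.one_closed unfolding M_one by blast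
        show "inv d \<in> ?N" if d: "d \<in> ?N" for d
        proof -
          obtain f where f: "(d, f) \<in> U'" using d by blast
          have "inv\<^bsub>M\<^esub> (d, f) \<in> U'" using f by (rule U'.m_inv_closed)
          then show ?thesis using d f by (auto simp: M_inv)
        qed
        show "d \<otimes> e \<in> ?N" if de: "d \<in> ?N" "e \<in> ?N" for d e
        proof -
          obtain f g where fg: "(d, f) \<in> U'" "(e, g) \<in> U'" using de by blast
          have "(d, f) \<otimes>\<^bsub>M\<^esub> (e, g) \<in> U'" using fg by (rule U'.m_closed)
          then show ?thesis using de by (auto simp: M_mult)
        qed
      qed
      fix x d assume x: "x \<in> carrier X" and d: "d \<in> ?N"
      then obtain f where f: "(d, f) \<in> U'" by blast
      from U'_conj[OF sH[OF x] f] x d D.inv_op_closed2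
      show "x \<otimes> d \<otimes> inv x \<in> ?N" by (auto simp: conj_def)
    qed
    moreover have "A \<subseteq> ?N" using gens_U' A(2) by blast
    ultimately have "D \<subseteq> ?N" by (rule A(3))
    with that show ?thesis by blast
  qed
  have all_U: "C #>\<^bsub>M\<^esub> m \<in> U" if m: "m \<in> carrier M" for m
  proof -
    obtain f where f: "(fst m, f) \<in> U'" using D_U'[of "fst m"] m by (auto simp: M_carrier)
    let ?g = "inv\<^bsub>F\<^esub> f \<otimes>\<^bsub>F\<^esub> snd m"
    have fM: "(fst m, f) \<in> carrier M" using f by simp
    then have "?g \<in> kernel F G \<phi>" using m by (auto simp: M_carrier kernel_def)
    then have "(fst m, f) \<otimes>\<^bsub>M\<^esub> (\<one>, ?g) \<in> U'" using f kernel_U' by (intro U'.m_closed)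
    moreover have "(fst m, f) \<otimes>\<^bsub>M\<^esub> (\<one>, ?g) = m"
      using fM m by (auto simp: M_mult M_carrier F.inv_mult_cancel prod_eq_iff)
    ultimately have "m \<in> U'" by (simp only:)
    then show ?thesis unfolding U'_def by blast
  qed
  define img where "img N = (\<lambda>w. C #>\<^bsub>M\<^esub> (w, \<one>\<^bsub>F\<^esub>)) ` N" for N
  have WM: "(w, \<one>\<^bsub>F\<^esub>) \<in> carrier M" if "w \<in> D \<inter> kernel X G r" for w
    using that by (auto simp: M_carrier kernel_def)
  have img_stable: "img N \<in> stable_subgroups (M Mod C) T U" if N: "N \<lhd> X" "N \<subseteq> D \<inter> kernel X G r" for N
  proof -
    interpret N: normal N X by fact
    have NM: "(w, \<one>\<^bsub>F\<^esub>) \<in> carrier M" if "w \<in> N" for w using that N(2) WM by blast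
    have "subgroup (img N) (M Mod C)"
    proof (rule V.subgroupI)
      show "img N \<subseteq> carrier (M Mod C)" unfolding img_def carr using NM by blast
      show "img N \<noteq> {}" using N.one_closed unfolding img_def by blast
      show "inv\<^bsub>M Mod C\<^esub> v \<in> img N" if v: "v \<in> img N" for v
      proof -
        obtain w where w: "w \<in> N" "v = C #>\<^bsub>M\<^esub> (w, \<one>\<^bsub>F\<^esub>)" using v unfolding img_def by blast
        have "inv\<^bsub>M Mod C\<^esub> v = C #>\<^bsub>M\<^esub> (inv w, \<one>\<^bsub>F\<^esub>)"
          using NM[OF w(1)] w(2) \<pi>.hom_inv[OF NM[OF w(1)]] by (simp add: M_inv)
        then show ?thesis using w(1) unfolding img_def by blast
      qed
      show "v \<otimes>\<^bsub>M Mod C\<^esub> v' \<in> img N" if v: "v \<in> img N" and v': "v' \<in> img N" for v v'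
      proof -
        obtain w where w: "w \<in> N" "v = C #>\<^bsub>M\<^esub> (w, \<one>\<^bsub>F\<^esub>)" using v unfolding img_def by blast
        obtain w' where w': "w' \<in> N" "v' = C #>\<^bsub>M\<^esub> (w', \<one>\<^bsub>F\<^esub>)" using v' unfolding img_def by blast
        have "v \<otimes>\<^bsub>M Mod C\<^esub> v' = C #>\<^bsub>M\<^esub> (w \<otimes> w', \<one>\<^bsub>F\<^esub>)"
          using \<pi>.hom_mult[OF NM[OF w(1)] NM[OF w'(1)]] by (simp add: w(2) w'(2) M_mult del: mult_FactGroup)
        then show ?thesis using w(1) w'(1) unfolding img_def by blast
      qed
    qed
    moreover have "img N \<subseteq> U" unfolding img_def using NM all_U by blast
    moreover have "\<tau> ` img N \<subseteq> img N" if \<tau>: "\<tau> \<in> T" for \<tau>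
    proof -
      obtain h where h: "h \<in> H" "\<tau> = (`) (conj h)" using \<tau> gens_H unfolding T_def by blast
      have "\<tau> (C #>\<^bsub>M\<^esub> (w, \<one>\<^bsub>F\<^esub>)) \<in> img N" if w: "w \<in> N" for w
      proof -
        have "conj h (w, \<one>\<^bsub>F\<^esub>) = (fst h \<otimes> w \<otimes> inv fst h, \<one>\<^bsub>F\<^esub>)"
          using h(1) by (simp add: conj_def H_iff)
        moreover have "fst h \<otimes> w \<otimes> inv fst h \<in> N"
          using h(1) w by (simp add: H_iff N.inv_op_closed2)
        ultimately show ?thesis unfolding h(2) conj_coset[OF h(1) NM[OF w]] img_def by simp
      qed
      then show ?thesis unfolding img_def by blast
    qed
    ultimately show ?thesis by (simp add: stable_subgroups_def)
  qed
  show ?thesis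
    unfolding acc_sets_def
  proof (intro allI impI)
    fix f :: "nat \<Rightarrow> 'b set"
    assume f: "\<forall>n. f n \<in> {N. N \<lhd> X \<and> N \<subseteq> D \<inter> kernel X G r} \<and> f n \<subseteq> f (Suc n)"
    then have fN: "f n \<lhd> X" "f n \<subseteq> D \<inter> kernel X G r" and fS: "f n \<subseteq> f (Suc n)" for n by auto
    have fm: "f m \<subseteq> f n" if "m \<le> n" for m n using fS that by (rule lift_Suc_mono_le)
    obtain m where m: "\<And>n. m \<le> n \<Longrightarrow> img (f n) = img (f m)"
    proof (rule acc_setsD[OF U(4), of "\<lambda>n. img (f n)"])
      show "img (f n) \<subseteq> img (f (Suc n))" for n unfolding img_def using fS by blast
    qed (rule img_stable[OF fN], rule that)
    have "f n \<subseteq> f m" if n: "m \<le> n" for n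
    proof
      interpret fm: normal "f m" X by (rule fN)
      fix w assume w: "w \<in> f n"
      then have "C #>\<^bsub>M\<^esub> (w, \<one>\<^bsub>F\<^esub>) \<in> img (f m)" using m[OF n] unfolding img_def by blast
      then obtain w' where w': "w' \<in> f m" "C #>\<^bsub>M\<^esub> (w, \<one>\<^bsub>F\<^esub>) = C #>\<^bsub>M\<^esub> (w', \<one>\<^bsub>F\<^esub>)" unfolding img_def by blast
      have wM: "(w, \<one>\<^bsub>F\<^esub>) \<in> carrier M" "(w', \<one>\<^bsub>F\<^esub>) \<in> carrier M" using w w'(1) fN(2) WM by blast+
      have "(w \<otimes> inv w', \<one>\<^bsub>F\<^esub>) \<in> C"
        using coset_eq_iff[OF wM] w'(2) wM by (simp add: M_mult M_inv)
      then have "w \<otimes> inv w' = \<one>" by (rule derived_M_trivial)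
      then have "w = w'" using wM by (simp add: M_carrier X.inv_solve_right')
      then show "w \<in> f m" using w' by simp
    qed
    with fm show "\<exists>m. \<forall>n\<ge>m. f n = f m" by (intro exI[of _ m]) blast
  qed
qed

end

section \<open>Noetherian induction on decidability\<close>

lemma acc_sets_maximal:
  assumes acc: "acc_sets F" and sub: "F' \<subseteq> F" and ne: "F' \<noteq> {}"
  obtains M where "M \<in> F'" "\<And>K. K \<in> F' \<Longrightarrow> M \<subseteq> K \<Longrightarrow> K = M"
proof (rule ccontr)
  assume "\<not> thesis"
  with that have no_max: "\<exists>K\<in>F'. M \<subset> K" if "M \<in> F'" for M using that by blast
  obtain M0 where "M0 \<in> F'" using ne by blast
  then have "\<exists>f. \<forall>n. f n \<in> F' \<and> f n \<subset> f (Suc n)"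
    using no_max by (intro dependent_nat_choice) auto
  then obtain f where f: "\<And>n. f n \<in> F'" "\<And>n. f n \<subset> f (Suc n)" by blast
  then obtain m where "\<And>n. m \<le> n \<Longrightarrow> f n = f m"
    using acc_setsD[OF acc, of f] sub by (metis psubset_imp_subset subsetD)
  from this[of "Suc m"] f(2)[of m] show False by simp
qed

lemma acc_sets_induct:
  assumes acc: "acc_sets F" and N: "N \<in> F"
    and step: "\<And>N. N \<in> F \<Longrightarrow> (\<And>K. K \<in> F \<Longrightarrow> N \<subset> K \<Longrightarrow> P K) \<Longrightarrow> P N"
  shows "P N"
proof (rule ccontr)
  assume "\<not> P N"
  with N have "{N \<in> F. \<not> P N} \<noteq> {}" by blast
  then obtain M where "M \<in> {N \<in> F. \<not> P N}" "\<And>K. K \<in> {N \<in> F. \<not> P N} \<Longrightarrow> M \<subseteq> K \<Longrightarrow> K = M"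
    using acc_sets_maximal[OF acc, of "{N \<in> F. \<not> P N}"] by blast
  with step[of M] show False by blast
qed

text \<open>
  The operators induced on a normal abelian subgroup by the integral group ring.
\<close>

inductive_set group_ring_ops :: "('b, 'd) monoid_scheme \<Rightarrow> ('b \<Rightarrow> 'b) set"
  for X :: "('b, 'd) monoid_scheme" where
  conj: "x \<in> carrier X \<Longrightarrow> (\<lambda>v. x \<otimes>\<^bsub>X\<^esub> v \<otimes>\<^bsub>X\<^esub> inv\<^bsub>X\<^esub> x) \<in> group_ring_ops X"
| add: "f \<in> group_ring_ops X \<Longrightarrow> g \<in> group_ring_ops X \<Longrightarrow> (\<lambda>v. f v \<otimes>\<^bsub>X\<^esub> g v) \<in> group_ring_ops X"
| neg: "f \<in> group_ring_ops X \<Longrightarrow> (\<lambda>v. inv\<^bsub>X\<^esub> f v) \<in> group_ring_ops X"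
| comp: "f \<in> group_ring_ops X \<Longrightarrow> g \<in> group_ring_ops X \<Longrightarrow> (\<lambda>v. f (g v)) \<in> group_ring_ops X"

locale noetherian_normal_subgroup = X: group X + W: normal W X
  for X :: "('b, 'd) monoid_scheme" (structure) and W :: "'b set" +
  fixes xg :: "nat \<Rightarrow> 'b"
  assumes W_comm: "\<And>u v. u \<in> W \<Longrightarrow> v \<in> W \<Longrightarrow> u \<otimes> v = v \<otimes> u"
    and conj_comm: "\<And>x y w. x \<in> carrier X \<Longrightarrow> y \<in> carrier X \<Longrightarrow> w \<in> W \<Longrightarrow>
      x \<otimes> (y \<otimes> w \<otimes> inv y) \<otimes> inv x = y \<otimes> (x \<otimes> w \<otimes> inv x) \<otimes> inv y"
    and acc: "acc_sets {N. N \<lhd> X \<and> N \<subseteq> W}"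
    and xg: "range xg \<subseteq> carrier X" "carrier X \<subseteq> range (word_val X xg)"
    and semidecidable_closure:
      "semidecidable (\<lambda>q. word_val X xg (snd q) \<in> normal_closure X (word_val X xg ` set (fst q)))"
    and decidable_W: "computable (\<lambda>w. word_val X xg w \<in> W)"
begin

abbreviation val where "val \<equiv> word_val X xg"
abbreviation Ops where "Ops \<equiv> group_ring_ops X"

lemma val_closed [simp]: "val w \<in> carrier X"
  by (rule X.word_val_closed[OF xg(1)])

lemma val_append: "val (u @ v) = val u \<otimes> val v"
  by (rule X.word_val_append[OF xg(1)])

lemma val_inv: "val (word_inv w) = inv val w"
  by (rule X.word_val_word_inv[OF xg(1)])

lemma val_surj: "x \<in> carrier X \<Longrightarrow> \<exists>w. val w = x"
  using xg(2) by (metis imageE subsetD)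

section \<open>Operators of the group ring on the abelian normal subgroup\<close>

lemma Ops_normal: "f \<in> Ops \<Longrightarrow> N \<lhd> X \<Longrightarrow> v \<in> N \<Longrightarrow> f v \<in> N"
proof (induction arbitrary: v rule: group_ring_ops.induct)
  case (conj x)
  then show ?case using normal.inv_op_closed2 by metis
next
  case (add f g)
  then show ?case using subgroup.m_closed[OF normal_imp_subgroup] by metis
next
  case (neg f)
  then show ?case using subgroup.m_inv_closed[OF normal_imp_subgroup] by metis
qed auto

lemma Ops_closed: "f \<in> Ops \<Longrightarrow> v \<in> W \<Longrightarrow> f v \<in> W"
  using Ops_normal W.normal_axioms by blast

lemma Ops_mult:
  "f \<in> Ops \<Longrightarrow> u \<in> W \<Longrightarrow> v \<in> W \<Longrightarrow> f (u \<otimes> v) = f u \<otimes> f v"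
proof (induction arbitrary: u v rule: group_ring_ops.induct)
  case (conj x)
  then have "u \<in> carrier X" "v \<in> carrier X" by auto
  with conj(1) show ?case by (simp add: X.m_assoc X.inv_mult_cancel)
next
  case (add f g)
  then have W: "f u \<in> W" "f v \<in> W" "g u \<in> W" "g v \<in> W" by (auto intro: Ops_closed)
  then have X: "f u \<in> carrier X" "f v \<in> carrier X" "g u \<in> carrier X" "g v \<in> carrier X" by auto
  have "f v \<otimes> (g u \<otimes> g v) = g u \<otimes> (f v \<otimes> g v)"
    using W_comm[OF W(2,3)] X by (simp flip: X.m_assoc)
  with add X show ?case by (simp add: X.m_assoc)
next
  case (neg f)
  then have "f u \<in> W" "f v \<in> W" by (auto intro: Ops_closed)
  with neg show ?case using W_comm[of "f u" "f v"] by (simp add: X.inv_mult_group)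
next
  case (comp f g)
  then show ?case by (simp add: Ops_closed)
qed

lemma Ops_inv:
  assumes "f \<in> Ops" "v \<in> W"
  shows "f (inv v) = inv f v"
proof -
  have "f v \<in> carrier X" "f (inv v) \<in> carrier X" "f \<one> \<in> carrier X"
    using assms Ops_closed W.subset W.one_closed by (blast, metis W.m_inv_closed W.mem_carrier Ops_closed, metis W.mem_carrier Ops_closed)
  moreover have "f \<one> = f \<one> \<otimes> f \<one>"
    using Ops_mult[OF assms(1) W.one_closed W.one_closed] by simp
  moreover have "f (inv v) \<otimes> f v = f \<one>"
    using Ops_mult[OF assms(1), of "inv v" v] assms(2) by simp
  ultimately show ?thesis by (metis X.inv_equality X.l_cancel_one)
qed

text \<open>Operators are equivariant because the conjugations commute on \<open>W\<close>; this
  makes their images and kernels normal in \<open>X\<close>.\<close>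

lemma Ops_conj:
  "g \<in> Ops \<Longrightarrow> x \<in> carrier X \<Longrightarrow> v \<in> W \<Longrightarrow>
    g (x \<otimes> v \<otimes> inv x) = x \<otimes> g v \<otimes> inv x"
proof (induction arbitrary: v rule: group_ring_ops.induct)
  case (conj y)
  then show ?case using conj_comm by simp
next
  case (add f g)
  then have "f v \<in> carrier X" "g v \<in> carrier X" using Ops_closed W.subset by blast+
  with add show ?case by (simp add: X.m_assoc X.inv_mult_cancel)
next
  case (neg f)
  then have "f v \<in> carrier X" using Ops_closed W.subset by blast
  with neg show ?case by (simp add: X.m_assoc X.inv_mult_group)
next
  case (comp f g)
  then show ?case by (simp add: Ops_closed)
qed

lemma Ops_computable:
  assumes "f \<in> Ops"
  obtains \<phi> where "computable \<phi>" "\<And>w. val (\<phi> w) = f (val w)"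
proof -
  have "\<exists>\<phi>. computable \<phi> \<and> (\<forall>w. val (\<phi> w) = f (val w))"
    using assms
  proof (induction rule: group_ring_ops.induct)
    case (conj x)
    then obtain u where "val u = x" using val_surj by blast
    then have "computable (\<lambda>w. u @ w @ word_inv u)" "\<And>w. val (u @ w @ word_inv u) = x \<otimes> val w \<otimes> inv x"
      by (intro computable_intros, auto simp: val_append val_inv X.m_assoc)
    then show ?case by blast
  next
    case (add f g)
    then obtain \<phi> \<psi> where *: "computable \<phi>" "\<And>w. val (\<phi> w) = f (val w)" "computable \<psi>" "\<And>w. val (\<psi> w) = g (val w)"
      by blast
    then have "computable (\<lambda>w. \<phi> w @ \<psi> w)" "\<And>w. val (\<phi> w @ \<psi> w) = f (val w) \<otimes> g (val w)"
      by (intro computable_intros, auto simp: val_append)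
    then show ?case by blast
  next
    case (neg f)
    then obtain \<phi> where *: "computable \<phi>" "\<And>w. val (\<phi> w) = f (val w)" by blast
    then have "computable (\<lambda>w. word_inv (\<phi> w))" "\<And>w. val (word_inv (\<phi> w)) = inv f (val w)"
      by (intro computable_intros, auto simp: val_inv)
    then show ?case by blast
  next
    case (comp f g)
    then obtain \<phi> \<psi> where *: "computable \<phi>" "\<And>w. val (\<phi> w) = f (val w)" "computable \<psi>" "\<And>w. val (\<psi> w) = g (val w)"
      by blast
    then have "computable (\<lambda>w. \<phi> (\<psi> w))" "\<And>w. val (\<phi> (\<psi> w)) = f (g (val w))"
      by (auto intro: computable_comp)
    then show ?case by blast
  qed
  with that show thesis by blast
qed

lemma Ops_id: "\<exists>f\<in>Ops. \<forall>v\<in>carrier X. f v = v"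
  by (rule bexI[OF _ group_ring_ops.conj[OF X.one_closed]]) simp

text \<open>Written additively with \<open>R\<close> for the ring of operators, these are the
  submodules \<open>N + R v\<close>, \<open>N + f W\<close> and the preimage of \<open>N\<close>
  under \<open>f\<close>. All of them contain \<open>N\<close>, and where they are strictly larger
  the induction hypothesis makes them decidable.\<close>

definition orbit where "orbit N v = {f v \<otimes> n | f n. f \<in> Ops \<and> n \<in> N}"
definition image_of where "image_of N f = {f v \<otimes> n | v n. v \<in> W \<and> n \<in> N}"
definition kernel_of where "kernel_of N f = {v \<in> W. f v \<in> N}"

lemma mult_normal_normal:
  assumes N: "N \<lhd> X" "N \<subseteq> W" and S: "S \<subseteq> W" "\<one> \<in> S"
    and S_inv: "\<And>s. s \<in> S \<Longrightarrow> inv s \<in> S" and S_mult: "\<And>s t. s \<in> S \<Longrightarrow> t \<in> S \<Longrightarrow> s \<otimes> t \<in> S"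
    and S_conj: "\<And>x s. x \<in> carrier X \<Longrightarrow> s \<in> S \<Longrightarrow> x \<otimes> s \<otimes> inv x \<in> S"
  shows "{s \<otimes> n | s n. s \<in> S \<and> n \<in> N} \<lhd> X" "{s \<otimes> n | s n. s \<in> S \<and> n \<in> N} \<subseteq> W"
    "N \<subseteq> {s \<otimes> n | s n. s \<in> S \<and> n \<in> N}"
proof -
  interpret N: normal N X by fact
  have SX: "s \<in> carrier X" if "s \<in> S" for s using that S(1) by auto
  show "{s \<otimes> n | s n. s \<in> S \<and> n \<in> N} \<subseteq> W" using N(2) S(1) by auto
  show "N \<subseteq> {s \<otimes> n | s n. s \<in> S \<and> n \<in> N}"
  proof
    fix n assume n: "n \<in> N"
    then have "n = \<one> \<otimes> n" by simp
    with n S(2) show "n \<in> {s \<otimes> n | s n. s \<in> S \<and> n \<in> N}" by blast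
  qed
  show "{s \<otimes> n | s n. s \<in> S \<and> n \<in> N} \<lhd> X" (is "?M \<lhd> X")
  proof (rule X.normal_invI)
    show "subgroup ?M X"
    proof (rule X.subgroupI)
      show "?M \<subseteq> carrier X" using SX by auto
      show "?M \<noteq> {}" using S(2) N.one_closed by blast
      fix a b assume "a \<in> ?M" "b \<in> ?M"
      then obtain s n t m where a: "a = s \<otimes> n" "s \<in> S" "n \<in> N" and b: "b = t \<otimes> m" "t \<in> S" "m \<in> N" by blast
      have W: "s \<in> W" "t \<in> W" "n \<in> W" "m \<in> W" using a b S(1) N(2) by auto
      have "inv a = inv s \<otimes> inv n"
        using a(1) W W_comm[OF W(1,3)] by (simp add: X.inv_mult_group)
      then show "inv a \<in> ?M" using a S_inv by blast
      have "n \<otimes> (t \<otimes> m) = t \<otimes> (n \<otimes> m)"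
        using W W_comm[OF W(3,2)] by (simp flip: X.m_assoc)
      then have "a \<otimes> b = (s \<otimes> t) \<otimes> (n \<otimes> m)"
        using a b W by (simp add: X.m_assoc)
      then show "a \<otimes> b \<in> ?M" using a b S_mult by blast
    qed
    fix x a assume x: "x \<in> carrier X" and "a \<in> ?M"
    then obtain s n where a: "a = s \<otimes> n" "s \<in> S" "n \<in> N" by blast
    have "x \<otimes> a \<otimes> inv x = (x \<otimes> s \<otimes> inv x) \<otimes> (x \<otimes> n \<otimes> inv x)"
      using a SX x by (simp add: X.m_assoc X.inv_mult_cancel)
    then show "x \<otimes> a \<otimes> inv x \<in> ?M" using a S_conj[OF x] N.inv_op_closed2[OF x] by blast
  qed
qed

lemma image_of:
  assumes N: "N \<lhd> X" "N \<subseteq> W" and f: "f \<in> Ops"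
  shows "image_of N f \<lhd> X" "image_of N f \<subseteq> W" "N \<subseteq> image_of N f"
proof -
  have eq: "image_of N f = {s \<otimes> n | s n. s \<in> f ` W \<and> n \<in> N}" by (auto simp: image_of_def)
  have one: "\<one> \<in> f ` W"
    using Ops_mult[OF f W.one_closed W.one_closed] Ops_closed[OF f W.one_closed] W.one_closed
    by (metis X.l_cancel_one' W.mem_carrier X.one_closed X.r_one rev_image_eqI)
  show "image_of N f \<lhd> X" "image_of N f \<subseteq> W" "N \<subseteq> image_of N f"
    unfolding eq
    by (rule mult_normal_normal[OF N _ one];
        use f Ops_closed Ops_mult Ops_inv Ops_conj W.inv_op_closed2 in \<open>auto simp flip: Ops_mult Ops_inv Ops_conj\<close>)+
qed

lemma kernel_of:
  assumes N: "N \<lhd> X" "N \<subseteq> W" and f: "f \<in> Ops"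
  shows "kernel_of N f \<lhd> X" "kernel_of N f \<subseteq> W" "N \<subseteq> kernel_of N f"
proof -
  interpret N: normal N X by fact
  show "kernel_of N f \<subseteq> W" by (auto simp: kernel_of_def)
  show "N \<subseteq> kernel_of N f" using N f by (auto simp: kernel_of_def Ops_normal)
  show "kernel_of N f \<lhd> X"
  proof (rule X.normal_invI)
    have "\<one> \<in> kernel_of N f" using \<open>N \<subseteq> kernel_of N f\<close> by auto
    then show "subgroup (kernel_of N f) X"
      by (intro X.subgroupI; (blast | use f in \<open>auto simp: kernel_of_def Ops_mult Ops_inv\<close>))
    show "x \<otimes> v \<otimes> inv x \<in> kernel_of N f" if "x \<in> carrier X" "v \<in> kernel_of N f" for x v
      using that f W.inv_op_closed2 N.inv_op_closed2 by (auto simp: kernel_of_def Ops_conj)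
  qed
qed

lemma orbit:
  assumes N: "N \<lhd> X" "N \<subseteq> W" and v: "v \<in> W"
  shows "orbit N v \<lhd> X" "orbit N v \<subseteq> W" "N \<subseteq> orbit N v" "v \<in> orbit N v"
proof -
  interpret N: normal N X by fact
  have eq: "orbit N v = {s \<otimes> n | s n. s \<in> (\<lambda>f. f v) ` Ops \<and> n \<in> N}" by (auto simp: orbit_def)
  obtain e where e: "e \<in> Ops" "e v = v" using Ops_id v by auto
  have one: "\<one> \<in> (\<lambda>f. f v) ` Ops"
    using group_ring_ops.add[OF e(1) group_ring_ops.neg[OF e(1)]] e(2) v by (auto intro: rev_image_eqI)
  show "orbit N v \<lhd> X" "orbit N v \<subseteq> W" "N \<subseteq> orbit N v"
    unfolding eq
    by (rule mult_normal_normal[OF N _ one];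
        auto intro: rev_image_eqI[OF group_ring_ops.add] rev_image_eqI[OF group_ring_ops.neg]
          rev_image_eqI[OF group_ring_ops.comp[OF group_ring_ops.conj]] Ops_closed[OF _ v])+
  have "e v \<otimes> \<one> \<in> orbit N v" using e(1) N.one_closed unfolding orbit_def by blast
  then show "v \<in> orbit N v" using e v by simp
qed

text \<open>Among the normal closures of finitely many elements of \<open>N\<close> the chain
  condition provides a maximal one; adjoining any further element of \<open>N\<close> cannot enlarge
  it.\<close>

lemma finitely_generated:
  assumes N: "N \<lhd> X" "N \<subseteq> W"
  obtains ps where "N = normal_closure X (val ` set ps)"
proof -
  let ?F = "{normal_closure X (val ` set ps) | ps. val ` set ps \<subseteq> N}"
  have normal: "normal_closure X (val ` set ps) \<lhd> X" for ps
    by (rule X.normal_closure_normal) auto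
  have sub: "?F \<subseteq> {N. N \<lhd> X \<and> N \<subseteq> W}"
    using normal X.normal_closure_minimal[OF N(1)] N(2) by blast
  have ne: "?F \<noteq> {}" by (auto intro: exI[of _ "[]"])
  obtain M where M: "M \<in> ?F" "\<And>K. K \<in> ?F \<Longrightarrow> M \<subseteq> K \<Longrightarrow> K = M"
  proof (rule acc_sets_maximal[OF acc sub ne])
    fix M assume "M \<in> ?F" "\<And>K. K \<in> ?F \<Longrightarrow> M \<subseteq> K \<Longrightarrow> K = M"
    then show thesis by (rule that)
  qed
  then obtain ps where ps: "M = normal_closure X (val ` set ps)" "val ` set ps \<subseteq> N" by blast
  have "N \<subseteq> M"
  proof
    fix x assume x: "x \<in> N"
    then obtain w where w: "val w = x" using val_surj subgroup.mem_carrier[OF normal_imp_subgroup[OF N(1)]] by blast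
    let ?K = "normal_closure X (val ` set (w # ps))"
    have "val ` set (w # ps) \<subseteq> N" using ps(2) x w by auto
    then have "?K \<in> ?F" by blast
    moreover have "M \<subseteq> ?K"
      unfolding ps(1) using X.normal_closure_superset[of "val ` set (w # ps)"]
      by (intro X.normal_closure_minimal[OF normal]) auto
    ultimately have "?K = M" by (rule M(2))
    moreover have "x \<in> ?K" using w X.normal_closure_superset[of "val ` set (w # ps)"] by auto
    ultimately show "x \<in> M" by simp
  qed
  moreover have "M \<subseteq> N" unfolding ps(1) by (rule X.normal_closure_minimal[OF N(1) ps(2)])
  ultimately show thesis using that ps(1) by blast
qed

lemma semidecidable_mem:
  assumes "N \<lhd> X" "N \<subseteq> W"
  shows "semidecidable (\<lambda>w. val w \<in> N)"
proof -
  obtain ps where ps: "N = normal_closure X (val ` set ps)" using finitely_generated[OF assms] .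
  have "semidecidable (\<lambda>w. val (snd (ps, w)) \<in> normal_closure X (val ` set (fst (ps, w))))"
    by (rule semidecidable_comp[OF semidecidable_closure]) (intro computable_intros)
  then show ?thesis by (simp add: ps)
qed

text \<open>Both sides say that \<open>f\<close> induces zero on \<open>W/N\<close>.\<close>

lemma image_of_kernel_of:
  assumes N: "N \<lhd> X" "N \<subseteq> W" and f: "f \<in> Ops"
  shows "image_of N f = N \<longleftrightarrow> kernel_of N f = W"
proof -
  interpret N: normal N X by fact
  have W: "f v \<in> carrier X" if "v \<in> W" for v using Ops_closed[OF f that] by simp
  show ?thesis
  proof
    assume im: "image_of N f = N"
    have "f v \<in> N" if v: "v \<in> W" for v
    proof -
      have "f v \<otimes> \<one> \<in> image_of N f" unfolding image_of_def using v N.one_closed by blast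
      then show ?thesis using W[OF v] by (simp add: im)
    qed
    then show "kernel_of N f = W" by (auto simp: kernel_of_def)
  next
    assume ker: "kernel_of N f = W"
    have "f v \<otimes> n \<in> N" if "v \<in> W" "n \<in> N" for v n
      using that ker by (auto simp: kernel_of_def)
    then have "image_of N f \<subseteq> N" unfolding image_of_def by blast
    then show "image_of N f = N" using image_of(3)[OF N f] by (rule equalityI)
  qed
qed

lemma mem_mult_cancel:
  assumes "N \<lhd> X" "u \<in> carrier X" "v \<in> carrier X" "inv u \<otimes> v \<in> N"
  shows "u \<in> N \<longleftrightarrow> v \<in> N"
proof -
  interpret N: normal N X by fact
  have v: "v = u \<otimes> (inv u \<otimes> v)" and u: "u = v \<otimes> inv (inv u \<otimes> v)"
    using assms by (simp_all add: X.inv_mult_cancel X.inv_mult_group)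
  show ?thesis using u v assms(4) N.m_closed N.m_inv_closed by metis
qed

lemma image_ofE:
  assumes "N \<lhd> X" "f \<in> Ops" "x \<in> image_of N f"
  obtains v where "v \<in> W" "inv f v \<otimes> x \<in> N"
proof -
  interpret N: normal N X by fact
  obtain v n where vn: "x = f v \<otimes> n" "v \<in> W" "n \<in> N" using assms(3) unfolding image_of_def by blast
  have "f v \<in> carrier X" using Ops_closed[OF assms(2) vn(2)] by simp
  then have "inv f v \<otimes> x = n" using vn by (simp add: X.inv_mult_cancel)
  with vn that show thesis by simp
qed

text \<open>
  If \<open>f\<close> is neither zero nor injective on \<open>W/N\<close>, then an element of the image of \<open>f\<close> vanishes iff a
  preimage of it lies in the kernel.
\<close>

lemma semidecidable_not_mem_zero_divisor:
  assumes N: "N \<lhd> X" "N \<subseteq> W" and f: "f \<in> Ops"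
    and im: "computable (\<lambda>w. val w \<in> image_of N f)" and ker: "computable (\<lambda>w. val w \<in> kernel_of N f)"
  shows "semidecidable (\<lambda>w. val w \<notin> N)"
proof -
  obtain \<phi> where \<phi>: "computable \<phi>" "\<And>w. val (\<phi> w) = f (val w)" using Ops_computable[OF f] by blast
  \<comment> \<open>Either \<open>w\<close> lies outside the larger submodule
    \<open>image_of N f\<close>, or a search finds \<open>v\<close> with \<open>f v\<close>
    congruent to \<open>w\<close>, and the decidable \<open>kernel_of N f\<close> is asked about
    \<open>v\<close>.\<close>
  have iff: "val w \<notin> N \<longleftrightarrow> val w \<notin> image_of N f \<or>
      (\<exists>v. (val v \<in> W \<and> val v \<notin> kernel_of N f) \<and> val (word_inv (\<phi> v) @ w) \<in> N)" for w
  proof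
    assume w: "val w \<notin> N"
    show "val w \<notin> image_of N f \<or>
      (\<exists>v. (val v \<in> W \<and> val v \<notin> kernel_of N f) \<and> val (word_inv (\<phi> v) @ w) \<in> N)"
    proof (cases "val w \<in> image_of N f")
      case True
      then obtain x where x: "x \<in> W" "inv f x \<otimes> val w \<in> N" using image_ofE[OF N(1) f] by blast
      obtain v where v: "val v = x" using val_surj[OF W.mem_carrier[OF x(1)]] by blast
      have "f x \<in> carrier X" using Ops_closed[OF f x(1)] by simp
      then have "f x \<notin> N" using mem_mult_cancel[OF N(1) _ _ x(2)] w by simp
      then have "x \<notin> kernel_of N f" by (simp add: kernel_of_def)
      with x v show ?thesis by (auto simp: val_append val_inv \<phi>(2))
    qed simp
  next
    assume "val w \<notin> image_of N f \<or>
      (\<exists>v. (val v \<in> W \<and> val v \<notin> kernel_of N f) \<and> val (word_inv (\<phi> v) @ w) \<in> N)"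
    then show "val w \<notin> N"
    proof
      assume "val w \<notin> image_of N f"
      then show ?thesis using image_of(3)[OF N f] by blast
    next
      assume "\<exists>v. (val v \<in> W \<and> val v \<notin> kernel_of N f) \<and> val (word_inv (\<phi> v) @ w) \<in> N"
      then obtain v where v: "val v \<in> W" "val v \<notin> kernel_of N f" "inv f (val v) \<otimes> val w \<in> N"
        by (auto simp: val_append val_inv \<phi>(2))
      have "f (val v) \<in> carrier X" using Ops_closed[OF f v(1)] by simp
      with v show ?thesis using mem_mult_cancel[OF N(1) _ _ v(3)] by (simp add: kernel_of_def)
    qed
  qed
  show ?thesis
    unfolding iff
    by (intro semidecidable_disj semidecidable_ex semidecidable_conj)
      (intro semidecidable_computable computable_intros im computable_comp[OF decidable_W] computable_comp[OF ker]
        semidecidable_comp[OF semidecidable_mem[OF N]] computable_comp[OF \<phi>(1)])+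
qed

text \<open>
  If \<open>f\<close> is injective but not invertible on \<open>W/N\<close>, then the chain condition allows a nonzero element
  to be divided by \<open>f\<close> only finitely often.
\<close>

lemma semidecidable_not_mem_nonunit:
  assumes N: "N \<lhd> X" "N \<subseteq> W" and f: "f \<in> Ops"
    and dichotomy: "\<And>g. g \<in> Ops \<Longrightarrow> image_of N g = N \<or> kernel_of N g = N"
    and inj: "kernel_of N f = N"
    and nonunit: "\<And>s. s \<in> Ops \<Longrightarrow> \<exists>v\<in>W. inv v \<otimes> s (f v) \<notin> N"
    and im: "computable (\<lambda>w. val w \<in> image_of N f)"
  shows "semidecidable (\<lambda>w. val w \<notin> N)"
proof -
  interpret N: normal N X by fact
  obtain \<phi> where \<phi>: "computable \<phi>" "\<And>w. val (\<phi> w) = f (val w)" using Ops_computable[OF f] by blast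
  have \<phi>n: "val ((\<phi> ^^ n) v) = (f ^^ n) (val v)" for n v
    by (induction n) (simp_all add: \<phi>(2))
  have fn_closed: "(f ^^ n) v \<in> W" if "v \<in> W" for n v
    using that by (induction n) (auto intro: Ops_closed[OF f])
  have fn_mem: "v \<in> N" if "(f ^^ n) v \<in> N" "v \<in> W" for n v
    using that
  proof (induction n)
    case (Suc n)
    then have "(f ^^ n) v \<in> kernel_of N f" using fn_closed by (simp add: kernel_of_def)
    with Suc inj show ?case by simp
  qed simp
  have fn_N: "(f ^^ n) v \<in> N" if "v \<in> N" for n v
    using that by (induction n) (auto intro: Ops_normal[OF f N(1)])
  \<comment> \<open>Otherwise division by \<open>f\<close> could be repeated forever, giving
    \<open>v n\<close> congruent to \<open>f (v (Suc n))\<close> for all \<open>n\<close> and thus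
    an ascending chain of submodules \<open>orbit N (v n)\<close>.\<close>
  have ex: "\<exists>n v. (v \<in> W \<and> v \<notin> image_of N f) \<and> inv (f ^^ n) v \<otimes> w \<in> N" if w: "w \<in> W" "w \<notin> N" for w
  proof (rule ccontr)
    assume contra: "\<not> ?thesis"
    let ?P = "\<lambda>n v. v \<in> W \<and> inv (f ^^ n) v \<otimes> w \<in> N"
    have "\<exists>v. \<forall>n. ?P n (v n) \<and> inv f (v (Suc n)) \<otimes> v n \<in> N"
    proof (rule dependent_nat_choice)
      show "\<exists>v. ?P 0 v" using w by (intro exI[of _ w]) auto
      fix v n assume v: "?P n v"
      with contra have "v \<in> image_of N f" by blast
      then obtain u where u: "u \<in> W" "inv f u \<otimes> v \<in> N" using image_ofE[OF N(1) f] by blast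
      have fn_mult: "(f ^^ n) (inv a \<otimes> b) = inv (f ^^ n) a \<otimes> (f ^^ n) b" if "a \<in> W" "b \<in> W" for a b
        using that by (induction n) (simp_all add: Ops_mult[OF f] Ops_inv[OF f] fn_closed)
      have fu: "f u \<in> W" using Ops_closed[OF f u(1)] .
      have cl: "(f ^^ n) (f u) \<in> carrier X" "(f ^^ n) v \<in> carrier X" "w \<in> carrier X"
        using fn_closed[OF fu] fn_closed v w by auto
      have "inv (f ^^ n) (f u) \<otimes> (f ^^ n) v \<in> N"
        using fn_N[OF u(2), of n] fn_mult[OF fu] v by simp
      then have "(inv (f ^^ n) (f u) \<otimes> (f ^^ n) v) \<otimes> (inv (f ^^ n) v \<otimes> w) \<in> N"
        using v by blast
      then have "inv (f ^^ Suc n) u \<otimes> w \<in> N"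
        using cl by (simp add: X.m_assoc X.inv_mult_cancel funpow_swap1)
      with u show "\<exists>u. ?P (Suc n) u \<and> inv f u \<otimes> v \<in> N" by blast
    qed
    then obtain v where v: "\<And>n. v n \<in> W" "\<And>n. inv (f ^^ n) (v n) \<otimes> w \<in> N"
      "\<And>n. inv f (v (Suc n)) \<otimes> v n \<in> N" by metis
    have orb: "orbit N (v n) \<lhd> X" "orbit N (v n) \<subseteq> W" "N \<subseteq> orbit N (v n)" "v n \<in> orbit N (v n)" for n
      using orbit[OF N v(1)] by blast+
    have asc: "orbit N (v n) \<subseteq> orbit N (v (Suc n))" for n
    proof -
      have fv: "f (v (Suc n)) \<in> orbit N (v (Suc n))" by (rule Ops_normal[OF f orb(1,4)])
      have "v n \<in> orbit N (v (Suc n))"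
        using mem_mult_cancel[OF orb(1)[of "Suc n"], of "f (v (Suc n))" "v n"] fv v(1,3) orb(3) Ops_closed[OF f]
        by (meson W.mem_carrier subsetD)
      then have "g (v n) \<otimes> m \<in> orbit N (v (Suc n))" if "g \<in> Ops" "m \<in> N" for g m
        using Ops_normal[OF that(1) orb(1)] that(2) orb(3)
          subgroup.m_closed[OF normal_imp_subgroup[OF orb(1)]] by blast
      then show ?thesis unfolding orbit_def[of N "v n"] by blast
    qed
    obtain m where "orbit N (v (Suc m)) = orbit N (v m)"
    proof (rule acc_setsD[OF acc, of "\<lambda>n. orbit N (v n)"])
      show "orbit N (v n) \<in> {N. N \<lhd> X \<and> N \<subseteq> W}" for n using orb(1,2) by blast
      show "orbit N (v n) \<subseteq> orbit N (v (Suc n))" for n by (rule asc)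
      show thesis if "\<And>n. m \<le> n \<Longrightarrow> orbit N (v n) = orbit N (v m)"
        "\<And>m. orbit N (v (Suc m)) = orbit N (v m) \<Longrightarrow> thesis" for m thesis
        using that(2)[OF that(1)[of "Suc m"]] by simp
    qed
    \<comment> \<open>Stabilization makes \<open>v (Suc m)\<close> congruent to
      \<open>s (v m)\<close>, hence to \<open>s (f (v (Suc m)))\<close>. So \<open>s f - 1\<close>
      kills a nonzero element of \<open>W/N\<close>; by the dichotomy it is zero there, which makes
      \<open>f\<close> invertible.\<close>
    then have "v (Suc m) \<in> orbit N (v m)" using orb(4)[of "Suc m"] by simp
    then obtain s n where s: "s \<in> Ops" "n \<in> N" "v (Suc m) = s (v m) \<otimes> n" unfolding orbit_def by blast
    obtain e where e: "e \<in> Ops" "\<And>v. v \<in> carrier X \<Longrightarrow> e v = v" using Ops_id by blast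
    define g where "g x = inv e x \<otimes> s (f x)" for x
    have g: "g \<in> Ops"
      unfolding g_def[abs_def]
      by (rule group_ring_ops.add[OF group_ring_ops.neg[OF e(1)] group_ring_ops.comp[OF s(1) f]])
    have cl: "v m \<in> W" "v (Suc m) \<in> W" "f (v (Suc m)) \<in> W" "s (f (v (Suc m))) \<in> W" "s (v m) \<in> W"
      using v(1) f s(1) by (auto intro: Ops_closed)
    have "s (inv f (v (Suc m)) \<otimes> v m) \<in> N"
      by (rule Ops_normal[OF s(1) N(1) v(3)])
    then have "inv s (f (v (Suc m))) \<otimes> s (v m) \<in> N"
      using cl by (simp add: Ops_mult[OF s(1)] Ops_inv[OF s(1)])
    then have "(inv s (f (v (Suc m))) \<otimes> s (v m)) \<otimes> n \<in> N" using s(2) by blast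
    then have "inv ((inv s (f (v (Suc m))) \<otimes> s (v m)) \<otimes> n) \<in> N" by (rule N.m_inv_closed)
    moreover have "inv ((inv s (f (v (Suc m))) \<otimes> s (v m)) \<otimes> n) = g (v (Suc m))"
    proof -
      have "(inv s (f (v (Suc m))) \<otimes> s (v m)) \<otimes> n = inv s (f (v (Suc m))) \<otimes> v (Suc m)"
        using cl s(2) by (simp add: s(3) X.m_assoc)
      then show ?thesis using cl by (simp add: g_def e(2) X.inv_mult_group)
    qed
    ultimately have "v (Suc m) \<in> kernel_of N g" using v(1) by (simp add: kernel_of_def)
    moreover have "v (Suc m) \<notin> N"
    proof
      assume "v (Suc m) \<in> N"
      then have "(f ^^ Suc m) (v (Suc m)) \<in> N" by (rule fn_N)
      with w(2) show False
        using mem_mult_cancel[OF N(1) _ _ v(2)[of "Suc m"]] fn_closed[OF v(1)] w(1) by (meson W.mem_carrier)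
    qed
    ultimately have "kernel_of N g \<noteq> N" by blast
    with dichotomy[OF g] have "kernel_of N g = W" by (simp add: image_of_kernel_of[OF N g])
    have "inv x \<otimes> s (f x) \<in> N" if "x \<in> W" for x
    proof -
      have "g x \<in> N" using \<open>kernel_of N g = W\<close> that by (auto simp: kernel_of_def)
      then show ?thesis using e(2) that by (simp add: g_def)
    qed
    with nonunit[OF s(1)] show False by blast
  qed
  \<comment> \<open>The certificate is a pair \<open>(n, v)\<close> with \<open>v\<close> outside
    \<open>image_of N f\<close> and its image under \<open>f ^^ n\<close> congruent to
    \<open>w\<close>. Such a \<open>v\<close> is nonzero modulo \<open>N\<close>, and
    \<open>f\<close> is injective there, so \<open>w\<close> is nonzero too.\<close>
  have iff: "val w \<notin> N \<longleftrightarrow> val w \<notin> W \<or> (\<exists>p. (val (snd p) \<in> W \<and> val (snd p) \<notin> image_of N f) \<and>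
      val (word_inv ((\<phi> ^^ fst p) (snd p)) @ w) \<in> N)" for w
  proof
    assume w: "val w \<notin> N"
    show "val w \<notin> W \<or> (\<exists>p. (val (snd p) \<in> W \<and> val (snd p) \<notin> image_of N f) \<and>
      val (word_inv ((\<phi> ^^ fst p) (snd p)) @ w) \<in> N)"
    proof (cases "val w \<in> W")
      case True
      from ex[OF this w] obtain n x where x: "x \<in> W" "x \<notin> image_of N f" "inv (f ^^ n) x \<otimes> val w \<in> N"
        by blast
      obtain v where "val v = x" using val_surj[OF W.mem_carrier[OF x(1)]] by blast
      with x show ?thesis by (intro disjI2 exI[of _ "(n, v)"]) (simp add: val_append val_inv \<phi>n)
    qed simp
  next
    assume *: "val w \<notin> W \<or> (\<exists>p. (val (snd p) \<in> W \<and> val (snd p) \<notin> image_of N f) \<and>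
      val (word_inv ((\<phi> ^^ fst p) (snd p)) @ w) \<in> N)"
    show "val w \<notin> N"
    proof
      assume w: "val w \<in> N"
      with * N(2) obtain n v where v: "val v \<in> W" "val v \<notin> image_of N f"
        "inv (f ^^ n) (val v) \<otimes> val w \<in> N"
        by (auto simp: val_append val_inv \<phi>n)
      have "(f ^^ n) (val v) \<in> N"
        using mem_mult_cancel[OF N(1) _ _ v(3)] fn_closed[OF v(1)] w by simp
      then have "val v \<in> N" using v(1) by (rule fn_mem)
      with v(2) image_of(3)[OF N f] show False by blast
    qed
  qed
  have iter: "computable (\<lambda>x. (\<phi> ^^ (a x)) (b x))" if "computable a" "computable b" for a b
  proof -
    have "computable (\<lambda>x. rec_nat (b x) (\<lambda>k. \<phi>) (a x))"
      by (intro computable_rec_nat that computable_comp[OF \<phi>(1)] computable_intros)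
    moreover have "rec_nat y (\<lambda>k. \<phi>) n = (\<phi> ^^ n) y" for n y by (induction n) auto
    ultimately show ?thesis by simp
  qed
  show ?thesis
    unfolding iff
    by (intro semidecidable_disj semidecidable_ex semidecidable_conj)
      (intro semidecidable_computable computable_intros computable_comp[OF im] computable_comp[OF decidable_W]
        semidecidable_comp[OF semidecidable_mem[OF N]] iter)+
qed

text \<open>
  If all operators are zero or invertible on \<open>W/N\<close>, then \<open>u\<close> can be recovered from each of its
  nonzero multiples.
\<close>

lemma semidecidable_not_mem_field:
  assumes N: "N \<lhd> X" "N \<subseteq> W" and u: "u \<in> W" "u \<notin> N"
    and units: "\<And>f. f \<in> Ops \<Longrightarrow> image_of N f = N \<or> (\<exists>s\<in>Ops. \<forall>v\<in>W. inv v \<otimes> s (f v) \<in> N)"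
    and orb: "computable (\<lambda>w. val w \<in> orbit N u)"
  shows "semidecidable (\<lambda>w. val w \<notin> N)"
proof -
  interpret N: normal N X by fact
  obtain ps where ps: "N = normal_closure X (val ` set ps)" using finitely_generated[OF N] .
  obtain c where c: "val c = u" using val_surj[OF W.mem_carrier[OF u(1)]] by blast
  \<comment> \<open>Inside the orbit, \<open>w\<close> is congruent to some \<open>f u\<close>. If
    it is nonzero, an inverse of \<open>f\<close> brings \<open>u\<close> back, so killing
    \<open>N\<close> and \<open>w\<close> also kills \<open>u\<close>. If \<open>w\<close> lies in
    \<open>N\<close>, nothing new is killed and \<open>u\<close> survives.\<close>
  have iff: "val w \<notin> N \<longleftrightarrow> val w \<notin> orbit N u \<or> val c \<in> normal_closure X (val ` set (w # ps))" for w
  proof -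
    let ?K = "normal_closure X (val ` set (w # ps))"
    have K: "?K \<lhd> X" by (rule X.normal_closure_normal) auto
    interpret K: normal ?K X by (rule K)
    have wK: "val w \<in> ?K" using X.normal_closure_superset[of "val ` set (w # ps)"] by auto
    have NK: "N \<subseteq> ?K"
      unfolding ps using X.normal_closure_superset[of "val ` set (w # ps)"]
      by (intro X.normal_closure_minimal K) auto
    show ?thesis
    proof
      assume w: "val w \<notin> N"
      show "val w \<notin> orbit N u \<or> val c \<in> ?K"
      proof (cases "val w \<in> orbit N u")
        case True
        then obtain f n where f: "val w = f u \<otimes> n" "f \<in> Ops" "n \<in> N" unfolding orbit_def by blast
        have fu: "f u \<in> W" by (rule Ops_closed[OF f(2) u(1)])
        have "f u \<notin> N" using w f by auto
        then have "kernel_of N f \<noteq> W" using u(1) by (auto simp: kernel_of_def)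
        then obtain s where s: "s \<in> Ops" "inv u \<otimes> s (f u) \<in> N"
          using units[OF f(2)] image_of_kernel_of[OF N f(2)] u(1) by blast
        have fu_eq: "f u = val w \<otimes> inv n" using f fu by (simp add: X.m_assoc)
        have "n \<in> ?K" using NK f(3) by blast
        then have "f u \<in> ?K" unfolding fu_eq by (intro K.m_closed K.m_inv_closed wK)
        then have "s (f u) \<in> ?K" by (rule Ops_normal[OF s(1) K])
        then have "u \<in> ?K"
          using mem_mult_cancel[OF K, of u "s (f u)"] s(2) NK u(1) by auto
        then show ?thesis by (simp add: c)
      qed simp
    next
      assume *: "val w \<notin> orbit N u \<or> val c \<in> ?K"
      show "val w \<notin> N"
      proof
        assume w: "val w \<in> N"
        then have "val w \<in> orbit N u" using orbit(3)[OF N u(1)] by blast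
        with * have "u \<in> ?K" by (simp add: c)
        moreover have "?K \<subseteq> N"
          using w X.normal_closure_superset[of "val ` set ps"] by (intro X.normal_closure_minimal N) (auto simp: ps)
        ultimately show False using u(2) by blast
      qed
    qed
  qed
  have "semidecidable (\<lambda>w. val (snd (w # ps, c)) \<in> normal_closure X (val ` set (fst (w # ps, c))))"
    by (rule semidecidable_comp[OF semidecidable_closure]) (intro computable_intros)
  then have "semidecidable (\<lambda>w. val c \<in> normal_closure X (val ` set (w # ps)))" by simp
  then show ?thesis
    unfolding iff by (intro semidecidable_disj) (intro semidecidable_computable computable_intros orb)
qed

text \<open>The cases concern the fixed \<open>N\<close> and not the input word, so a classical case
  distinction is harmless. In each of them the auxiliary submodules strictly contain
  \<open>N\<close>, and semidecidability of both membership and non-membership gives an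
  algorithm.\<close>

theorem decidable_normal_subgroup:
  assumes "N \<lhd> X" "N \<subseteq> W"
  shows "computable (\<lambda>w. val w \<in> N)"
proof -
  have "N \<in> {N. N \<lhd> X \<and> N \<subseteq> W}" using assms by blast
  with acc show ?thesis
  proof (rule acc_sets_induct[where P = "\<lambda>N. computable (\<lambda>w. val w \<in> N)"])
    fix N assume "N \<in> {N. N \<lhd> X \<and> N \<subseteq> W}"
    then have N: "N \<lhd> X" "N \<subseteq> W" by auto
    assume IH: "\<And>K. K \<in> {N. N \<lhd> X \<and> N \<subseteq> W} \<Longrightarrow> N \<subset> K \<Longrightarrow> computable (\<lambda>w. val w \<in> K)"
    have IH': "computable (\<lambda>w. val w \<in> K)" if "K \<lhd> X" "K \<subseteq> W" "N \<subseteq> K" "K \<noteq> N" for K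
      using IH[of K] that by blast
    show "computable (\<lambda>w. val w \<in> N)"
    proof (cases "N = W")
      case True
      then show ?thesis using decidable_W by simp
    next
      case False
      then obtain u where u: "u \<in> W" "u \<notin> N" using N(2) by blast
      have "semidecidable (\<lambda>w. val w \<notin> N)"
      proof (cases "\<exists>f\<in>Ops. image_of N f \<noteq> N \<and> kernel_of N f \<noteq> N")
        case True
        then obtain f where f: "f \<in> Ops" "image_of N f \<noteq> N" "kernel_of N f \<noteq> N" by blast
        show ?thesis
          by (rule semidecidable_not_mem_zero_divisor[OF N f(1) IH'[OF image_of[OF N f(1)] f(2)]
            IH'[OF kernel_of[OF N f(1)] f(3)]])
      next
        case nzd: False
        show ?thesis
        proof (cases "\<exists>f\<in>Ops. kernel_of N f = N \<and> (\<forall>s\<in>Ops. \<exists>v\<in>W. inv v \<otimes> s (f v) \<notin> N)")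
          case True
          then obtain f where f: "f \<in> Ops" "kernel_of N f = N"
            "\<And>s. s \<in> Ops \<Longrightarrow> \<exists>v\<in>W. inv v \<otimes> s (f v) \<notin> N" by blast
          have "image_of N f \<noteq> N" using f(2) False image_of_kernel_of[OF N f(1)] by simp
          from IH'[OF image_of[OF N f(1)] this] show ?thesis
            using nzd f by (intro semidecidable_not_mem_nonunit[OF N f(1)]) auto
        next
          case False
          have "orbit N u \<noteq> N" using orbit(4)[OF N u(1)] u(2) by blast
          from IH'[OF orbit(1-3)[OF N u(1)] this] show ?thesis
          proof (rule semidecidable_not_mem_field[OF N u, rotated])
            fix f assume f: "f \<in> Ops"
            show "image_of N f = N \<or> (\<exists>s\<in>Ops. \<forall>v\<in>W. inv v \<otimes> s (f v) \<in> N)"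
            proof (cases "kernel_of N f = N")
              case True
              with False f show ?thesis by blast
            next
              case False
              with nzd f show ?thesis by blast
            qed
          qed
        qed
      qed
      with semidecidable_mem[OF N] show ?thesis by (rule computable_by_semidecidable)
    qed
  qed
qed

end

section \<open>The word problem in the weak commutativity group\<close>

lemma finitely_presentedE:
  fixes G :: "('a, 'b) monoid_scheme"
  assumes "group G" and "finitely_presented G"
  obtains n :: nat and \<phi> :: "word set \<Rightarrow> 'a" and R and gs :: "'a list"
  where "\<phi> \<in> hom (free_group {..<n}) G" "\<phi> ` carrier (free_group {..<n}) = carrier G"
    "finite R" "R \<subseteq> kernel (free_group {..<n}) G \<phi>"
    "\<And>N. N \<lhd> free_group {..<n} \<Longrightarrow> R \<subseteq> N \<Longrightarrow> kernel (free_group {..<n}) G \<phi> \<subseteq> N"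
    "set gs \<subseteq> carrier G" "carrier G \<subseteq> range (word_val G (gens_fun G gs))"
proof -
  interpret G: group G by fact
  obtain n :: nat and R where R: "finite R" "R \<subseteq> carrier (free_group {..<n})"
    and iso: "G \<cong> free_group {..<n} Mod normal_closure (free_group {..<n}) R"
    using assms(2) unfolding finitely_presented_def by blast
  let ?F = "free_group {..<n}"
  let ?N = "normal_closure ?F R"
  interpret F: group ?F by (rule group_free_group)
  interpret N: normal ?N ?F by (rule F.normal_closure_normal[OF R(2)])
  interpret Q: group "?F Mod ?N" by (rule N.factorgroup_is_group)
  obtain \<theta> where \<theta>: "\<theta> \<in> iso (?F Mod ?N) G"
    using G.iso_sym[OF iso] by (auto simp: is_iso_def)
  interpret \<pi>: group_hom ?F "?F Mod ?N" "\<lambda>f. ?N #>\<^bsub>?F\<^esub> f" by unfold_locales (rule N.r_coset_hom_Mod)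
  interpret \<theta>: group_hom "?F Mod ?N" G \<theta> by unfold_locales (use \<theta> in \<open>simp add: iso_def\<close>)
  define \<phi> where "\<phi> f = \<theta> (?N #>\<^bsub>?F\<^esub> f)" for f
  have \<phi>: "\<phi> \<in> hom ?F G"
    using Group.hom_compose[OF \<pi>.homh \<theta>.homh] by (simp add: \<phi>_def[abs_def] comp_def)
  interpret \<phi>: group_hom ?F G \<phi> by unfold_locales (rule \<phi>)
  have surj: "\<phi> ` carrier ?F = carrier G"
  proof -
    have "\<theta> ` carrier (?F Mod ?N) = carrier G" using \<theta> by (simp add: iso_def bij_betw_def)
    then show ?thesis by (simp add: \<phi>_def[abs_def] carrier_FactGroup image_image)
  qed
  have inj: "inj_on \<theta> (carrier (?F Mod ?N))" using \<theta> by (simp add: iso_def bij_betw_def)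
  have kernel: "kernel ?F G \<phi> = ?N"
  proof
    show "kernel ?F G \<phi> \<subseteq> ?N"
    proof
      fix f assume f: "f \<in> kernel ?F G \<phi>"
      then have "\<theta> (?N #>\<^bsub>?F\<^esub> f) = \<theta> \<one>\<^bsub>?F Mod ?N\<^esub>" by (simp only: \<phi>_def kernel_def mem_Collect_eq \<theta>.hom_one)
      moreover have "?N #>\<^bsub>?F\<^esub> f \<in> carrier (?F Mod ?N)" using f \<pi>.hom_closed by (auto simp: kernel_def)
      ultimately have "?N #>\<^bsub>?F\<^esub> f = \<one>\<^bsub>?F Mod ?N\<^esub>" using inj Q.one_closed by (simp only: inj_on_eq_iff)
      then have "?N #>\<^bsub>?F\<^esub> f = ?N" by (simp only: one_FactGroup)
      moreover have "f \<in> carrier ?F" using f by (simp add: kernel_def)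
      ultimately show "f \<in> ?N" using F.coset_join1[OF _ _ N.subgroup_axioms] by blast
    qed
    show "?N \<subseteq> kernel ?F G \<phi>"
    proof
      fix f assume f: "f \<in> ?N"
      then have "?N #>\<^bsub>?F\<^esub> f = \<one>\<^bsub>?F Mod ?N\<^esub>" using N.rcos_const[OF F.is_group f] by (simp only: one_FactGroup)
      then have "\<phi> f = \<one>\<^bsub>G\<^esub>" by (simp only: \<phi>_def \<theta>.hom_one)
      with f show "f \<in> kernel ?F G \<phi>" by (simp add: kernel_def)
    qed
  qed
  let ?S = "{..<n} \<times> (UNIV :: bool set)"
  let ?E = "{([(x, b), (x, \<not> b)], []) |x b. x \<in> {..<n}}"
  let ?cl = "\<lambda>w. word_cong ?S ?E `` {w}"
  have F: "?F = word_quotient ?S ?E" by (simp add: free_group_def)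
  have cl: "?cl w \<in> carrier ?F" if "w \<in> lists ?S" for w
    unfolding F word_quotient_carrier using that by blast
  have cl_Cons: "?cl (l # w) = ?cl [l] \<otimes>\<^bsub>?F\<^esub> ?cl w" if "l \<in> ?S" "w \<in> lists ?S" for l w
    using that word_quotient_mult[of "[l]" ?S w ?E] by (simp add: F)
  have cl_inv: "?cl [(i, False)] = inv\<^bsub>?F\<^esub> ?cl [(i, True)]" if i: "i < n" for i
  proof (rule F.inv_equality[symmetric])
    have "([(i, False), (i, True)], []) \<in> word_cong ?S ?E"
      using word_cong.base[of "[(i, False), (i, True)]" "[]" ?E ?S "[]" "[]"] i by auto
    then have "?cl [(i, False), (i, True)] = ?cl []"
      using i by (subst word_cong_class_eq) auto
    also have "?cl [] = \<one>\<^bsub>?F\<^esub>" by (simp add: F word_quotient_one)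
    finally show "?cl [(i, False)] \<otimes>\<^bsub>?F\<^esub> ?cl [(i, True)] = \<one>\<^bsub>?F\<^esub>"
      using cl_Cons[of "(i, False)" "[(i, True)]"] i by simp
  qed (use cl i in auto)
  \<comment> \<open>The images of the free generators, so that the same letters can be read in the
    free group and in \<open>G\<close>.\<close>
  define gs where "gs = map (\<lambda>i. \<phi> (?cl [(i, True)])) [0..<n]"
  have gs_in: "set gs \<subseteq> carrier G"
    using cl by (auto simp: gs_def)
  have val: "\<phi> (?cl w) = word_val G (gens_fun G gs) w" if "w \<in> lists ?S" for w
    using that
  proof (induction w)
    case Nil
    have "?cl [] = \<one>\<^bsub>?F\<^esub>" by (simp add: F word_quotient_one)
    then show ?case by simp
  next
    case (Cons l w)
    obtain i b where l: "l = (i, b)" "i < n" using Cons.hyps by auto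
    have "\<phi> (?cl (l # w)) = \<phi> (?cl [l]) \<otimes>\<^bsub>G\<^esub> \<phi> (?cl w)"
      using Cons.hyps cl by (subst cl_Cons) auto
    also have "\<phi> (?cl [l]) = (if b then gens_fun G gs i else inv\<^bsub>G\<^esub> gens_fun G gs i)"
      using l cl cl_inv[OF l(2)] by (simp add: gens_fun_def gs_def)
    finally show ?case using Cons.IH l by (simp add: word_val_Cons)
  qed
  have "carrier G \<subseteq> range (word_val G (gens_fun G gs))"
  proof
    fix g assume "g \<in> carrier G"
    then obtain f where "f \<in> carrier ?F" "g = \<phi> f" using surj by blast
    then obtain w where "w \<in> lists ?S" "g = \<phi> (?cl w)" unfolding F word_quotient_carrier by blast
    then show "g \<in> range (word_val G (gens_fun G gs))" by (simp only: val rangeI)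
  qed
  moreover have "R \<subseteq> kernel ?F G \<phi>" unfolding kernel by (rule F.normal_closure_superset)
  moreover have "kernel ?F G \<phi> \<subseteq> N" if "N \<lhd> ?F" "R \<subseteq> N" for N
    unfolding kernel using that by (rule F.normal_closure_minimal)
  ultimately show thesis using that[OF \<phi> surj R(1)] gs_in by blast
qed

lemma finite_range_gens_fun: "finite (range (gens_fun G gs))"
  by (rule finite_subset[of _ "insert \<one>\<^bsub>G\<^esub> (set gs)"]) (auto simp: gens_fun_def)

lemma (in group) \<XX>_weakly_commuting:
  obtains p q r where "weakly_commuting G (\<XX> G) (\<XX>_inl G) (\<XX>_inr G) p q r"
proof -
  have one: "(\<lambda>g. \<one>) \<in> hom G G" and id: "(\<lambda>g. g) \<in> hom G G" by (auto simp: hom_def)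
  obtain p where p: "p \<in> hom (\<XX> G) G" "\<And>g. g \<in> carrier G \<Longrightarrow> p (\<XX>_inl G g) = g"
    "\<And>g. g \<in> carrier G \<Longrightarrow> p (\<XX>_inr G g) = \<one>"
    using \<XX>_universal[OF is_group id one] by auto
  obtain q where q: "q \<in> hom (\<XX> G) G" "\<And>g. g \<in> carrier G \<Longrightarrow> q (\<XX>_inl G g) = \<one>"
    "\<And>g. g \<in> carrier G \<Longrightarrow> q (\<XX>_inr G g) = g"
    using \<XX>_universal[OF is_group one id] by auto
  obtain r where r: "r \<in> hom (\<XX> G) G" "\<And>g. g \<in> carrier G \<Longrightarrow> r (\<XX>_inl G g) = g"
    "\<And>g. g \<in> carrier G \<Longrightarrow> r (\<XX>_inr G g) = g"
    using \<XX>_universal[OF is_group id id] by auto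
  have "weakly_commuting G (\<XX> G) (\<XX>_inl G) (\<XX>_inr G) p q r"
    by (intro weakly_commuting.intro weakly_commuting_axioms.intro is_group group_\<XX> \<XX>_inl_hom \<XX>_inr_hom
        \<XX>_commute \<XX>_generated p q r)
  then show thesis by (rule that)
qed

lemma (in weakly_commuting) acc_W:
  fixes n :: nat
  assumes \<phi>: "\<phi> \<in> hom (free_group {..<n}) G" "\<phi> ` carrier (free_group {..<n}) = carrier G"
    and R: "finite R" "R \<subseteq> kernel (free_group {..<n}) G \<phi>"
      "\<And>N. N \<lhd> free_group {..<n} \<Longrightarrow> R \<subseteq> N \<Longrightarrow> kernel (free_group {..<n}) G \<phi> \<subseteq> N"
    and A: "finite A" "A \<subseteq> carrier G" "generate G A = carrier G"
  shows "acc_sets {N. N \<lhd> X \<and> N \<subseteq> D \<inter> L}"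
proof -
  interpret F: group "free_group {..<n}" by (rule group_free_group)
  interpret \<phi>: group_hom "free_group {..<n}" G \<phi> by unfold_locales (rule \<phi>)
  interpret D: normal D X by (rule normal_D)
  obtain \<sigma> where \<sigma>:
    "\<And>f. f \<in> carrier (free_group {..<n}) \<Longrightarrow> \<phi> f \<in> r ` D \<Longrightarrow> \<sigma> f \<in> D \<and> r (\<sigma> f) = \<phi> f"
    "\<And>f f'. f \<in> carrier (free_group {..<n}) \<Longrightarrow> f' \<in> carrier (free_group {..<n}) \<Longrightarrow> \<phi> f \<in> r ` D \<Longrightarrow>
      \<phi> f' \<in> r ` D \<Longrightarrow> \<sigma> (f \<otimes>\<^bsub>free_group {..<n}\<^esub> f') = \<sigma> f \<otimes> \<sigma> f'"
    using free_group_section[OF X.is_group G.is_group r(1) \<phi>(1) D.subgroup_axioms] by blast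
  \<comment> \<open>Commutators of pairs of generators normally generate \<open>D\<close> by
    \<open>D_subset_normal_gens\<close>, so finitely many suffice.\<close>
  let ?A = "(\<lambda>(a, b). commutator X (i a) (j b)) ` (A \<times> A)" and ?Y = "i ` A \<union> j ` A"
  have YX: "?Y \<subseteq> carrier X" using A(2) by auto
  have Y: "generate X ?Y = carrier X"
  proof (rule generated)
    show "subgroup (generate X ?Y) X" by (rule X.generate_is_subgroup[OF YX])
    have "f ` carrier G \<subseteq> generate X ?Y" if "group_hom G X f" "f ` A \<subseteq> ?Y" for f
      using group_hom.generate_img[OF that(1) A(2)] X.mono_generate[OF that(2)] A(3) by simp
    then show "i ` carrier G \<subseteq> generate X ?Y" "j ` carrier G \<subseteq> generate X ?Y"
      using i.group_hom_axioms j.group_hom_axioms by blast+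
  qed
  interpret lifted_crossed_module X G "free_group {..<n}" r \<phi> D ?A ?Y R \<sigma>
  proof (unfold_locales)
    show "r ` carrier X = carrier G"
    proof
      show "carrier G \<subseteq> r ` carrier X"
      proof
        fix g assume "g \<in> carrier G"
        then have "g = r (i g)" "i g \<in> carrier X" by (simp_all add: r)
        then show "g \<in> r ` carrier X" by blast
      qed
    qed auto
    show "d \<otimes> l = l \<otimes> d" if "d \<in> D" "l \<in> kernel X G r" for d l
      using that D_L_commute by (simp add: L_def)
    show "\<exists>d\<in>D. r d = r (commutator X x y)" if "x \<in> carrier X" "y \<in> carrier X" for x y
      using commutator_eq_mod_L[OF that] by blast
    show "finite ?A" "finite ?Y" using A(1) by auto
    show "?Y \<subseteq> carrier X" by (rule YX)
    show "carrier X \<subseteq> generate X ?Y" by (simp add: Y)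
    show "?A \<subseteq> D"
    proof (rule image_subsetI)
      fix ab assume "ab \<in> A \<times> A"
      then obtain a b where ab: "ab = (a, b)" "a \<in> carrier G" "b \<in> carrier G" using A(2) by auto
      show "(case ab of (a, b) \<Rightarrow> commutator X (i a) (j b)) \<in> D"
        using ab commutator_in_D by simp
    qed
    show "D \<subseteq> N" if N: "N \<lhd> X" "?A \<subseteq> N" for N
    proof (rule D_subset_normal_gens[OF N(1) A(2,3)])
      show "commutator X (i a) (j b) \<in> N" if "a \<in> A" "b \<in> A" for a b
        using that N(2) by auto
    qed
  qed (use \<phi>(2) R \<sigma> in auto)
  show ?thesis using acc_normal_subgroups by (simp add: L_def)
qed

lemma (in group) soluble_\<XX>:
  assumes fp: "finitely_presented G" and sol: "soluble_word_problem G"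
  shows "soluble_word_problem (\<XX> G)"
proof -
  obtain n :: nat and \<phi> R and gs :: "'a list" where \<phi>: "\<phi> \<in> hom (free_group {..<n}) G"
    "\<phi> ` carrier (free_group {..<n}) = carrier G"
    and R: "finite R" "R \<subseteq> kernel (free_group {..<n}) G \<phi>"
    "\<And>N. N \<lhd> free_group {..<n} \<Longrightarrow> R \<subseteq> N \<Longrightarrow> kernel (free_group {..<n}) G \<phi> \<subseteq> N"
    and gs: "set gs \<subseteq> carrier G" "carrier G \<subseteq> range (word_val G (gens_fun G gs))"
    by (rule finitely_presentedE[OF is_group fp]) (rule that)
  let ?a = "gens_fun G gs"
  have a: "range ?a \<subseteq> carrier G" by (rule range_gens_fun[OF gs(1)])
  obtain gs' where gs': "set gs' \<subseteq> carrier G" "carrier G \<subseteq> range (word_val G (gens_fun G gs'))"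
    "computable (\<lambda>w. word_val G (gens_fun G gs') w = \<one>)"
    using sol unfolding soluble_word_problem_iff by blast
  \<comment> \<open>The tuple that witnesses solubility need not be the one coming from the
    presentation; the identity homomorphism transfers the algorithm.\<close>
  have "(\<lambda>g. g) \<in> hom G G" by (simp add: hom_def)
  from computable_hom_word_val[OF is_group this a _ range_gens_fun[OF gs'(1)] gs'(2,3), of "length gs"]
  have dec: "computable (\<lambda>w. word_val G ?a w = \<one>)" by (simp add: gens_fun_def)
  obtain p q r where "weakly_commuting G (\<XX> G) (\<XX>_inl G) (\<XX>_inr G) p q r"
    by (rule \<XX>_weakly_commuting)
  then interpret X: weakly_commuting G "\<XX> G" "\<XX>_inl G" "\<XX>_inr G" p q r .
  let ?x = "\<XX>_gens G ?a"
  have x: "range ?x \<subseteq> carrier (\<XX> G)" by (rule \<XX>_gens_closed[OF a])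
  have x_gen: "carrier (\<XX> G) \<subseteq> range (word_val (\<XX> G) ?x)" using \<XX>_gens_generate[OF a gs(2)] by simp
  \<comment> \<open>The two copies are interleaved, which accounts for the factor 2.\<close>
  have x_fin: "?x i = \<one>\<^bsub>\<XX> G\<^esub>" if "2 * length gs \<le> i" for i
    using that by (auto simp: \<XX>_gens_def gens_fun_def)
  have proj: "computable (\<lambda>w. h (word_val (\<XX> G) ?x w) = \<one>)" if "h \<in> hom (\<XX> G) G" for h
    using X.X.computable_hom_word_val[OF is_group that x x_fin a gs(2) dec] .
  have W: "computable (\<lambda>w. word_val (\<XX> G) ?x w \<in> X.D \<inter> X.L)"
  proof -
    have "computable (\<lambda>w. p (word_val (\<XX> G) ?x w) = \<one> \<and> q (word_val (\<XX> G) ?x w) = \<one> \<and> r (word_val (\<XX> G) ?x w) = \<one>)"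
      by (intro computable_conj proj X.p X.q X.r)
    moreover have "word_val (\<XX> G) ?x w \<in> X.D \<inter> X.L \<longleftrightarrow>
      p (word_val (\<XX> G) ?x w) = \<one> \<and> q (word_val (\<XX> G) ?x w) = \<one> \<and> r (word_val (\<XX> G) ?x w) = \<one>" for w
      using X.X.word_val_closed[OF x] by (auto simp: X.D_def X.L_def kernel_def)
    ultimately show ?thesis by (simp only:)
  qed
  have gen: "generate G (range ?a) = carrier G"
    using generate_range_eq[OF a] gs(2) word_val_closed[OF a] by auto
  interpret W: normal "X.D \<inter> X.L" "\<XX> G" by (rule X.normal_W)
  interpret N: noetherian_normal_subgroup "\<XX> G" "X.D \<inter> X.L" ?x
  proof unfold_locales
    show "u \<otimes>\<^bsub>\<XX> G\<^esub> v = v \<otimes>\<^bsub>\<XX> G\<^esub> u" if "u \<in> X.D \<inter> X.L" "v \<in> X.D \<inter> X.L" for u v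
      using that X.D_L_commute by blast
    show "acc_sets {N. N \<lhd> \<XX> G \<and> N \<subseteq> X.D \<inter> X.L}"
      by (rule X.acc_W[OF \<phi> R finite_range_gens_fun a gen])
  qed (use X.W_conj_commute x x_gen semidecidable_normal_closure_\<XX>[OF a gs(2) dec] W in auto)
  have "{\<one>\<^bsub>\<XX> G\<^esub>} \<lhd> \<XX> G"
    by (rule X.X.one_is_normal)
  from N.decidable_normal_subgroup[OF this] have dec_X: "computable (\<lambda>w. word_val (\<XX> G) ?x w = \<one>\<^bsub>\<XX> G\<^esub>)"
    using W.one_closed by simp
  let ?gs = "map ?x [0..<2 * length gs]"
  have "gens_fun (\<XX> G) ?gs = ?x"
    using x_fin by (auto simp: gens_fun_def fun_eq_iff)
  moreover have "set ?gs \<subseteq> carrier (\<XX> G)" using x by auto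
  ultimately show ?thesis
    unfolding X.X.soluble_word_problem_iff using x_gen dec_X by (intro exI[of _ ?gs]) (simp only: simp_thms)
qed

lemma (in group) soluble_if_soluble_\<XX>:
  assumes fp: "finitely_presented G" and sol: "soluble_word_problem (\<XX> G)"
  shows "soluble_word_problem G"
proof -
  obtain gs :: "'a list" where gs: "set gs \<subseteq> carrier G" "carrier G \<subseteq> range (word_val G (gens_fun G gs))"
    by (rule finitely_presentedE[OF is_group fp]) (rule that)
  have a: "range (gens_fun G gs) \<subseteq> carrier G" by (rule range_gens_fun[OF gs(1)])
  interpret X: group "\<XX> G" by (rule group_\<XX>) (rule is_group)
  interpret inl: group_hom G "\<XX> G" "\<XX>_inl G" by unfold_locales (rule \<XX>_inl_hom)
  obtain p q r where "weakly_commuting G (\<XX> G) (\<XX>_inl G) (\<XX>_inr G) p q r"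
    by (rule \<XX>_weakly_commuting)
  then interpret weakly_commuting G "\<XX> G" "\<XX>_inl G" "\<XX>_inr G" p q r .
  obtain gs' where gs': "set gs' \<subseteq> carrier (\<XX> G)" "carrier (\<XX> G) \<subseteq> range (word_val (\<XX> G) (gens_fun (\<XX> G) gs'))"
    "computable (\<lambda>w. word_val (\<XX> G) (gens_fun (\<XX> G) gs') w = \<one>\<^bsub>\<XX> G\<^esub>)"
    using sol unfolding X.soluble_word_problem_iff by blast
  have "computable (\<lambda>w. \<XX>_inl G (word_val G (gens_fun G gs) w) = \<one>\<^bsub>\<XX> G\<^esub>)"
    by (rule computable_hom_word_val[OF X.is_group \<XX>_inl_hom a _ X.range_gens_fun[OF gs'(1)] gs'(2,3), of "length gs"])
      (simp add: gens_fun_def)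
  moreover have "\<XX>_inl G g = \<one>\<^bsub>\<XX> G\<^esub> \<longleftrightarrow> g = \<one>" if "g \<in> carrier G" for g
    using p(2)[OF that] p.hom_one inl.hom_one by metis
  ultimately have "computable (\<lambda>w. word_val G (gens_fun G gs) w = \<one>)"
    using word_val_closed[OF a] by simp
  then show ?thesis unfolding soluble_word_problem_iff using gs by blast
qed

theorem theoremF:
  fixes G :: "('a, 'b) monoid_scheme"
  assumes "group G" and "finitely_presented G"
  shows "soluble_word_problem (\<XX> G) \<longleftrightarrow> soluble_word_problem G"
  using group.soluble_\<XX>[OF assms] group.soluble_if_soluble_\<XX>[OF assms] by blast

end
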